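(* There is a constant $K>0$ such that the following holds for every holomorphic function $\varphi:\mathbb{D}\to\mathbb{D}$ for which $C_\varphi$ is continuous on $\mathcal{Z}^{v_{\log}}$. Put $$M(\varphi)=\max\left\{\limsup_{n\to\infty}\frac{(n+2)(n+1)\,\|J'_{\varphi'}(\varphi^n)\|_{\mathcal{Z}^{v_{\log}}}}{\|g_{n+2}\|_{\mathcal{Z}^{w_{\log}}}},\ \limsup_{n\to\infty}\frac{(n+1)\,\|I'_{\varphi'}(\varphi^n)\|_{\mathcal{Z}^{v_{\log}}}}{\|g_{n+1}\|_{\mathcal{Z}^{v_{\log}}}}\right\}.$$ Then $$\frac1K\,M(\varphi)\ \le\ \|C_\varphi\|_e^{\mathcal{Z}^{v_{\log}}\to\mathcal{Z}^{v_{\log}}}\ \le\ K\,M(\varphi).$$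
   Context: $\mathbb{D}$ is the open unit disk of $\mathbb{C}$ and $H(\mathbb{D})$ is the space of holomorphic functions on $\mathbb{D}$. The weights used are $v_{\log}(z)=(1-|z|)\log\left(\frac{2}{1-|z|}\right)$ and $w_{\log}(z)=\left[\log\log\left(\frac{4}{1-|z|^2}\right)\right]^{-1}$, $z\in\mathbb{D}$. For $v\in\{v_{\log},w_{\log}\}$, $\mathcal{Z}^v$ is the Banach space of all $f\in H(\mathbb{D})$ with $\sup_{z\in\mathbb{D}}v(z)|f''(z)|<\infty$, normed by $\|f\|_{\mathcal{Z}^v}=|f(0)|+|f'(0)|+\sup_{z\in\mathbb{D}}v(z)|f''(z)|$. $C_\varphi(f)=f\circ\varphi$. For holomorphic $u:\mathbb{D}\to\mathbb{C}$ and $f\in H(\mathbb{D})$, define the holomorphic functions $I_u(f)(z)=\int_0^z f'(s)u(s)\,ds$, $J_u(f)(z)=\int_0^z f(s)u'(s)\,ds$, $I'_u(f)(z)=\int_0^z I_u(f)(s)\,ds$ and $J'_u(f)(z)=\int_0^z J_u(f)(s)\,ds$ (here the prime on $I'_u,J'_u$ is part of the name, not a derivative). In the claim $u=\varphi'$. $\varphi^n$ is the pointwise $n$-th power of $\varphi$, and $g_n(z)=z^n$. The essential norm of a continuous linear operator $T:X\to Y$ between Banach spaces is $\|T\|_e^{X\to Y}=\inf\{\|T-K\|^{X\to Y}: K:X\to Y \text{ compact linear operator}\}$, where $\|\cdot\|^{X\to Y}$ is the operator norm. *)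

theory Defs
  imports "HOL-Complex_Analysis.Complex_Analysis"
begin

section \<open>Complex normed spaces, compact operators, essential norm\<close>

class scaleC =
  fixes scaleC :: "complex \<Rightarrow> 'a \<Rightarrow> 'a"

class complex_normed_vector = real_normed_vector + scaleC +
  assumes scaleC_add_right: "scaleC a (x + y) = scaleC a x + scaleC a y"
    and scaleC_add_left: "scaleC (a + b) x = scaleC a x + scaleC b x"
    and scaleC_scaleC: "scaleC a (scaleC b x) = scaleC (a * b) x"
    and scaleR_scaleC: "scaleR r x = scaleC (of_real r) x"
    and norm_scaleC: "norm (scaleC a x) = norm a * norm x"

lemma vector_space_scaleC:
  "vector_space (scaleC :: complex \<Rightarrow> 'a \<Rightarrow> 'a::complex_normed_vector)"
proof
  fix x :: 'a
  show "scaleC 1 x = x"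
    using scaleR_scaleC[of 1 x] by simp
qed (simp_all add: scaleC_add_right scaleC_add_left scaleC_scaleC)

definition compact_operator ::
    "('a::complex_normed_vector \<Rightarrow> 'b::complex_normed_vector) \<Rightarrow> bool" where
  "compact_operator K \<longleftrightarrow>
     Vector_Spaces.linear scaleC scaleC K \<and> compact (closure (K ` cball 0 1))"

definition ess_norm ::
    "('a::complex_normed_vector \<Rightarrow> 'b::complex_normed_vector) \<Rightarrow> real" where
  "ess_norm T = (INF K\<in>{K. compact_operator K}. onorm (\<lambda>x. T x - K x))"

section \<open>Weighted Zygmund-type spaces\<close>

abbreviation unit_disc :: "complex set" (\<open>\<bbbD>\<close>) where
  "\<bbbD> \<equiv> ball 0 1"

definition v_log :: "complex \<Rightarrow> real" where
  "v_log z = (1 - norm z) * ln (2 / (1 - norm z))"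

definition w_log :: "complex \<Rightarrow> real" where
  "w_log z = inverse (ln (ln (4 / (1 - (norm z)\<^sup>2))))"

text \<open>A function on the disc is represented by its extension by zero, so that equality in
  the space is equality of functions.\<close>

definition zygmund :: "(complex \<Rightarrow> real) \<Rightarrow> (complex \<Rightarrow> complex) set" where
  "zygmund v = {f. f holomorphic_on \<bbbD> \<and> (\<forall>z. z \<notin> \<bbbD> \<longrightarrow> f z = 0) \<and>
     bdd_above ((\<lambda>z. v z * norm (deriv (deriv f) z)) ` \<bbbD>)}"

text \<open>The norm only sees the values of \<open>f\<close> on the disc, so it is also
  applied to functions that are not zero elsewhere.\<close>

definition zygmund_norm :: "(complex \<Rightarrow> real) \<Rightarrow> (complex \<Rightarrow> complex) \<Rightarrow> real" where
  "zygmund_norm v f =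
     norm (f 0) + norm (deriv f 0) + (SUP z\<in>\<bbbD>. v z * norm (deriv (deriv f) z))"

lemma v_log_pos: "z \<in> \<bbbD> \<Longrightarrow> v_log z > 0"
  using norm_ge_zero[of z]
  by (auto simp: v_log_def field_simps simp del: norm_ge_zero intro!: mult_pos_pos ln_gt_zero)

lemma deriv2_add:
  assumes "f holomorphic_on \<bbbD>" "g holomorphic_on \<bbbD>" "z \<in> \<bbbD>"
  shows "deriv (\<lambda>z. f z + g z) z = deriv f z + deriv g z"
    and "deriv (deriv (\<lambda>z. f z + g z)) z = deriv (deriv f) z + deriv (deriv g) z"
proof -
  have d: "h field_differentiable at w" if "h holomorphic_on \<bbbD>" "w \<in> \<bbbD>" for h w
    using that holomorphic_on_imp_differentiable_at by blast
  have 1: "deriv (\<lambda>z. f z + g z) w = deriv f w + deriv g w" if "w \<in> \<bbbD>" for w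
    by (intro deriv_add d assms that)
  show "deriv (\<lambda>z. f z + g z) z = deriv f z + deriv g z"
    using 1 assms by blast
  have "deriv (deriv (\<lambda>z. f z + g z)) z = deriv (\<lambda>z. deriv f z + deriv g z) z"
    by (rule deriv_cong_ev[OF eventually_mono[OF eventually_nhds_in_open[of \<bbbD>]]])
       (use 1 assms in auto)
  also have "\<dots> = deriv (deriv f) z + deriv (deriv g) z"
    by (intro deriv_add d holomorphic_deriv assms) auto
  finally show "deriv (deriv (\<lambda>z. f z + g z)) z = deriv (deriv f) z + deriv (deriv g) z" .
qed

lemma deriv2_cmult:
  assumes "f holomorphic_on \<bbbD>" "z \<in> \<bbbD>"
  shows "deriv (\<lambda>z. c * f z) z = c * deriv f z"
    and "deriv (deriv (\<lambda>z. c * f z)) z = c * deriv (deriv f) z"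
proof -
  have d: "h field_differentiable at w" if "h holomorphic_on \<bbbD>" "w \<in> \<bbbD>" for h w
    using that holomorphic_on_imp_differentiable_at by blast
  have 1: "deriv (\<lambda>z. c * f z) w = c * deriv f w" if "w \<in> \<bbbD>" for w
    by (intro deriv_cmult d assms that)
  show "deriv (\<lambda>z. c * f z) z = c * deriv f z"
    using 1 assms by blast
  have "deriv (deriv (\<lambda>z. c * f z)) z = deriv (\<lambda>z. c * deriv f z) z"
    by (rule deriv_cong_ev[OF eventually_mono[OF eventually_nhds_in_open[of \<bbbD>]]])
       (use 1 assms in auto)
  also have "\<dots> = c * deriv (deriv f) z"
    by (intro deriv_cmult d holomorphic_deriv assms) auto
  finally show "deriv (deriv (\<lambda>z. c * f z)) z = c * deriv (deriv f) z" .
qed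

lemma zygmund_bound:
  assumes "f \<in> zygmund v" "z \<in> \<bbbD>"
  shows "v z * norm (deriv (deriv f) z) \<le> (SUP z\<in>\<bbbD>. v z * norm (deriv (deriv f) z))"
  using assms by (auto simp: zygmund_def intro!: cSUP_upper)

lemma zygmund_add_aux:
  assumes f: "f \<in> zygmund v_log" and g: "g \<in> zygmund v_log" and z: "z \<in> \<bbbD>"
  shows "v_log z * norm (deriv (deriv (\<lambda>z. f z + g z)) z) \<le>
     (SUP z\<in>\<bbbD>. v_log z * norm (deriv (deriv f) z)) +
     (SUP z\<in>\<bbbD>. v_log z * norm (deriv (deriv g) z))"
proof -
  have h: "f holomorphic_on \<bbbD>" "g holomorphic_on \<bbbD>"
    using f g by (auto simp: zygmund_def)
  have "v_log z * norm (deriv (deriv (\<lambda>z. f z + g z)) z) \<le>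
      v_log z * (norm (deriv (deriv f) z) + norm (deriv (deriv g) z))"
    unfolding deriv2_add(2)[OF h z]
    using v_log_pos[OF z] by (intro mult_left_mono norm_triangle_ineq) auto
  then show ?thesis
    using zygmund_bound[OF f z] zygmund_bound[OF g z] by (simp add: distrib_left)
qed

lemma zygmund_add:
  assumes "f \<in> zygmund v_log" "g \<in> zygmund v_log"
  shows "(\<lambda>z. f z + g z) \<in> zygmund v_log"
  using assms zygmund_add_aux[OF assms]
  by (auto simp: zygmund_def intro!: holomorphic_intros bdd_aboveI2)

lemma zygmund_norm_add:
  assumes "f \<in> zygmund v_log" "g \<in> zygmund v_log"
  shows "zygmund_norm v_log (\<lambda>z. f z + g z) \<le> zygmund_norm v_log f + zygmund_norm v_log g"
proof -
  have h: "f holomorphic_on \<bbbD>" "g holomorphic_on \<bbbD>"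
    using assms by (auto simp: zygmund_def)
  have "(SUP z\<in>\<bbbD>. v_log z * norm (deriv (deriv (\<lambda>z. f z + g z)) z)) \<le>
     (SUP z\<in>\<bbbD>. v_log z * norm (deriv (deriv f) z)) +
     (SUP z\<in>\<bbbD>. v_log z * norm (deriv (deriv g) z))"
    by (rule cSUP_least) (use zygmund_add_aux[OF assms] in auto)
  moreover have "norm (f 0 + g 0) \<le> norm (f 0) + norm (g 0)"
    by (rule norm_triangle_ineq)
  moreover have "norm (deriv (\<lambda>z. f z + g z) 0) \<le> norm (deriv f 0) + norm (deriv g 0)"
    using deriv2_add(1)[OF h, of 0] by (simp add: norm_triangle_ineq)
  ultimately show ?thesis
    by (simp add: zygmund_norm_def)
qed

lemma zygmund_scale_aux:
  assumes "f \<in> zygmund v_log" "z \<in> \<bbbD>"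
  shows "v_log z * norm (deriv (deriv (\<lambda>z. c * f z)) z) =
     norm c * (v_log z * norm (deriv (deriv f) z))"
proof -
  have "f holomorphic_on \<bbbD>"
    using assms by (auto simp: zygmund_def)
  then show ?thesis
    using deriv2_cmult(2)[of f z c] assms(2) by (simp add: norm_mult)
qed

lemma zygmund_scale:
  assumes "f \<in> zygmund v_log"
  shows "(\<lambda>z. c * f z) \<in> zygmund v_log"
proof -
  have "v_log z * norm (deriv (deriv (\<lambda>z. c * f z)) z) \<le>
      norm c * (SUP z\<in>\<bbbD>. v_log z * norm (deriv (deriv f) z))" if "z \<in> \<bbbD>" for z
    unfolding zygmund_scale_aux[OF assms that]
    by (intro mult_left_mono zygmund_bound assms that) auto
  then have "bdd_above ((\<lambda>z. v_log z * norm (deriv (deriv (\<lambda>z. c * f z)) z)) ` \<bbbD>)"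
    by (rule bdd_aboveI2)
  then show ?thesis
    using assms by (auto simp: zygmund_def intro!: holomorphic_intros)
qed

lemma zygmund_norm_scale:
  assumes "f \<in> zygmund v_log"
  shows "zygmund_norm v_log (\<lambda>z. c * f z) = norm c * zygmund_norm v_log f"
proof -
  have h: "f holomorphic_on \<bbbD>" and b: "bdd_above ((\<lambda>z. v_log z * norm (deriv (deriv f) z)) ` \<bbbD>)"
    using assms by (auto simp: zygmund_def)
  have "(SUP z\<in>\<bbbD>. v_log z * norm (deriv (deriv (\<lambda>z. c * f z)) z)) =
      (SUP z\<in>\<bbbD>. norm c * (v_log z * norm (deriv (deriv f) z)))"
    by (rule SUP_cong) (use zygmund_scale_aux[OF assms] in auto)
  also have "\<dots> = norm c * (SUP z\<in>\<bbbD>. v_log z * norm (deriv (deriv f) z))"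
  proof (cases "c = 0")
    case False
    show ?thesis
    proof (rule antisym)
      show "(SUP z\<in>\<bbbD>. norm c * (v_log z * norm (deriv (deriv f) z)))
          \<le> norm c * (SUP z\<in>\<bbbD>. v_log z * norm (deriv (deriv f) z))"
        by (intro cSUP_least mult_left_mono zygmund_bound assms) auto
      have b': "bdd_above ((\<lambda>z. norm c * (v_log z * norm (deriv (deriv f) z))) ` \<bbbD>)"
        by (rule bdd_aboveI2[where M = "norm c * (SUP z\<in>\<bbbD>. v_log z * norm (deriv (deriv f) z))"])
           (intro mult_left_mono zygmund_bound assms; simp)
      have "v_log z * norm (deriv (deriv f) z) \<le>
          (SUP z\<in>\<bbbD>. norm c * (v_log z * norm (deriv (deriv f) z))) / norm c"
        if "z \<in> \<bbbD>" for z
        using cSUP_upper[OF that b'] False by (simp add: field_simps)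
      then have "(SUP z\<in>\<bbbD>. v_log z * norm (deriv (deriv f) z)) \<le>
          (SUP z\<in>\<bbbD>. norm c * (v_log z * norm (deriv (deriv f) z))) / norm c"
        by (intro cSUP_least) auto
      then show "norm c * (SUP z\<in>\<bbbD>. v_log z * norm (deriv (deriv f) z))
          \<le> (SUP z\<in>\<bbbD>. norm c * (v_log z * norm (deriv (deriv f) z)))"
        using False by (simp add: field_simps)
    qed
  qed simp
  finally show ?thesis
    using deriv2_cmult(1)[OF h, of 0 c]
    by (simp add: zygmund_norm_def norm_mult distrib_left)
qed

lemma zygmund_zero: "(\<lambda>z. 0) \<in> zygmund v_log"
  by (auto simp: zygmund_def intro!: bdd_aboveI2[where M = 0])

lemma zygmund_sup_nonneg:
  assumes "f \<in> zygmund v_log"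
  shows "0 \<le> (SUP z\<in>\<bbbD>. v_log z * norm (deriv (deriv f) z))"
proof -
  have "0 \<le> v_log 0 * norm (deriv (deriv f) 0)"
    using v_log_pos[of 0] by simp
  also have "\<dots> \<le> (SUP z\<in>\<bbbD>. v_log z * norm (deriv (deriv f) z))"
    by (rule zygmund_bound[OF assms]) simp
  finally show ?thesis .
qed

lemma zygmund_norm_eq_0:
  assumes f: "f \<in> zygmund v_log" and 0: "zygmund_norm v_log f = 0"
  shows "f = (\<lambda>z. 0)"
proof -
  let ?S = "SUP z\<in>\<bbbD>. v_log z * norm (deriv (deriv f) z)"
  have h: "f holomorphic_on \<bbbD>" "deriv f holomorphic_on \<bbbD>"
    using f by (auto simp: zygmund_def intro!: holomorphic_deriv)
  have "f 0 = 0 \<and> deriv f 0 = 0 \<and> ?S = 0"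
    using 0 zygmund_sup_nonneg[OF f] norm_ge_zero[of "f 0"] norm_ge_zero[of "deriv f 0"]
    unfolding zygmund_norm_def by (smt (verit) norm_eq_zero)
  then have z: "f 0 = 0" "deriv f 0 = 0" "?S = 0"
    by auto
  have const: "g w = g 0"
    if "g holomorphic_on \<bbbD>" "\<And>w. w \<in> \<bbbD> \<Longrightarrow> deriv g w = 0" "w \<in> \<bbbD>" for g w
  proof -
    have "(g has_field_derivative 0) (at x within \<bbbD>)" if "x \<in> \<bbbD>" for x
      using \<open>g holomorphic_on \<bbbD>\<close> \<open>\<And>w. w \<in> \<bbbD> \<Longrightarrow> deriv g w = 0\<close>[OF that] that
      by (metis has_field_derivative_at_within holomorphic_derivI open_ball)
    then obtain c where "\<And>x. x \<in> \<bbbD> \<Longrightarrow> g x = c"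
      using has_field_derivative_zero_constant[of \<bbbD> g] by auto
    then show ?thesis
      using \<open>w \<in> \<bbbD>\<close> by auto
  qed
  have "deriv (deriv f) w = 0" if "w \<in> \<bbbD>" for w
    using zygmund_bound[OF f that] v_log_pos[OF that] z(3)
    by (simp add: mult_le_0_iff)
  then have "deriv f w = 0" if "w \<in> \<bbbD>" for w
    using const[OF h(2) _ that] z(2) by simp
  then have "f w = 0" if "w \<in> \<bbbD>" for w
    using const[OF h(1) _ that] z(1) by simp
  moreover have "f w = 0" if "w \<notin> \<bbbD>" for w
    using f that by (auto simp: zygmund_def)
  ultimately show ?thesis
    by blast
qed

text \<open>The space $\mathcal{Z}^{v_{\log}}$ as a type, with its complex normed structure.\<close>

typedef zyg_vlog = "zygmund v_log"
  using zygmund_zero by blast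

setup_lifting type_definition_zyg_vlog

instantiation zyg_vlog :: complex_normed_vector
begin

lift_definition zero_zyg_vlog :: zyg_vlog is "\<lambda>z. 0"
  by (rule zygmund_zero)

lift_definition plus_zyg_vlog :: "zyg_vlog \<Rightarrow> zyg_vlog \<Rightarrow> zyg_vlog"
  is "\<lambda>f g z. f z + g z"
  by (rule zygmund_add)

lift_definition scaleC_zyg_vlog :: "complex \<Rightarrow> zyg_vlog \<Rightarrow> zyg_vlog"
  is "\<lambda>c f z. c * f z"
  by (rule zygmund_scale)

lift_definition norm_zyg_vlog :: "zyg_vlog \<Rightarrow> real" is "zygmund_norm v_log" .

definition "scaleR_zyg_vlog r (f :: zyg_vlog) = scaleC (complex_of_real r) f"
definition "uminus_zyg_vlog (f :: zyg_vlog) = scaleC (-1) f"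
definition "minus_zyg_vlog (f :: zyg_vlog) g = f + - g"
definition "dist_zyg_vlog (f :: zyg_vlog) g = norm (f - g)"
definition "sgn_zyg_vlog (f :: zyg_vlog) = scaleR (inverse (norm f)) f"
definition "uniformity_zyg_vlog =
  (INF e\<in>{0<..}. principal {(f :: zyg_vlog, g). dist f g < e})"
definition "open_zyg_vlog (U :: zyg_vlog set) \<longleftrightarrow>
  (\<forall>x\<in>U. eventually (\<lambda>(x', y). x' = x \<longrightarrow> y \<in> U) uniformity)"

instance
proof
  fix f g h :: zyg_vlog and a b :: complex and r s :: real
  show "f + g + h = f + (g + h)"
    by transfer (simp add: add.assoc)
  show "f + g = g + f"
    by transfer (simp add: add.commute)
  show "0 + f = f"
    by transfer simp
  show "- f + f = 0"
    unfolding uminus_zyg_vlog_def by transfer simp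
  show "f - g = f + - g"
    by (rule minus_zyg_vlog_def)
  show add_r: "scaleC a (f + g) = scaleC a f + scaleC a g" for a and f g :: zyg_vlog
    by transfer (simp add: distrib_left)
  show add_l: "scaleC (a + b) f = scaleC a f + scaleC b f" for a b and f :: zyg_vlog
    by transfer (simp add: distrib_right)
  show sc: "scaleC a (scaleC b f) = scaleC (a * b) f" for a b and f :: zyg_vlog
    by transfer (simp add: mult.assoc)
  show "scaleR r f = scaleC (of_real r) f"
    by (rule scaleR_zyg_vlog_def)
  show nsc: "norm (scaleC a f) = norm a * norm f" for a and f :: zyg_vlog
    by transfer (rule zygmund_norm_scale)
  show "r *\<^sub>R (f + g) = r *\<^sub>R f + r *\<^sub>R g"
    by (simp add: scaleR_zyg_vlog_def add_r)
  show "(r + s) *\<^sub>R f = r *\<^sub>R f + s *\<^sub>R f"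
    by (simp add: scaleR_zyg_vlog_def add_l)
  show "r *\<^sub>R s *\<^sub>R f = (r * s) *\<^sub>R f"
    by (simp add: scaleR_zyg_vlog_def sc)
  show "1 *\<^sub>R f = f"
    unfolding scaleR_zyg_vlog_def by transfer simp
  show "norm (r *\<^sub>R f) = \<bar>r\<bar> * norm f"
    by (simp add: scaleR_zyg_vlog_def nsc)
  show "norm (f + g) \<le> norm f + norm g"
    by transfer (rule zygmund_norm_add)
  show "norm f = 0 \<longleftrightarrow> f = 0"
  proof
    show "norm f = 0 \<Longrightarrow> f = 0"
      by transfer (rule zygmund_norm_eq_0)
    show "f = 0 \<Longrightarrow> norm f = 0"
      by (hypsubst, transfer) (simp add: zygmund_norm_def)
  qed
qed (rule dist_zyg_vlog_def sgn_zyg_vlog_def uniformity_zyg_vlog_def open_zyg_vlog_def)+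

end

section \<open>Composition and integral operators\<close>

definition comp_ext :: "(complex \<Rightarrow> complex) \<Rightarrow> (complex \<Rightarrow> complex) \<Rightarrow> complex \<Rightarrow> complex" where
  "comp_ext \<phi> f = (\<lambda>z. if z \<in> \<bbbD> then f (\<phi> z) else 0)"

text \<open>\<open>comp_op \<phi>\<close> is meaningful only if composition with \<open>\<phi>\<close> maps the space into itself;
  this is part of \<open>comp_op_continuous\<close>.\<close>

definition comp_op :: "(complex \<Rightarrow> complex) \<Rightarrow> zyg_vlog \<Rightarrow> zyg_vlog" where
  "comp_op \<phi> f = Abs_zyg_vlog (comp_ext \<phi> (Rep_zyg_vlog f))"

definition comp_op_continuous :: "(complex \<Rightarrow> complex) \<Rightarrow> bool" where
  "comp_op_continuous \<phi> \<longleftrightarrow>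
     (\<forall>f\<in>zygmund v_log. comp_ext \<phi> f \<in> zygmund v_log) \<and> continuous_on UNIV (comp_op \<phi>)"

definition I_op :: "(complex \<Rightarrow> complex) \<Rightarrow> (complex \<Rightarrow> complex) \<Rightarrow> complex \<Rightarrow> complex" where
  "I_op u f = (\<lambda>z. contour_integral (linepath 0 z) (\<lambda>s. deriv f s * u s))"

definition J_op :: "(complex \<Rightarrow> complex) \<Rightarrow> (complex \<Rightarrow> complex) \<Rightarrow> complex \<Rightarrow> complex" where
  "J_op u f = (\<lambda>z. contour_integral (linepath 0 z) (\<lambda>s. f s * deriv u s))"

definition I'_op :: "(complex \<Rightarrow> complex) \<Rightarrow> (complex \<Rightarrow> complex) \<Rightarrow> complex \<Rightarrow> complex" where
  "I'_op u f = (\<lambda>z. contour_integral (linepath 0 z) (I_op u f))"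

definition J'_op :: "(complex \<Rightarrow> complex) \<Rightarrow> (complex \<Rightarrow> complex) \<Rightarrow> complex \<Rightarrow> complex" where
  "J'_op u f = (\<lambda>z. contour_integral (linepath 0 z) (J_op u f))"

text \<open>An extended real, so that the upper limits always exist.\<close>

definition M_log :: "(complex \<Rightarrow> complex) \<Rightarrow> ereal" where
  "M_log \<phi> = max
     (limsup (\<lambda>n. ereal
        (real (n + 2) * real (n + 1) * zygmund_norm v_log (J'_op (deriv \<phi>) (\<lambda>z. \<phi> z ^ n)) /
         zygmund_norm w_log (\<lambda>z. z ^ (n + 2)))))
     (limsup (\<lambda>n. ereal
        (real (n + 1) * zygmund_norm v_log (I'_op (deriv \<phi>) (\<lambda>z. \<phi> z ^ n)) /
         zygmund_norm v_log (\<lambda>z. z ^ (n + 1)))))"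

end

theory Submission
  imports Defs
begin

text \<open>
Why the theorem holds. For \<open>f\<close> in the space,
\<open>(f \<circ> \<phi>)'' = (f'' \<circ> \<phi>) * \<phi>'\<^sup>2 + (f' \<circ> \<phi>) * \<phi>''\<close>. By definition of the norm \<open>f''\<close> is at most
\<open>norm f / v_log\<close>, and integration along radii shows that \<open>f'\<close> is at most a constant times
\<open>norm f / w_log\<close>. The size of the composition operator is thus governed by the two quotients

  \<open>v_log z * \<bar>\<phi>' z\<bar>\<^sup>2 / v_log (\<phi> z)\<close>   and   \<open>v_log z * \<bar>\<phi>'' z\<bar> / w_log (\<phi> z)\<close>,

and its distance to the compact operators by their upper limits as \<open>\<bar>\<phi> z\<bar>\<close> tends to 1. Both \<open>M_log\<close>
and the essential norm are compared with these upper limits.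

For \<open>M_log\<close>, its two sequences are the quotients of weighted suprema of
\<open>\<bar>\<phi>'\<bar>\<^sup>2 * \<bar>\<phi>\<bar> ^ n\<close> and \<open>\<bar>\<phi>''\<bar> * \<bar>\<phi>\<bar> ^ n\<close> by the weighted suprema of \<open>\<bar>z\<bar> ^ n\<close> (lemma \<open>M_log_eq\<close>).
They are at most the upper limits above since powers are negligible away from the boundary
(\<open>limsup_power_sup_le\<close>), and up to a constant they are at least as large, since a point \<open>w\<close> near the
boundary almost maximises the weighted power of degree about \<open>1 / (1 - \<bar>w\<bar>)\<close>
(\<open>le_weight_of_limsup_less\<close> with \<open>peaking_v_log\<close> and \<open>peaking_w_log\<close>).

For the upper estimate of the essential norm, the composition operator is approximated by
\<open>f \<mapsto> f (r * \<phi> z)\<close> with \<open>r < 1\<close>, which is compact by Montel's theorem (\<open>ess_norm_upper\<close>).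

For the lower estimate, each \<open>a\<close> near the boundary gets a test function of bounded norm whose second,
respectively first, derivative at \<open>a\<close> has the maximal order, and which tends to 0 pointwise as \<open>a\<close>
approaches the boundary (\<open>second_order_test_function\<close>, \<open>first_order_test_function\<close>). A compact
operator is nearly zero on suitable differences of such functions, while the composition operator is
not (\<open>compact_perturbation_lower\<close>).
\<close>

section \<open>Monotonicity of the two weights\<close>

lemma half_le_ln2: "1/2 \<le> ln (2::real)"
  using ln_le_minus_one[of "1/2::real"] by (simp add: ln_div)

text \<open>The function \<open>s ln (2 / s)\<close> increases only up to \<open>s = 2 / e < 1\<close>, so the weight \<open>v_log\<close> is not
monotone near the centre. The inequality \<open>ln (t / s) \<le> t / s - 1\<close> shows that a factor of 2
makes up for this.\<close>

lemma log_weight_quasi_mono: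
  fixes s t :: real
  assumes "0 < s" "s \<le> t" "t \<le> 1"
  shows "s * ln (2 / s) \<le> 2 * (t * ln (2 / t))"
proof -
  have L: "1/2 \<le> ln (2 / t)"
    using assms half_le_ln2 by (simp add: ln_div) (smt (verit) ln_le_zero_iff)
  have "ln (2 / s) = ln (2 / t) + ln (t / s)"
    using assms by (simp add: ln_div)
  also have "ln (t / s) \<le> t / s - 1"
    using assms by (intro ln_le_minus_one) auto
  finally have "s * ln (2 / s) \<le> s * (ln (2 / t) + (t / s - 1))"
    using assms by (intro mult_left_mono) auto
  also have "\<dots> = s * ln (2 / t) + (t - s)"
    using assms by (simp add: field_simps)
  also have "\<dots> \<le> s * ln (2 / t) + (t - s) * (2 * ln (2 / t))"
    using assms L mult_left_mono[of 1 "2 * ln (2 / t)" "t - s"] by simp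
  also have "\<dots> \<le> 2 * (t * ln (2 / t))"
    using assms L by (simp add: algebra_simps)
  finally show ?thesis .
qed

lemma v_log_quasi_mono:
  assumes "norm y \<le> norm z" "z \<in> \<bbbD>"
  shows "v_log z \<le> 2 * v_log y"
  unfolding v_log_def using assms by (intro log_weight_quasi_mono) auto

lemma v_log_le_2:
  assumes "z \<in> \<bbbD>"
  shows "v_log z \<le> 2"
proof -
  have "v_log z \<le> 2 * ln 2"
    using v_log_quasi_mono[of 0 z] assms by (simp add: v_log_def)
  then show ?thesis
    using ln_le_minus_one[of "2::real"] by simp
qed

text \<open>This is \<open>1 / w_log\<close>; it occurs in products much more often than \<open>w_log\<close> itself.\<close>

definition loglog :: "complex \<Rightarrow> real" where
  "loglog z = ln (ln (4 / (1 - (norm z)\<^sup>2)))"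

lemma w_log_eq: "w_log z = 1 / loglog z"
  by (simp add: w_log_def loglog_def inverse_eq_divide)

lemma one_less_ln4: "1 < ln (4::real)"
  using exp_le ln_less_cancel_iff[of "exp 1" "4::real"] by (simp del: ln_less_cancel_iff)

lemma norm_disc_sq: "z \<in> \<bbbD> \<Longrightarrow> (norm z)\<^sup>2 < 1"
  by (simp add: power_less_one_iff abs_square_less_1)

lemma four_over_ge: "z \<in> \<bbbD> \<Longrightarrow> 4 \<le> 4 / (1 - (norm z)\<^sup>2)"
  using norm_disc_sq[of z] by (simp add: field_simps)

lemma ln_four_over_gt_1:
  assumes "z \<in> \<bbbD>"
  shows "1 < ln (4 / (1 - (norm z)\<^sup>2))"
  using one_less_ln4 four_over_ge[OF assms] by (smt (verit) ln_le_cancel_iff)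

lemma loglog_mono:
  assumes "norm y \<le> norm z" "z \<in> \<bbbD>"
  shows "loglog y \<le> loglog z"
proof -
  have y: "y \<in> \<bbbD>"
    using assms by simp
  have "(norm y)\<^sup>2 \<le> (norm z)\<^sup>2"
    using assms by (intro power_mono) auto
  then have "4 / (1 - (norm y)\<^sup>2) \<le> 4 / (1 - (norm z)\<^sup>2)"
    using norm_disc_sq[OF assms(2)] norm_disc_sq[OF y]
    by (intro divide_left_mono mult_pos_pos) auto
  then have "ln (4 / (1 - (norm y)\<^sup>2)) \<le> ln (4 / (1 - (norm z)\<^sup>2))"
    using four_over_ge[OF y] by (intro iffD2[OF ln_le_cancel_iff]) linarith+
  then show ?thesis
    unfolding loglog_def by (rule ln_mono) (use ln_four_over_gt_1[OF y] in linarith)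
qed

lemma loglog0_pos: "0 < loglog 0"
  using one_less_ln4 by (simp add: loglog_def)

lemma loglog_ge: "z \<in> \<bbbD> \<Longrightarrow> loglog 0 \<le> loglog z"
  by (rule loglog_mono) auto

lemma loglog_pos: "z \<in> \<bbbD> \<Longrightarrow> 0 < loglog z"
  using loglog0_pos loglog_ge by force

lemma w_log_pos: "z \<in> \<bbbD> \<Longrightarrow> 0 < w_log z"
  using loglog_pos by (simp add: w_log_eq)

lemma lnln_le_loglog:
  assumes "z \<in> \<bbbD>"
  shows "ln (ln (2 / (1 - norm z))) \<le> loglog z"
proof -
  have *: "2 / (1 - norm z) \<le> 4 / (1 - (norm z)\<^sup>2)"
  proof -
    have "2 * (1 - (norm z)\<^sup>2) = (2 * (1 + norm z)) * (1 - norm z)"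
      by (simp add: algebra_simps power2_eq_square)
    also have "\<dots> \<le> 4 * (1 - norm z)"
      using assms by (intro mult_right_mono) auto
    finally show ?thesis
      using assms norm_disc_sq[OF assms] by (simp add: divide_simps mult.commute)
  qed
  have "ln 2 \<le> ln (2 / (1 - norm z))"
    using assms by (intro ln_mono) (auto simp: field_simps)
  then have "0 < ln (2 / (1 - norm z))"
    using half_le_ln2 by linarith
  then show ?thesis
    unfolding loglog_def using * assms
    by (intro ln_mono) (auto simp: divide_simps)
qed

section \<open>Growth of functions in the space\<close>

lemma zyg_holomorphic: "Rep_zyg_vlog f holomorphic_on \<bbbD>"
  using Rep_zyg_vlog[of f] by (simp add: zygmund_def)

lemma zyg_deriv_holomorphic:
  "deriv (Rep_zyg_vlog f) holomorphic_on \<bbbD>"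
  "deriv (deriv (Rep_zyg_vlog f)) holomorphic_on \<bbbD>"
  by (auto intro!: holomorphic_deriv zyg_holomorphic)

lemma zyg_norm_eq:
  "norm f = norm (Rep_zyg_vlog f 0) + norm (deriv (Rep_zyg_vlog f) 0) +
     (SUP z\<in>\<bbbD>. v_log z * norm (deriv (deriv (Rep_zyg_vlog f)) z))"
  by (simp add: norm_zyg_vlog.rep_eq zygmund_norm_def)

lemma zyg_norm_sum_le:
  assumes "z \<in> \<bbbD>"
  shows "norm (Rep_zyg_vlog f 0) + norm (deriv (Rep_zyg_vlog f) 0) +
     v_log z * norm (deriv (deriv (Rep_zyg_vlog f)) z) \<le> norm f"
  using zygmund_bound[OF Rep_zyg_vlog assms, of f] by (simp add: zyg_norm_eq)

lemma zyg_second_deriv_le: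
  assumes "z \<in> \<bbbD>"
  shows "v_log z * norm (deriv (deriv (Rep_zyg_vlog f)) z) \<le> norm f"
  using zyg_norm_sum_le[OF assms, of f] norm_ge_zero by (smt (verit))

lemma zyg_deriv_0_le: "norm (deriv (Rep_zyg_vlog f) 0) \<le> norm f"
  using zyg_norm_sum_le[of 0 f] v_log_pos[of 0]
  by (smt (verit) centre_in_ball mult_nonneg_nonneg norm_ge_zero zero_less_one)

lemma zyg_0_le: "norm (Rep_zyg_vlog f 0) \<le> norm f"
  using zyg_norm_sum_le[of 0 f] v_log_pos[of 0]
  by (smt (verit) centre_in_ball mult_nonneg_nonneg norm_ge_zero zero_less_one)

lemma zyg_norm_le:
  assumes "\<And>z. z \<in> \<bbbD> \<Longrightarrow> v_log z * norm (deriv (deriv (Rep_zyg_vlog f)) z) \<le> B"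
  shows "norm f \<le> norm (Rep_zyg_vlog f 0) + norm (deriv (Rep_zyg_vlog f) 0) + B"
  unfolding zyg_norm_eq using assms by (intro add_left_mono cSUP_least) auto

text \<open>The additive constant \<open>2\<close> that the integration below produces is absorbed into \<open>loglog z\<close>,
which never falls below \<open>loglog 0\<close>.\<close>

definition growth_const :: real where
  "growth_const = (2 + loglog 0) / loglog 0"

lemma growth_const_ge_1: "1 \<le> growth_const"
  using loglog0_pos by (simp add: growth_const_def)

text \<open>On a radius \<open>1 / v_log\<close> has the primitive \<open>ln (ln (2 / (1 - t)))\<close>. Integrating the bound
\<open>norm f / v_log\<close> on the second derivative therefore controls the first derivative by the
iterated logarithm, that is by \<open>1 / w_log\<close>. This is why the two weights belong together.\<close>

lemma zyg_deriv_growth: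
  assumes z: "z \<in> \<bbbD>"
  shows "norm (deriv (Rep_zyg_vlog f) z) \<le> growth_const * norm f * loglog z"
proof -
  let ?F = "deriv (Rep_zyg_vlog f)"
  let ?p = "\<lambda>t. ln (ln (2 / (1 - t * norm z))) * norm f"
  have tz: "of_real t * z \<in> \<bbbD>" "t * norm z < 1" if "0 \<le> t" "t \<le> 1" for t
    using mult_left_le_one_le[of "norm z" t] that z by (auto simp: norm_mult)
  have pos: "0 < ln (2 / (1 - t * norm z))" if "0 \<le> t" "t \<le> 1" for t
    using tz[OF that] that z by (intro ln_gt_zero) (auto simp: field_simps intro: add_pos_nonneg)
  have dF: "((\<lambda>t. ?F (of_real t * z)) has_vector_derivative deriv ?F (of_real t * z) * z) (at t)"
    if "0 \<le> t" "t \<le> 1" for t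
  proof -
    have "(?F has_field_derivative deriv ?F (of_real t * z)) (at (of_real t * z))"
      using zyg_deriv_holomorphic(1)[of f] tz[OF that] by (intro holomorphic_derivI[of _ \<bbbD>]) auto
    moreover have "((\<lambda>t. of_real t * z) has_vector_derivative z) (at t)"
      by (auto intro!: derivative_eq_intros)
    ultimately show ?thesis
      using field_vector_diff_chain_at[of "\<lambda>t. of_real t * z" z t ?F] unfolding o_def mult.commute[of z] by blast
  qed
  have dp: "(?p has_real_derivative
      norm f * norm z / ((1 - t * norm z) * ln (2 / (1 - t * norm z)))) (at t)"
    if "0 \<le> t" "t \<le> 1" for t
  proof -
    have u: "0 < 1 - t * norm z"
      using tz[OF that] by simp
    have "((\<lambda>t. 2 / (1 - t * norm z)) has_real_derivative 2 * norm z / (1 - t * norm z)\<^sup>2) (at t)"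
      using u by (auto intro!: derivative_eq_intros simp: power2_eq_square)
    from DERIV_chain2[OF DERIV_ln_divide this] u
    have "((\<lambda>t. ln (2 / (1 - t * norm z))) has_real_derivative norm z / (1 - t * norm z)) (at t)"
      by (simp add: power2_eq_square)
    from DERIV_cmult_right[OF DERIV_chain2[OF DERIV_ln_divide[OF pos[OF that]] this], of "norm f"]
    show "(?p has_real_derivative
        norm f * norm z / ((1 - t * norm z) * ln (2 / (1 - t * norm z)))) (at t)"
      by (simp add: mult_ac)
  qed
  have "norm (?F (of_real 1 * z) - ?F (of_real 0 * z)) \<le> ?p 1 - ?p 0"
  proof (rule differentiable_bound_general)
    show "continuous_on {0..1} (\<lambda>t. ?F (of_real t * z))"
      using dF by (intro continuous_at_imp_continuous_on)
        (auto intro!: has_vector_derivative_continuous)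
    show "continuous_on {0..1} ?p"
      using DERIV_isCont[OF dp] by (intro continuous_at_imp_continuous_on) auto
    fix t :: real
    assume t: "0 < t" "t < 1"
    let ?w = "of_real t * z"
    have "norm (deriv ?F ?w) \<le> norm f / v_log ?w"
      using zyg_second_deriv_le[of ?w f] v_log_pos[of ?w] tz[of t] t
      by (simp add: field_simps)
    then have "norm (deriv ?F ?w) * norm z \<le> norm f / v_log ?w * norm z"
      by (intro mult_right_mono) auto
    then show "norm (deriv ?F ?w * z) \<le>
        norm f * norm z / ((1 - t * norm z) * ln (2 / (1 - t * norm z)))"
      using t by (simp add: norm_mult v_log_def)
  qed (use dF dp in \<open>auto simp: has_real_derivative_iff_has_vector_derivative[symmetric]\<close>)
  then have "norm (?F z - ?F 0) \<le> (ln (ln (2 / (1 - norm z))) - ln (ln 2)) * norm f"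
    by (simp add: algebra_simps)
  also have "\<dots> \<le> (loglog z + 1) * norm f"
  proof -
    have "- ln (ln 2) = ln (1 / ln 2 :: real)"
      using half_le_ln2 by (simp add: ln_div)
    also have "\<dots> \<le> 1 / ln 2 - 1"
      using half_le_ln2 by (intro ln_le_minus_one) auto
    also have "\<dots> \<le> 1"
      using half_le_ln2 by (simp add: field_simps)
    finally show ?thesis
      using lnln_le_loglog[OF z] by (intro mult_right_mono) auto
  qed
  finally have "norm (?F z) \<le> (loglog z + 1) * norm f + norm f"
    using zyg_deriv_0_le[of f] norm_triangle_ineq4[of "?F z - ?F 0" "- ?F 0"] by simp
  also have "\<dots> = (2 + loglog z) * norm f"
    by (simp add: algebra_simps)
  also have "\<dots> \<le> (growth_const * loglog z) * norm f"
  proof (intro mult_right_mono)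
    have "2 \<le> 2 * (loglog z / loglog 0)"
      using loglog_ge[OF z] loglog0_pos by (simp add: field_simps)
    then show "2 + loglog z \<le> growth_const * loglog z"
      using loglog0_pos by (simp add: growth_const_def field_simps)
  qed auto
  finally show ?thesis
    by (simp add: mult_ac)
qed

section \<open>Weighted suprema of powers\<close>

definition power_sup :: "(complex \<Rightarrow> real) \<Rightarrow> (complex \<Rightarrow> complex) \<Rightarrow> nat \<Rightarrow> real" where
  "power_sup q \<phi> n = (SUP z\<in>\<bbbD>. q z * norm (\<phi> z) ^ n)"

abbreviation weight_sup :: "(complex \<Rightarrow> real) \<Rightarrow> nat \<Rightarrow> real" where
  "weight_sup \<omega> \<equiv> power_sup \<omega> (\<lambda>z. z)"

definition bounded_weight :: "(complex \<Rightarrow> real) \<Rightarrow> bool" where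
  "bounded_weight q \<longleftrightarrow> (\<exists>C. \<forall>z\<in>\<bbbD>. 0 \<le> q z \<and> q z \<le> C)"

lemma mult_power_le:
  fixes a x C :: real
  assumes "0 \<le> a" "a \<le> C" "0 \<le> x" "x < 1"
  shows "a * x ^ n \<le> C"
  using mult_left_mono[of "x ^ n" 1 a] assms by (simp add: power_le_one)

lemma bdd_above_power_sup:
  assumes "bounded_weight q" "\<phi> ` \<bbbD> \<subseteq> \<bbbD>"
  shows "bdd_above ((\<lambda>z. q z * norm (\<phi> z) ^ n) ` \<bbbD>)"
proof -
  obtain C where "\<forall>z\<in>\<bbbD>. 0 \<le> q z \<and> q z \<le> C"
    using assms by (auto simp: bounded_weight_def)
  then show ?thesis
    using assms(2) by (intro bdd_aboveI2[where M = C] mult_power_le) (auto simp: image_subset_iff)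
qed

lemma power_sup_upper:
  assumes "bounded_weight q" "\<phi> ` \<bbbD> \<subseteq> \<bbbD>" "z \<in> \<bbbD>"
  shows "q z * norm (\<phi> z) ^ n \<le> power_sup q \<phi> n"
  unfolding power_sup_def using assms by (intro cSUP_upper bdd_above_power_sup)

lemma power_sup_nonneg:
  assumes "bounded_weight q" "\<phi> ` \<bbbD> \<subseteq> \<bbbD>"
  shows "0 \<le> power_sup q \<phi> n"
proof -
  have "0 \<le> q 0 * norm (\<phi> 0) ^ n"
    using assms(1) by (auto simp: bounded_weight_def)
  then show ?thesis
    using power_sup_upper[OF assms, of 0 n] by simp
qed

lemma weight_sup_lower:
  assumes "bounded_weight \<omega>" "0 < \<rho>" "\<rho> < 1"
  shows "\<omega> (of_real \<rho>) * \<rho> ^ n \<le> weight_sup \<omega> n"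
  using power_sup_upper[of \<omega> "\<lambda>z. z" "of_real \<rho>" n] assms by simp

lemma weight_sup_pos:
  assumes "bounded_weight \<omega>" "\<And>z. z \<in> \<bbbD> \<Longrightarrow> 0 < \<omega> z"
  shows "0 < weight_sup \<omega> n"
proof -
  have "0 < \<omega> (of_real (1/2)) * (1/2) ^ n"
    using assms(2)[of "of_real (1/2)"] by simp
  also have "\<dots> \<le> weight_sup \<omega> n"
    by (rule weight_sup_lower[OF assms(1)]) auto
  finally show ?thesis .
qed

text \<open>Only the points with \<open>norm (\<phi> z)\<close> close to 1 matter: where \<open>norm (\<phi> z) \<le> s < 1\<close> the powers
are at most \<open>s ^ n\<close>, which is negligible against \<open>\<omega> \<rho> * \<rho> ^ n\<close> for any \<open>\<rho>\<close> between \<open>s\<close> and 1.\<close>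

lemma limsup_power_sup_le:
  assumes \<omega>: "bounded_weight \<omega>" "\<And>z. z \<in> \<bbbD> \<Longrightarrow> 0 < \<omega> z"
    and q: "bounded_weight q" and \<phi>: "\<phi> ` \<bbbD> \<subseteq> \<bbbD>"
    and r: "r < 1" "\<And>z. z \<in> \<bbbD> \<Longrightarrow> r < norm (\<phi> z) \<Longrightarrow> q z \<le> c * \<omega> (\<phi> z)" and c: "0 \<le> c"
  shows "limsup (\<lambda>n. ereal (power_sup q \<phi> n / weight_sup \<omega> n)) \<le> ereal c"
proof -
  obtain C where C: "\<And>z. z \<in> \<bbbD> \<Longrightarrow> 0 \<le> q z \<and> q z \<le> C"
    using q unfolding bounded_weight_def by blast
  have C0: "0 \<le> C"
    using C[of 0] by simp
  define s where "s = max r 0"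
  \<comment> \<open>a radius strictly between \<open>s\<close> and 1: on the disc of radius \<open>s\<close> the powers decay
     faster than they do at \<open>\<rho>\<close>\<close>
  define \<rho> where "\<rho> = (1 + s) / 2"
  have s: "0 \<le> s" "s < \<rho>" "0 < \<rho>" "\<rho> < 1" "r \<le> s"
    using r by (auto simp: s_def \<rho>_def)
  have w\<rho>: "0 < \<omega> (of_real \<rho>)"
    using \<omega>(2) s by simp
  have le: "power_sup q \<phi> n / weight_sup \<omega> n \<le> c + C / \<omega> (of_real \<rho>) * (s / \<rho>) ^ n" for n
  proof -
    have S: "0 < weight_sup \<omega> n"
      by (rule weight_sup_pos[OF \<omega>])
    have "power_sup q \<phi> n \<le> c * weight_sup \<omega> n + C * s ^ n"
      unfolding power_sup_def[of q]
    proof (rule cSUP_least)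
      fix z :: complex
      assume z: "z \<in> \<bbbD>"
      show "q z * norm (\<phi> z) ^ n \<le> c * weight_sup \<omega> n + C * s ^ n"
      proof (cases "norm (\<phi> z) \<le> s")
        case True
        then have "q z * norm (\<phi> z) ^ n \<le> C * s ^ n"
          using C[OF z] C0 by (intro mult_mono power_mono) auto
        moreover have "0 \<le> c * weight_sup \<omega> n"
          using c S by simp
        ultimately show ?thesis by linarith
      next
        case False
        then have "q z * norm (\<phi> z) ^ n \<le> (c * \<omega> (\<phi> z)) * norm (\<phi> z) ^ n"
          using r(2)[OF z] s by (intro mult_right_mono) auto
        also have "\<dots> = c * (\<omega> (\<phi> z) * norm (\<phi> z) ^ n)"
          by simp
        also have "\<dots> \<le> c * weight_sup \<omega> n"
        proof (rule mult_left_mono[OF _ c])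
          have "\<phi> z \<in> \<bbbD>"
            using \<phi> z by blast
          then show "\<omega> (\<phi> z) * norm (\<phi> z) ^ n \<le> weight_sup \<omega> n"
            using power_sup_upper[OF \<omega>(1), of "\<lambda>z. z" "\<phi> z" n] by simp
        qed
        finally show ?thesis
          using C0 s by (smt (verit) mult_nonneg_nonneg zero_le_power)
      qed
    qed simp
    then have "power_sup q \<phi> n / weight_sup \<omega> n \<le> c + C * s ^ n / weight_sup \<omega> n"
      using S by (simp add: field_simps)
    also have "C * s ^ n / weight_sup \<omega> n \<le> C * s ^ n / (\<omega> (of_real \<rho>) * \<rho> ^ n)"
      using weight_sup_lower[OF \<omega>(1) s(3,4), of n] C0 s w\<rho> S
      by (intro divide_left_mono mult_pos_pos) auto
    finally show ?thesis
      by (simp add: power_divide)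
  qed
  have "(\<lambda>n. c + C / \<omega> (of_real \<rho>) * (s / \<rho>) ^ n) \<longlonglongrightarrow> c + C / \<omega> (of_real \<rho>) * 0"
    using s by (intro tendsto_intros LIMSEQ_power_zero) auto
  then have "limsup (\<lambda>n. ereal (c + C / \<omega> (of_real \<rho>) * (s / \<rho>) ^ n)) = ereal c"
    by (intro lim_imp_Limsup) auto
  moreover have "limsup (\<lambda>n. ereal (power_sup q \<phi> n / weight_sup \<omega> n)) \<le>
      limsup (\<lambda>n. ereal (c + C / \<omega> (of_real \<rho>) * (s / \<rho>) ^ n))"
    using le by (intro Limsup_mono always_eventually) auto
  ultimately show ?thesis
    by simp
qed

text \<open>Every point \<open>z\<close> close to the boundary is, up to the factor \<open>C\<close>, a maximum point of
\<open>\<omega> y * norm y ^ n\<close> for a suitable large degree \<open>n\<close>. Both weights have this property with \<open>n\<close> of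
the order of \<open>1 / (1 - norm z)\<close>.\<close>

definition peaking :: "real \<Rightarrow> (complex \<Rightarrow> real) \<Rightarrow> bool" where
  "peaking C \<omega> \<longleftrightarrow> (\<forall>N. \<exists>r<1. \<forall>z\<in>\<bbbD>. r < norm z \<longrightarrow>
     (\<exists>n\<ge>N. weight_sup \<omega> n \<le> C * (\<omega> z * norm z ^ n)))"

text \<open>The converse of \<open>limsup_power_sup_le\<close>. For a point \<open>z\<close> with \<open>\<phi> z\<close> close to the boundary, the
hypothesis on the quotients is used for the one degree at which \<open>\<phi> z\<close> is a peak.\<close>

lemma le_weight_of_limsup_less:
  assumes \<omega>: "bounded_weight \<omega>" "\<And>z. z \<in> \<bbbD> \<Longrightarrow> 0 < \<omega> z" and pk: "peaking C \<omega>"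
    and q: "bounded_weight q" and \<phi>: "\<phi> ` \<bbbD> \<subseteq> \<bbbD>"
    and less: "limsup (\<lambda>n. ereal (power_sup q \<phi> n / weight_sup \<omega> n)) < ereal c"
  shows "\<exists>r<1. \<forall>z\<in>\<bbbD>. r < norm (\<phi> z) \<longrightarrow> q z \<le> C * c * \<omega> (\<phi> z)"
proof -
  have "eventually (\<lambda>n. ereal (power_sup q \<phi> n / weight_sup \<omega> n) < ereal c) sequentially"
    using less by (rule Limsup_lessD)
  then obtain N where N: "\<And>n. n \<ge> N \<Longrightarrow> power_sup q \<phi> n / weight_sup \<omega> n < c"
    by (auto simp: eventually_sequentially)
  obtain r where r: "r < 1" "\<And>z. z \<in> \<bbbD> \<Longrightarrow> r < norm z \<Longrightarrow>
      \<exists>n\<ge>N. weight_sup \<omega> n \<le> C * (\<omega> z * norm z ^ n)"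
    using pk unfolding peaking_def by blast
  have "q z \<le> C * c * \<omega> (\<phi> z)" if z: "z \<in> \<bbbD>" "max r 0 < norm (\<phi> z)" for z
  proof -
    have pz: "\<phi> z \<in> \<bbbD>"
      using \<phi> z by blast
    obtain n where n: "n \<ge> N" "weight_sup \<omega> n \<le> C * (\<omega> (\<phi> z) * norm (\<phi> z) ^ n)"
      using r(2)[OF pz] z by auto
    have S: "0 < weight_sup \<omega> n"
      by (rule weight_sup_pos[OF \<omega>])
    have Pc: "power_sup q \<phi> n < c * weight_sup \<omega> n"
      using N[OF n(1)] S by (simp add: field_simps)
    have c: "0 \<le> c"
      using N[OF n(1)] S power_sup_nonneg[OF q \<phi>, of n]
      by (smt (verit) divide_nonneg_pos)
    have "q z * norm (\<phi> z) ^ n \<le> power_sup q \<phi> n"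
      by (rule power_sup_upper[OF q \<phi> z(1)])
    also have "\<dots> \<le> c * weight_sup \<omega> n"
      using Pc by simp
    also have "\<dots> \<le> c * (C * (\<omega> (\<phi> z) * norm (\<phi> z) ^ n))"
      using n c by (intro mult_left_mono) auto
    also have "\<dots> = (C * c * \<omega> (\<phi> z)) * norm (\<phi> z) ^ n"
      by simp
    finally have "q z * norm (\<phi> z) ^ n \<le> (C * c * \<omega> (\<phi> z)) * norm (\<phi> z) ^ n" .
    moreover have "0 < norm (\<phi> z) ^ n"
      using z by simp
    ultimately show ?thesis
      by (rule mult_right_le_imp_le)
  qed
  moreover have "max r 0 < 1"
    using r by simp
  ultimately have "max r 0 < 1 \<and> (\<forall>z\<in>\<bbbD>. max r 0 < norm (\<phi> z) \<longrightarrow> q z \<le> C * c * \<omega> (\<phi> z))"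
    by simp
  then show ?thesis ..
qed

section \<open>Peaking of the two weights\<close>

lemma peak_exponent:
  fixes s :: real
  assumes "0 < s" "s \<le> 1/2"
  defines "n \<equiv> nat \<lfloor>1 / s\<rfloor>"
  shows "1/2 \<le> n * s" "exp (-2) \<le> (1 - s) ^ n"
proof -
  have n: "real n = of_int \<lfloor>1 / s\<rfloor>"
    using assms by (simp add: n_def)
  have le: "n * s \<le> 1"
    using mult_right_mono[OF of_int_floor_le[of "1 / s"], of s] assms by (simp add: n)
  have "1 / s - 1 \<le> n"
    unfolding n by linarith
  then have "(1 / s - 1) * s \<le> n * s"
    using assms by (intro mult_right_mono) auto
  then show "1/2 \<le> n * s"
    using assms by (simp add: algebra_simps)
  have "inverse (1 - s) \<le> 1 + 2 * s"
  proof -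
    have "1 + 2 * (s * s) \<le> 1 + s"
      using assms mult_right_mono[of "2 * s" 1 s] by simp
    then show ?thesis
      using assms by (simp add: field_simps)
  qed
  also have "\<dots> \<le> exp (2 * s)"
    by (rule exp_ge_add_one_self)
  finally have "exp (- (2 * s)) \<le> 1 - s"
    using assms by (simp add: exp_minus field_simps)
  then have "exp (- (2 * s)) ^ n \<le> (1 - s) ^ n"
    by (intro power_mono) auto
  moreover have "exp (- (2 * s)) ^ n = exp (- (2 * (n * s)))"
    by (simp add: exp_of_nat_mult[symmetric] mult_ac)
  ultimately show "exp (-2) \<le> (1 - s) ^ n"
    using le by (smt (verit) exp_le_cancel_iff)
qed

text \<open>With \<open>s = 1 - norm z\<close> and \<open>n = \<lfloor>1 / s\<rfloor>\<close> the power \<open>norm z ^ n\<close> stays above \<open>exp (-2)\<close>, while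
\<open>norm y ^ n\<close> is at most \<open>exp (- (1 - norm y) / (2 * s))\<close>. Peaking thus becomes a comparison of the
values of the weight at two points, in which the exponential outweighs the quotient of
\<open>1 - norm y\<close> and \<open>1 - norm z\<close>.\<close>

lemma peakingI:
  assumes pos: "\<And>z. z \<in> \<bbbD> \<Longrightarrow> 0 < \<omega> z"
    and cmp: "\<And>y z. y \<in> \<bbbD> \<Longrightarrow> z \<in> \<bbbD> \<Longrightarrow>
        \<omega> y * exp (- ((1 - norm y) / (1 - norm z) / 2)) \<le> C * \<omega> z"
    and C: "0 \<le> C"
  shows "peaking (C * exp 2) \<omega>"
  unfolding peaking_def
proof
  fix N :: nat
  let ?r = "1 - 1 / (real N + 2)"
  have "\<exists>n\<ge>N. weight_sup \<omega> n \<le> C * exp 2 * (\<omega> z * norm z ^ n)"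
    if z: "z \<in> \<bbbD>" "?r < norm z" for z
  proof -
    define s where "s = 1 - norm z"
    have s: "0 < s" "s \<le> 1/2" "s * (real N + 2) < 1"
    proof -
      have *: "s < 1 / (real N + 2)"
        using z by (simp add: s_def)
      then show "s * (real N + 2) < 1"
        by (simp add: field_simps)
      have "1 / (real N + 2) \<le> 1 / 2"
        by (intro divide_left_mono) auto
      then show "s \<le> 1/2" using * by linarith
    qed (use z in \<open>simp add: s_def\<close>)
    define n where "n = nat \<lfloor>1 / s\<rfloor>"
    note pe = peak_exponent[OF s(1,2), folded n_def]
    have "real N + 2 \<le> 1 / s"
      using s by (simp add: field_simps)
    then have "N \<le> n"
      unfolding n_def using s(1) by (subst le_nat_iff) (auto simp: le_floor_iff)
    moreover have "weight_sup \<omega> n \<le> C * exp 2 * (\<omega> z * norm z ^ n)"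
      unfolding power_sup_def
    proof (rule cSUP_least)
      fix y :: complex
      assume y: "y \<in> \<bbbD>"
      have "norm y ^ n \<le> exp (- (1 - norm y)) ^ n"
        using exp_ge_add_one_self[of "- (1 - norm y)"] by (intro power_mono) auto
      also have "\<dots> = exp (- (1 - norm y) * n)"
        by (simp add: exp_of_nat_mult[symmetric] mult_ac)
      also have "\<dots> \<le> exp (- ((1 - norm y) / s / 2))"
      proof -
        have "(1 - norm y) / s / 2 = (1 - norm y) / s * (1/2)"
          by simp
        also have "\<dots> \<le> (1 - norm y) / s * (n * s)"
          using pe y s by (intro mult_left_mono) auto
        also have "\<dots> = (1 - norm y) * n"
          using s by simp
        finally have "(1 - norm y) / s / 2 \<le> (1 - norm y) * n" .
        then show ?thesis
          unfolding exp_le_cancel_iff mult_minus_left by (rule le_imp_neg_le)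
      qed
      finally have "\<omega> y * norm y ^ n \<le> \<omega> y * exp (- ((1 - norm y) / s / 2))"
        using pos[OF y] by (intro mult_left_mono) auto
      also have "\<dots> \<le> C * \<omega> z"
        using cmp[OF y z(1)] by (simp add: s_def)
      also have "\<dots> \<le> C * \<omega> z * (exp 2 * norm z ^ n)"
      proof -
        have "1 \<le> exp 2 * norm z ^ n"
          using pe(2) by (simp add: s_def exp_minus field_simps)
        then show ?thesis
          using mult_left_mono[of 1 "exp 2 * norm z ^ n" "C * \<omega> z"] C pos[OF z(1)] by simp
      qed
      finally show "\<omega> y * norm y ^ n \<le> C * exp 2 * (\<omega> z * norm z ^ n)"
        by (simp add: mult_ac)
    qed simp
    ultimately show ?thesis by (intro exI[of _ n] conjI)
  qed
  moreover have "?r < 1" by simp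
  ultimately show "\<exists>r<1. \<forall>z\<in>\<bbbD>. r < norm z \<longrightarrow>
      (\<exists>n\<ge>N. weight_sup \<omega> n \<le> C * exp 2 * (\<omega> z * norm z ^ n))"
    by (intro exI[of _ ?r] conjI ballI impI)
qed

lemma times_exp_half_le: "x * exp (- (x / 2)) \<le> (2::real)"
proof -
  have "x \<le> 2 * exp (x / 2)"
    using exp_ge_add_one_self[of "x / 2"] by linarith
  then show ?thesis
    by (simp add: exp_minus field_simps)
qed

lemma peaking_v_log: "peaking (2 * exp 2) v_log"
proof (rule peakingI)
  fix y z :: complex
  assume y: "y \<in> \<bbbD>" and z: "z \<in> \<bbbD>"
  let ?s = "1 - norm z" and ?t = "1 - norm y"
  have s: "0 < ?s" "0 < ?t" "?s \<le> 1" "?t \<le> 1"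
    using y z by auto
  show "v_log y * exp (- (?t / ?s / 2)) \<le> 2 * v_log z"
  proof (cases "norm z \<le> norm y")
    case True
    have "v_log y * exp (- (?t / ?s / 2)) \<le> v_log y * 1"
      using v_log_pos[OF y] s by (intro mult_left_mono) auto
    then show ?thesis
      using v_log_quasi_mono[OF True y] by simp
  next
    case False
    have ln: "0 \<le> ln (2 / ?t)" "ln (2 / ?t) \<le> ln (2 / ?s)"
      using s False by (auto intro!: ln_ge_zero simp: field_simps)
    have "?t * ln (2 / ?t) * exp (- (?t / ?s / 2)) = ln (2 / ?t) * (?s * (?t / ?s * exp (- (?t / ?s / 2))))"
      using s by (simp add: field_simps)
    also have "\<dots> \<le> ln (2 / ?s) * (?s * 2)"
    proof (intro mult_mono ln(2) mult_left_mono times_exp_half_le)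
      show "0 \<le> ln (2 / ?s)"
        using ln by linarith
    qed (use s in \<open>auto intro!: mult_nonneg_nonneg divide_nonneg_pos\<close>)
    also have "\<dots> = 2 * (?s * ln (2 / ?s))"
      by (simp only: mult_ac)
    finally show ?thesis
      unfolding v_log_def .
  qed
qed (auto simp: v_log_pos)

text \<open>Two applications of \<open>ln x \<le> x - 1\<close> bound the increment of the iterated logarithm by the quotient
of the distances to the boundary, which the exponential factor in \<open>peakingI\<close> absorbs.\<close>

lemma loglog_le_add:
  assumes "norm y \<le> norm z" "z \<in> \<bbbD>"
  shows "loglog z \<le> loglog y + 2 * ((1 - norm y) / (1 - norm z))"
proof -
  define a b where "a = 1 - (norm z)\<^sup>2" and "b = 1 - (norm y)\<^sup>2"
  have y: "y \<in> \<bbbD>"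
    using assms by simp
  have ab: "0 < a" "a \<le> b"
    using norm_disc_sq[OF assms(2)] power_mono[OF assms(1), of 2] by (auto simp: a_def b_def)
  define X Y where "X = ln (4 / a)" and "Y = ln (4 / b)"
  have Y: "1 < Y"
    using ln_four_over_gt_1[OF y] by (simp add: Y_def b_def)
  have XY: "X - Y = ln (b / a)"
    using ab by (simp add: X_def Y_def ln_div)
  have "0 \<le> X - Y"
    unfolding XY using ab by (intro ln_ge_zero) auto
  then have "loglog z - loglog y = ln (X / Y)"
    using Y by (simp add: loglog_def X_def Y_def a_def b_def ln_div)
  also have "\<dots> \<le> X / Y - 1"
    using Y \<open>0 \<le> X - Y\<close> by (intro ln_le_minus_one) auto
  also have "\<dots> = (X - Y) / Y"
    using Y by (simp add: field_simps)
  also have "\<dots> \<le> X - Y"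
    using Y \<open>0 \<le> X - Y\<close> divide_left_mono[of 1 Y "X - Y"] by simp
  also have "\<dots> \<le> b / a"
    unfolding XY using ab ln_le_minus_one[of "b / a"] by simp
  also have "b / a \<le> (2 * (1 - norm y)) / (1 - norm z)"
  proof (rule frac_le)
    have "b = (1 + norm y) * (1 - norm y)"
      by (simp add: b_def power2_eq_square algebra_simps)
    also have "\<dots> \<le> 2 * (1 - norm y)"
      using y by (intro mult_right_mono) auto
    finally show "b \<le> 2 * (1 - norm y)" .
    have "1 * (1 - norm z) \<le> (1 + norm z) * (1 - norm z)"
      using assms by (intro mult_right_mono) auto
    then show "1 - norm z \<le> a"
      by (simp add: a_def power2_eq_square algebra_simps)
  qed (use y assms in auto)
  finally show ?thesis by simp
qed

lemma peaking_w_log: "peaking ((1 + 4 / loglog 0) * exp 2) w_log"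
proof (rule peakingI)
  fix y z :: complex
  assume y: "y \<in> \<bbbD>" and z: "z \<in> \<bbbD>"
  let ?C = "1 + 4 / loglog 0"
  define x where "x = (1 - norm y) / (1 - norm z)"
  have x: "0 \<le> x"
    using y z by (simp add: x_def)
  have C1: "1 \<le> ?C"
    using loglog0_pos by simp
  note p = loglog_pos[OF y] loglog_pos[OF z]
  have "loglog z * exp (- (x / 2)) \<le> ?C * loglog y"
  proof (cases "norm z \<le> norm y")
    case True
    have "loglog z * exp (- (x / 2)) \<le> loglog z * 1"
    proof (intro mult_left_mono)
      show "exp (- (x / 2)) \<le> 1"
        unfolding exp_le_one_iff using x by linarith
    qed (use p in auto)
    also have "\<dots> \<le> 1 * loglog y"
      using loglog_mono[OF True y] by simp
    also have "\<dots> \<le> ?C * loglog y"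
      using C1 p by (intro mult_right_mono) auto
    finally show ?thesis .
  next
    case False
    then have "loglog z * exp (- (x / 2)) \<le> (loglog y + 2 * x) * exp (- (x / 2))"
      using loglog_le_add[of y z, folded x_def] z by (intro mult_right_mono) auto
    also have "\<dots> = loglog y * exp (- (x / 2)) + 2 * (x * exp (- (x / 2)))"
      by (simp add: algebra_simps)
    also have "\<dots> \<le> loglog y * 1 + 2 * 2"
    proof (intro add_mono mult_left_mono)
      show "exp (- (x / 2)) \<le> 1"
        unfolding exp_le_one_iff using x by linarith
    qed (use p times_exp_half_le[of x] in auto)
    also have "\<dots> \<le> ?C * loglog y"
      using loglog_ge[OF y] loglog0_pos by (simp add: field_simps)
    finally show ?thesis .
  qed
  then show "w_log y * exp (- ((1 - norm y) / (1 - norm z) / 2)) \<le> ?C * w_log z"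
    unfolding x_def[symmetric] using p by (simp add: w_log_eq field_simps)
qed (use w_log_pos loglog0_pos in auto)

lemma bounded_weight_v_log: "bounded_weight v_log"
  using v_log_le_2 v_log_pos unfolding bounded_weight_def by (intro exI[of _ 2]) (auto simp del: mem_ball_0 intro: less_imp_le)

lemma bounded_weight_w_log: "bounded_weight w_log"
  unfolding bounded_weight_def
proof (intro exI[of _ "1 / loglog 0"] ballI conjI)
  fix z :: complex
  assume z: "z \<in> \<bbbD>"
  show "0 \<le> w_log z" using w_log_pos[OF z] by simp
  show "w_log z \<le> 1 / loglog 0"
    using loglog_ge[OF z] loglog0_pos by (simp add: w_log_eq frac_le)
qed

section \<open>The quantity \<open>M\<close> as a pair of weighted suprema\<close>

lemma contour_integral_has_derivative:
  assumes h: "h holomorphic_on \<bbbD>" and z: "z \<in> \<bbbD>"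
  shows "((\<lambda>z. contour_integral (linepath 0 z) h) has_field_derivative h z) (at z)"
proof -
  obtain g where g: "\<And>x. x \<in> \<bbbD> \<Longrightarrow> (g has_field_derivative h x) (at x within \<bbbD>)"
    using holomorphic_convex_primitive'[OF convex_ball open_ball h] by blast
  have "contour_integral (linepath 0 w) h = g w - g 0" if "w \<in> \<bbbD>" for w
  proof -
    have "path_image (linepath 0 w) \<subseteq> \<bbbD>"
      using that by (simp add: closed_segment_subset)
    from contour_integral_primitive[OF g valid_path_linepath this]
    show ?thesis
      by (simp add: contour_integral_unique)
  qed
  moreover have "((\<lambda>w. g w - g 0) has_field_derivative h z) (at z)"
    using DERIV_diff[OF g[OF z] DERIV_const[of "g 0"]] z by (simp add: at_within_open[of z \<bbbD>])
  ultimately show ?thesis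
    using has_field_derivative_transform_within_open[of "\<lambda>w. g w - g 0" "h z" z \<bbbD>] z by simp
qed

lemma contour_integral_holomorphic:
  assumes "h holomorphic_on \<bbbD>"
  shows "(\<lambda>z. contour_integral (linepath 0 z) h) holomorphic_on \<bbbD>"
  unfolding holomorphic_on_open[OF open_ball]
proof (intro ballI exI)
  show "((\<lambda>z. contour_integral (linepath 0 z) h) has_field_derivative h x) (at x)" if "x \<in> \<bbbD>" for x
    by (rule contour_integral_has_derivative[OF assms that])
qed

lemma deriv_eq_on_disc:
  assumes "\<And>w. w \<in> \<bbbD> \<Longrightarrow> f w = g w" "z \<in> \<bbbD>"
  shows "deriv f z = deriv g z"
  using assms by (intro deriv_cong_ev[OF eventually_mono[OF eventually_nhds_in_open[of \<bbbD>]]]) auto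

text \<open>The operators \<open>I'_op\<close> and \<open>J'_op\<close> are double primitives that vanish to second order at 0, so that
only the supremum remains of the norm.\<close>

lemma zygmund_norm_iterated_primitive:
  assumes h: "h holomorphic_on \<bbbD>"
  shows "zygmund_norm v (\<lambda>z. contour_integral (linepath 0 z)
      (\<lambda>z. contour_integral (linepath 0 z) h)) = (SUP z\<in>\<bbbD>. v z * norm (h z))"
proof -
  let ?H = "\<lambda>z. contour_integral (linepath 0 z) h"
  let ?HH = "\<lambda>z. contour_integral (linepath 0 z) ?H"
  have H: "?H holomorphic_on \<bbbD>"
    by (rule contour_integral_holomorphic[OF h])
  have 1: "deriv ?HH z = ?H z" "deriv ?H z = h z" if "z \<in> \<bbbD>" for z
    using contour_integral_has_derivative[OF H that] contour_integral_has_derivative[OF h that]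
    by (auto intro: DERIV_imp_deriv)
  have 2: "deriv (deriv ?HH) z = h z" if "z \<in> \<bbbD>" for z
    using deriv_eq_on_disc[of "deriv ?HH" ?H z] 1 that by simp
  have "zygmund_norm v ?HH = (SUP z\<in>\<bbbD>. v z * norm (deriv (deriv ?HH) z))"
    using 1(1)[of 0] by (simp add: zygmund_norm_def)
  also have "\<dots> = (SUP z\<in>\<bbbD>. v z * norm (h z))"
    by (rule SUP_cong) (auto simp: 2)
  finally show ?thesis .
qed

lemma SUP_cmult:
  fixes f :: "'a \<Rightarrow> real"
  assumes "0 < k" "A \<noteq> {}" "bdd_above (f ` A)"
  shows "(SUP x\<in>A. k * f x) = k * (SUP x\<in>A. f x)"
proof (rule antisym)
  show "(SUP x\<in>A. k * f x) \<le> k * (SUP x\<in>A. f x)"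
    by (rule cSUP_least) (use assms in \<open>auto intro!: mult_left_mono cSUP_upper\<close>)
  have bdd: "bdd_above ((\<lambda>x. k * f x) ` A)"
    by (rule bdd_aboveI2[where M = "k * (SUP x\<in>A. f x)"])
      (use assms in \<open>auto intro!: mult_left_mono cSUP_upper\<close>)
  have "(SUP x\<in>A. f x) \<le> (SUP x\<in>A. k * f x) / k"
    using assms cSUP_upper[OF _ bdd]
    by (intro cSUP_least) (auto simp: pos_le_divide_eq mult.commute)
  then show "k * (SUP x\<in>A. f x) \<le> (SUP x\<in>A. k * f x)"
    using assms by (simp add: field_simps)
qed

lemma power_sup_cmult:
  assumes "bounded_weight q" "\<phi> ` \<bbbD> \<subseteq> \<bbbD>" "0 < k"
  shows "(SUP z\<in>\<bbbD>. k * (q z * norm (\<phi> z) ^ n)) = k * power_sup q \<phi> n"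
  unfolding power_sup_def using assms by (intro SUP_cmult bdd_above_power_sup) auto

lemma zygmund_norm_power:
  assumes "bounded_weight v"
  shows "zygmund_norm v (\<lambda>z. z ^ (n + 2)) = real (n + 2) * real (n + 1) * weight_sup v n"
proof -
  have 1: "deriv (\<lambda>z::complex. z ^ (n + 2)) = (\<lambda>z. of_nat (n + 2) * z ^ (n + 1))"
    using DERIV_power[OF DERIV_ident, where n = "n + 2"] by (intro ext DERIV_imp_deriv) simp
  have 2: "deriv (\<lambda>z::complex. of_nat (n + 2) * z ^ (n + 1)) =
      (\<lambda>z. of_nat (n + 2) * (of_nat (n + 1) * z ^ n))"
    using DERIV_cmult[OF DERIV_power[OF DERIV_ident, where n = "n + 1"], where c = "of_nat (n + 2)"]
    by (intro ext DERIV_imp_deriv) simp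
  have "zygmund_norm v (\<lambda>z. z ^ (n + 2)) =
      (SUP z\<in>\<bbbD>. (real (n + 2) * real (n + 1)) * (v z * norm z ^ n))"
    unfolding zygmund_norm_def 1 2
    by (simp add: norm_mult norm_power mult_ac del: of_nat_Suc of_nat_add)
  also have "\<dots> = real (n + 2) * real (n + 1) * weight_sup v n"
    using assms by (intro power_sup_cmult) auto
  finally show ?thesis .
qed

text \<open>The second derivatives of \<open>J'_op (deriv \<phi>) (\<phi> ^ n)\<close> and \<open>I'_op (deriv \<phi>) (\<phi> ^ n)\<close> are \<open>\<phi> ^ n * \<phi>''\<close> and
\<open>n * \<phi> ^ (n - 1) * \<phi>'\<^sup>2\<close>. The numerical factors in the definition of \<open>M_log\<close> cancel
those of the monomials in the denominators, and an index shift in the second sequence aligns the powers.\<close>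

lemma M_log_eq:
  assumes \<phi>: "\<phi> holomorphic_on \<bbbD>" "\<phi> ` \<bbbD> \<subseteq> \<bbbD>"
    and q1: "bounded_weight (\<lambda>z. v_log z * norm (deriv (deriv \<phi>) z))"
    and q2: "bounded_weight (\<lambda>z. v_log z * (norm (deriv \<phi> z))\<^sup>2)"
  shows "M_log \<phi> = max
     (limsup (\<lambda>n. ereal (power_sup (\<lambda>z. v_log z * norm (deriv (deriv \<phi>) z)) \<phi> n / weight_sup w_log n)))
     (limsup (\<lambda>n. ereal (power_sup (\<lambda>z. v_log z * (norm (deriv \<phi> z))\<^sup>2) \<phi> n / weight_sup v_log n)))"
proof -
  let ?q1 = "\<lambda>z. v_log z * norm (deriv (deriv \<phi>) z)"
  let ?q2 = "\<lambda>z. v_log z * (norm (deriv \<phi> z))\<^sup>2"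
  have d: "deriv \<phi> holomorphic_on \<bbbD>" "deriv (deriv \<phi>) holomorphic_on \<bbbD>"
    using \<phi> by (auto intro!: holomorphic_deriv)
  have "zygmund_norm v_log (J'_op (deriv \<phi>) (\<lambda>z. \<phi> z ^ n)) = power_sup ?q1 \<phi> n" for n
    unfolding J'_op_def J_op_def power_sup_def
    by (subst zygmund_norm_iterated_primitive)
      (auto intro!: holomorphic_intros d \<phi> simp: norm_mult norm_power mult_ac)
  then have J: "real (n + 2) * real (n + 1) * zygmund_norm v_log (J'_op (deriv \<phi>) (\<lambda>z. \<phi> z ^ n)) /
      zygmund_norm w_log (\<lambda>z. z ^ (n + 2)) = power_sup ?q1 \<phi> n / weight_sup w_log n" for n
    unfolding zygmund_norm_power[OF bounded_weight_w_log] by simp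
  have "zygmund_norm v_log (I'_op (deriv \<phi>) (\<lambda>z. \<phi> z ^ (n + 1))) = real (n + 1) * power_sup ?q2 \<phi> n" for n
  proof -
    have hol: "(\<lambda>s. deriv (\<lambda>z. \<phi> z ^ (n + 1)) s * deriv \<phi> s) holomorphic_on \<bbbD>"
      by (intro holomorphic_intros holomorphic_deriv d \<phi>) auto
    have "deriv (\<lambda>z. \<phi> z ^ (n + 1)) z = of_nat (n + 1) * \<phi> z ^ n * deriv \<phi> z" if "z \<in> \<bbbD>" for z
      using DERIV_power[OF holomorphic_derivI[OF \<phi>(1) open_ball that], of "n + 1"]
      by (intro DERIV_imp_deriv) (simp add: mult_ac)
    then have "(SUP z\<in>\<bbbD>. v_log z * norm (deriv (\<lambda>z. \<phi> z ^ (n + 1)) z * deriv \<phi> z)) =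
        (SUP z\<in>\<bbbD>. real (n + 1) * (?q2 z * norm (\<phi> z) ^ n))"
      by (intro SUP_cong)
        (auto simp: norm_mult norm_power power2_eq_square mult_ac simp del: of_nat_Suc of_nat_add)
    also have "\<dots> = real (n + 1) * power_sup ?q2 \<phi> n"
      by (intro power_sup_cmult q2 \<phi>) auto
    finally show ?thesis
      unfolding I'_op_def I_op_def zygmund_norm_iterated_primitive[OF hol] .
  qed
  then have I: "real (n + 1 + 1) * zygmund_norm v_log (I'_op (deriv \<phi>) (\<lambda>z. \<phi> z ^ (n + 1))) /
      zygmund_norm v_log (\<lambda>z. z ^ (n + 1 + 1)) = power_sup ?q2 \<phi> n / weight_sup v_log n" for n
    using zygmund_norm_power[OF bounded_weight_v_log, of n] by simp
  have "limsup (\<lambda>n. ereal (real (n + 1) * zygmund_norm v_log (I'_op (deriv \<phi>) (\<lambda>z. \<phi> z ^ n)) /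
         zygmund_norm v_log (\<lambda>z. z ^ (n + 1)))) =
      limsup (\<lambda>n. ereal (power_sup ?q2 \<phi> n / weight_sup v_log n))"
    unfolding I[symmetric]
    by (rule limsup_shift[symmetric])
  then show ?thesis
    unfolding M_log_def J by simp
qed

section \<open>Composition operators on the space\<close>

definition extend_zero :: "(complex \<Rightarrow> complex) \<Rightarrow> complex \<Rightarrow> complex" where
  "extend_zero h = (\<lambda>z. if z \<in> \<bbbD> then h z else 0)"

lemma extend_zero_derivs:
  assumes "z \<in> \<bbbD>"
  shows "deriv (extend_zero h) z = deriv h z"
    and "deriv (deriv (extend_zero h)) z = deriv (deriv h) z"
proof -
  have 1: "deriv (extend_zero h) z = deriv h z" if "z \<in> \<bbbD>" for z
    using that by (intro deriv_eq_on_disc) (auto simp: extend_zero_def)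
  show "deriv (extend_zero h) z = deriv h z"
    by (rule 1[OF assms])
  show "deriv (deriv (extend_zero h)) z = deriv (deriv h) z"
    using assms by (intro deriv_eq_on_disc 1)
qed

lemma extend_zero_in_zygmund:
  assumes "h holomorphic_on \<bbbD>" "\<And>z. z \<in> \<bbbD> \<Longrightarrow> v_log z * norm (deriv (deriv h) z) \<le> B"
  shows "extend_zero h \<in> zygmund v_log"
  unfolding zygmund_def
proof (intro CollectI conjI allI impI)
  show "extend_zero h holomorphic_on \<bbbD>"
    by (rule holomorphic_transform[OF assms(1)]) (auto simp: extend_zero_def)
  show "bdd_above ((\<lambda>z. v_log z * norm (deriv (deriv (extend_zero h)) z)) ` \<bbbD>)"
    using assms(2) extend_zero_derivs by (intro bdd_aboveI2[where M = B]) auto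
qed (auto simp: extend_zero_def)

text \<open>Test functions are prescribed through their first derivative.\<close>

lemma zyg_with_derivative:
  assumes g: "g holomorphic_on \<bbbD>" and B: "\<And>z. z \<in> \<bbbD> \<Longrightarrow> v_log z * norm (deriv g z) \<le> B"
  shows "\<exists>f. norm f \<le> norm (g 0) + B \<and> (\<forall>z\<in>\<bbbD>. deriv (Rep_zyg_vlog f) z = g z \<and>
     deriv (deriv (Rep_zyg_vlog f)) z = deriv g z)"
proof -
  let ?G = "\<lambda>z. contour_integral (linepath 0 z) g"
  have 1: "deriv ?G z = g z" if "z \<in> \<bbbD>" for z
    using contour_integral_has_derivative[OF g that] by (rule DERIV_imp_deriv)
  have 2: "deriv (deriv ?G) z = deriv g z" if "z \<in> \<bbbD>" for z
    using that by (intro deriv_eq_on_disc 1)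
  have mem: "extend_zero ?G \<in> zygmund v_log"
    using contour_integral_holomorphic[OF g] B 2 by (intro extend_zero_in_zygmund[of _ B]) auto
  define f where "f = Abs_zyg_vlog (extend_zero ?G)"
  have f: "Rep_zyg_vlog f = extend_zero ?G"
    unfolding f_def by (rule Abs_zyg_vlog_inverse[OF mem])
  have d: "deriv (Rep_zyg_vlog f) z = g z" "deriv (deriv (Rep_zyg_vlog f)) z = deriv g z"
    if "z \<in> \<bbbD>" for z
    using extend_zero_derivs[OF that, of ?G] 1[OF that] 2[OF that] by (auto simp: f)
  have "norm f \<le> norm (Rep_zyg_vlog f 0) + norm (deriv (Rep_zyg_vlog f) 0) + B"
    using B d by (intro zyg_norm_le) auto
  then have "norm f \<le> norm (g 0) + B"
    using d(1)[of 0] by (simp add: f extend_zero_def)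
  moreover have "\<forall>z\<in>\<bbbD>. deriv (Rep_zyg_vlog f) z = g z \<and> deriv (deriv (Rep_zyg_vlog f)) z = deriv g z"
    using d by (intro ballI conjI)
  ultimately show ?thesis
    by (intro exI[of _ f] conjI)
qed

lemma Rep_zyg_linear:
  "Rep_zyg_vlog (f + g) z = Rep_zyg_vlog f z + Rep_zyg_vlog g z"
  "Rep_zyg_vlog (scaleC c f) z = c * Rep_zyg_vlog f z"
  "Rep_zyg_vlog (r *\<^sub>R f) z = of_real r * Rep_zyg_vlog f z"
  "Rep_zyg_vlog (f - g) z = Rep_zyg_vlog f z - Rep_zyg_vlog g z"
  by (simp_all add: plus_zyg_vlog.rep_eq scaleC_zyg_vlog.rep_eq scaleR_zyg_vlog_def
      minus_zyg_vlog_def uminus_zyg_vlog_def)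

lemma deriv_zyg_diff:
  assumes "z \<in> \<bbbD>"
  shows "deriv (Rep_zyg_vlog (f - g)) z = deriv (Rep_zyg_vlog f) z - deriv (Rep_zyg_vlog g) z"
    and "deriv (deriv (Rep_zyg_vlog (f - g))) z =
      deriv (deriv (Rep_zyg_vlog f)) z - deriv (deriv (Rep_zyg_vlog g)) z"
proof -
  have d: "h field_differentiable at w" if "h holomorphic_on \<bbbD>" "w \<in> \<bbbD>" for h w
    using that holomorphic_on_imp_differentiable_at by blast
  have eq: "Rep_zyg_vlog (f - g) = (\<lambda>z. Rep_zyg_vlog f z - Rep_zyg_vlog g z)"
    by (auto simp: Rep_zyg_linear)
  have 1: "deriv (Rep_zyg_vlog (f - g)) z = deriv (Rep_zyg_vlog f) z - deriv (Rep_zyg_vlog g) z"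
    if "z \<in> \<bbbD>" for z
    unfolding eq by (intro deriv_diff d zyg_holomorphic that)
  show "deriv (Rep_zyg_vlog (f - g)) z = deriv (Rep_zyg_vlog f) z - deriv (Rep_zyg_vlog g) z"
    by (rule 1[OF assms])
  have "deriv (deriv (Rep_zyg_vlog (f - g))) z =
      deriv (\<lambda>z. deriv (Rep_zyg_vlog f) z - deriv (Rep_zyg_vlog g) z) z"
    using assms by (intro deriv_eq_on_disc 1)
  also have "\<dots> = deriv (deriv (Rep_zyg_vlog f)) z - deriv (deriv (Rep_zyg_vlog g)) z"
    by (intro deriv_diff d zyg_deriv_holomorphic assms)
  finally show "deriv (deriv (Rep_zyg_vlog (f - g))) z =
      deriv (deriv (Rep_zyg_vlog f)) z - deriv (deriv (Rep_zyg_vlog g)) z" .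
qed

lemma linearC_bounded:
  fixes T :: "'a::complex_normed_vector \<Rightarrow> 'b::complex_normed_vector"
  assumes T: "Vector_Spaces.linear scaleC scaleC T"
    and d: "0 < d" and B: "\<And>x. norm x \<le> d \<Longrightarrow> norm (T x) \<le> B"
  shows "bounded_linear T"
proof -
  interpret T: Vector_Spaces.linear "scaleC :: complex \<Rightarrow> 'a \<Rightarrow> 'a" "scaleC :: complex \<Rightarrow> 'b \<Rightarrow> 'b" T
    by (rule T)
  have sc: "T (r *\<^sub>R x) = r *\<^sub>R T x" for r x
    by (simp add: scaleR_scaleC T.scale)
  show ?thesis
  proof (rule bounded_linear_intro[where K = "B / d"])
    fix x
    show "norm (T x) \<le> norm x * (B / d)"
    proof (cases "x = 0")
      case True
      then show ?thesis by (simp add: T.zero)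
    next
      case False
      have "norm (T ((d / norm x) *\<^sub>R x)) \<le> B"
        using False d by (intro B) simp
      then show ?thesis
        using False d by (simp add: sc field_simps)
    qed
  qed (simp_all add: T.add sc)
qed

lemma linearC_diff:
  fixes T :: "'a::complex_normed_vector \<Rightarrow> 'b::complex_normed_vector"
  assumes "Vector_Spaces.linear scaleC scaleC T"
  shows "T (x - y) = T x - T y"
proof -
  interpret T: Vector_Spaces.linear "scaleC :: complex \<Rightarrow> 'a \<Rightarrow> 'a" "scaleC :: complex \<Rightarrow> 'b \<Rightarrow> 'b" T
    by (rule assms)
  show ?thesis
    using T.add[of "x - y" y] by simp
qed

lemma compact_operator_bounded_linear:
  assumes "compact_operator K"
  shows "bounded_linear K"
proof -
  have "bounded (closure (K ` cball 0 1))"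
    using assms by (auto simp: compact_operator_def intro: compact_imp_bounded)
  then have "bounded (K ` cball 0 1)"
    using bounded_subset closure_subset by blast
  then obtain B where "\<forall>y\<in>K ` cball 0 1. norm y \<le> B"
    by (auto simp: bounded_iff)
  then show ?thesis
    using assms by (intro linearC_bounded[of K 1 B]) (auto simp: compact_operator_def)
qed

lemma Rep_comp_op:
  assumes "\<forall>f\<in>zygmund v_log. comp_ext \<phi> f \<in> zygmund v_log"
  shows "Rep_zyg_vlog (comp_op \<phi> f) = comp_ext \<phi> (Rep_zyg_vlog f)"
  unfolding comp_op_def using assms by (intro Abs_zyg_vlog_inverse) (auto simp: Rep_zyg_vlog)

lemma comp_op_linear:
  assumes "\<forall>f\<in>zygmund v_log. comp_ext \<phi> f \<in> zygmund v_log"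
  shows "Vector_Spaces.linear scaleC scaleC (comp_op \<phi>)"
proof -
  interpret V: vector_space "scaleC :: complex \<Rightarrow> zyg_vlog \<Rightarrow> zyg_vlog"
    by (rule vector_space_scaleC)
  show ?thesis
    by unfold_locales
      (auto simp: Rep_zyg_vlog_inject[symmetric] fun_eq_iff Rep_comp_op[OF assms] comp_ext_def Rep_zyg_linear)
qed

lemma comp_op_bounded_linear:
  assumes "comp_op_continuous \<phi>"
  shows "bounded_linear (comp_op \<phi>)"
proof -
  have ext: "\<forall>f\<in>zygmund v_log. comp_ext \<phi> f \<in> zygmund v_log"
    using assms by (simp add: comp_op_continuous_def)
  interpret T: Vector_Spaces.linear "scaleC :: complex \<Rightarrow> zyg_vlog \<Rightarrow> zyg_vlog"
    "scaleC :: complex \<Rightarrow> zyg_vlog \<Rightarrow> zyg_vlog" "comp_op \<phi>"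
    by (rule comp_op_linear[OF ext])
  have "continuous (at 0) (comp_op \<phi>)"
    using assms by (simp add: comp_op_continuous_def continuous_on_eq_continuous_at)
  then obtain d where d: "0 < d" "\<And>x. dist x 0 < d \<Longrightarrow> dist (comp_op \<phi> x) (comp_op \<phi> 0) < 1"
    unfolding continuous_at_eps_delta by (metis zero_less_one)
  show ?thesis
  proof (rule linearC_bounded[OF comp_op_linear[OF ext]])
    show "0 < d / 2" using d by simp
    fix x :: zyg_vlog
    assume "norm x \<le> d / 2"
    then have "norm (comp_op \<phi> x) < 1"
      using d(1) d(2)[of x] by (simp add: T.zero)
    then show "norm (comp_op \<phi> x) \<le> 1" by simp
  qed
qed

lemma deriv_compose_disc:
  assumes f: "f holomorphic_on \<bbbD>" and \<phi>: "\<phi> holomorphic_on \<bbbD>" "\<phi> ` \<bbbD> \<subseteq> \<bbbD>" and z: "z \<in> \<bbbD>"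
  shows "deriv (\<lambda>z. f (\<phi> z)) z = deriv f (\<phi> z) * deriv \<phi> z"
    and "deriv (deriv (\<lambda>z. f (\<phi> z))) z =
      deriv (deriv f) (\<phi> z) * (deriv \<phi> z)\<^sup>2 + deriv f (\<phi> z) * deriv (deriv \<phi>) z"
proof -
  have \<phi>z: "\<phi> w \<in> \<bbbD>" if "w \<in> \<bbbD>" for w
    using \<phi>(2) that by blast
  have d\<phi>: "(\<phi> has_field_derivative deriv \<phi> w) (at w)"
    "(deriv \<phi> has_field_derivative deriv (deriv \<phi>) w) (at w)" if "w \<in> \<bbbD>" for w
    using that \<phi>(1) by (auto intro!: holomorphic_derivI[of _ \<bbbD>] holomorphic_deriv)
  have df: "(f has_field_derivative deriv f (\<phi> w)) (at (\<phi> w))"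
    "(deriv f has_field_derivative deriv (deriv f) (\<phi> w)) (at (\<phi> w))" if "w \<in> \<bbbD>" for w
    using \<phi>z[OF that] f by (auto intro!: holomorphic_derivI[of _ \<bbbD>] holomorphic_deriv)
  have 1: "deriv (\<lambda>z. f (\<phi> z)) w = deriv f (\<phi> w) * deriv \<phi> w" if "w \<in> \<bbbD>" for w
    by (rule DERIV_imp_deriv[OF DERIV_chain2[OF df(1)[OF that] d\<phi>(1)[OF that]]])
  show "deriv (\<lambda>z. f (\<phi> z)) z = deriv f (\<phi> z) * deriv \<phi> z"
    by (rule 1[OF z])
  have "deriv (deriv (\<lambda>z. f (\<phi> z))) z = deriv (\<lambda>w. deriv f (\<phi> w) * deriv \<phi> w) z"
    using z by (intro deriv_eq_on_disc 1)
  also have "\<dots> = deriv (deriv f) (\<phi> z) * (deriv \<phi> z)\<^sup>2 + deriv f (\<phi> z) * deriv (deriv \<phi>) z"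
    using DERIV_mult[OF DERIV_chain2[OF df(2)[OF z] d\<phi>(1)[OF z]] d\<phi>(2)[OF z]]
    by (intro DERIV_imp_deriv) (simp add: power2_eq_square algebra_simps)
  finally show "deriv (deriv (\<lambda>z. f (\<phi> z))) z =
      deriv (deriv f) (\<phi> z) * (deriv \<phi> z)\<^sup>2 + deriv f (\<phi> z) * deriv (deriv \<phi>) z" .
qed

lemma comp_op_derivs:
  assumes ext: "\<forall>f\<in>zygmund v_log. comp_ext \<phi> f \<in> zygmund v_log"
    and \<phi>: "\<phi> holomorphic_on \<bbbD>" "\<phi> ` \<bbbD> \<subseteq> \<bbbD>" and z: "z \<in> \<bbbD>"
  shows "deriv (Rep_zyg_vlog (comp_op \<phi> f)) z = deriv (Rep_zyg_vlog f) (\<phi> z) * deriv \<phi> z"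
    and "deriv (deriv (Rep_zyg_vlog (comp_op \<phi> f))) z =
      deriv (deriv (Rep_zyg_vlog f)) (\<phi> z) * (deriv \<phi> z)\<^sup>2 +
      deriv (Rep_zyg_vlog f) (\<phi> z) * deriv (deriv \<phi>) z"
proof -
  have eq: "Rep_zyg_vlog (comp_op \<phi> f) = extend_zero (\<lambda>z. Rep_zyg_vlog f (\<phi> z))"
    by (simp add: Rep_comp_op[OF ext] comp_ext_def extend_zero_def)
  note d = deriv_compose_disc[OF zyg_holomorphic \<phi> z, of f] extend_zero_derivs[OF z, of "\<lambda>z. Rep_zyg_vlog f (\<phi> z)"]
  show "deriv (Rep_zyg_vlog (comp_op \<phi> f)) z = deriv (Rep_zyg_vlog f) (\<phi> z) * deriv \<phi> z"
    unfolding eq using d(1,3) by simp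
  show "deriv (deriv (Rep_zyg_vlog (comp_op \<phi> f))) z =
      deriv (deriv (Rep_zyg_vlog f)) (\<phi> z) * (deriv \<phi> z)\<^sup>2 +
      deriv (Rep_zyg_vlog f) (\<phi> z) * deriv (deriv \<phi>) z"
    unfolding eq using d(2,4) by simp
qed

definition admissible :: "(complex \<Rightarrow> complex) \<Rightarrow> bool" where
  "admissible \<phi> \<longleftrightarrow> \<phi> holomorphic_on \<bbbD> \<and> \<phi> ` \<bbbD> \<subseteq> \<bbbD> \<and> comp_op_continuous \<phi>"

lemma admissible_derivs:
  assumes "admissible \<phi>" "z \<in> \<bbbD>"
  shows "deriv (Rep_zyg_vlog (comp_op \<phi> f)) z = deriv (Rep_zyg_vlog f) (\<phi> z) * deriv \<phi> z"
    and "deriv (deriv (Rep_zyg_vlog (comp_op \<phi> f))) z =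
      deriv (deriv (Rep_zyg_vlog f)) (\<phi> z) * (deriv \<phi> z)\<^sup>2 +
      deriv (Rep_zyg_vlog f) (\<phi> z) * deriv (deriv \<phi>) z"
  using comp_op_derivs[of \<phi> z f] assms by (auto simp: admissible_def comp_op_continuous_def)

text \<open>Since \<open>(f \<circ> \<phi>)'' = (f'' \<circ> \<phi>) * \<phi>'\<^sup>2 + (f' \<circ> \<phi>) * \<phi>''\<close>, the images of a primitive of 1 and of a
primitive of \<open>z\<close> have the second derivatives \<open>\<phi>''\<close> and \<open>\<phi>'\<^sup>2 + \<phi> * \<phi>''\<close>.\<close>

lemma admissible_bounded_weights:
  assumes adm: "admissible \<phi>"
  shows "bounded_weight (\<lambda>z. v_log z * norm (deriv (deriv \<phi>) z))"
    and "bounded_weight (\<lambda>z. v_log z * (norm (deriv \<phi> z))\<^sup>2)"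
proof -
  obtain f1 where f1: "\<forall>z\<in>\<bbbD>. deriv (Rep_zyg_vlog f1) z = 1 \<and> deriv (deriv (Rep_zyg_vlog f1)) z = 0"
    using zyg_with_derivative[of "\<lambda>_. 1" 0] by auto
  obtain f2 where f2: "\<forall>z\<in>\<bbbD>. deriv (Rep_zyg_vlog f2) z = z \<and> deriv (deriv (Rep_zyg_vlog f2)) z = 1"
    using zyg_with_derivative[of "\<lambda>z. z" 2] v_log_le_2 by auto
  let ?N1 = "norm (comp_op \<phi> f1)" and ?N2 = "norm (comp_op \<phi> f2)"
  have \<phi>z: "\<phi> z \<in> \<bbbD>" if "z \<in> \<bbbD>" for z
    using adm that unfolding admissible_def by blast
  have 1: "v_log z * norm (deriv (deriv \<phi>) z) \<le> ?N1" if z: "z \<in> \<bbbD>" for z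
    using zyg_second_deriv_le[OF z, of "comp_op \<phi> f1"] admissible_derivs(2)[OF adm z, of f1] bspec[OF f1 \<phi>z[OF z]]
    by simp
  have 2: "v_log z * (norm (deriv \<phi> z))\<^sup>2 \<le> ?N2 + ?N1" if z: "z \<in> \<bbbD>" for z
  proof -
    let ?a = "(deriv \<phi> z)\<^sup>2" and ?b = "\<phi> z * deriv (deriv \<phi>) z"
    have "norm ?a \<le> norm (?a + ?b) + norm ?b"
      using norm_triangle_ineq4[of "?a + ?b" ?b] by simp
    then have "v_log z * norm ?a \<le> v_log z * (norm (?a + ?b) + norm ?b)"
      using v_log_pos[OF z] by (intro mult_left_mono) auto
    also have "\<dots> = v_log z * norm (?a + ?b) + norm (\<phi> z) * (v_log z * norm (deriv (deriv \<phi>) z))"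
      by (simp add: norm_mult algebra_simps)
    also have "\<dots> \<le> ?N2 + 1 * ?N1"
    proof (intro add_mono mult_mono 1 z)
      show "v_log z * norm (?a + ?b) \<le> ?N2"
        using zyg_second_deriv_le[OF z, of "comp_op \<phi> f2"] admissible_derivs(2)[OF adm z, of f2] bspec[OF f2 \<phi>z[OF z]]
        by simp
      show "0 \<le> v_log z * norm (deriv (deriv \<phi>) z)"
        using v_log_pos[OF z] by simp
    qed (use \<phi>z[OF z] in auto)
    finally show ?thesis
      by (simp add: norm_power)
  qed
  have v0: "0 \<le> v_log z" if "z \<in> \<bbbD>" for z
    using v_log_pos[OF that] by simp
  show "bounded_weight (\<lambda>z. v_log z * norm (deriv (deriv \<phi>) z))"
    unfolding bounded_weight_def using 1 v0
    by (intro exI[of _ ?N1] ballI conjI mult_nonneg_nonneg) auto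
  show "bounded_weight (\<lambda>z. v_log z * (norm (deriv \<phi> z))\<^sup>2)"
    unfolding bounded_weight_def using 2 v0
    by (intro exI[of _ "?N2 + ?N1"] ballI conjI mult_nonneg_nonneg) auto
qed

section \<open>Dilations\<close>

definition dilation :: "real \<Rightarrow> zyg_vlog \<Rightarrow> zyg_vlog" where
  "dilation r = comp_op (\<lambda>z. of_real r * z)"

lemma dilation_disc:
  assumes "0 \<le> r" "r < 1" "z \<in> \<bbbD>"
  shows "norm (of_real r * z :: complex) \<le> norm z" "of_real r * z \<in> \<bbbD>"
    "norm (of_real r * z :: complex) \<le> r"
proof -
  show *: "norm (of_real r * z :: complex) \<le> norm z"
    using assms mult_right_mono[of r 1 "norm z"] by (simp add: norm_mult)
  show "of_real r * z \<in> \<bbbD>"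
    using * assms by simp
  show "norm (of_real r * z :: complex) \<le> r"
    using assms mult_left_mono[of "norm z" 1 r] by (simp add: norm_mult)
qed

lemma deriv_linear_map:
  "deriv (\<lambda>z. c * z) = (\<lambda>_. c :: complex)" "deriv (deriv (\<lambda>z. c * z)) = (\<lambda>_. 0 :: complex)"
proof -
  show 1: "deriv (\<lambda>z. c * z) = (\<lambda>_. c)"
    using DERIV_cmult[OF DERIV_ident, of c] by (intro ext DERIV_imp_deriv) simp
  show "deriv (deriv (\<lambda>z. c * z)) = (\<lambda>_. 0 :: complex)"
    unfolding 1 by simp
qed

context
  fixes r :: real
  assumes r: "0 \<le> r" "r < 1"
begin

lemma dilation_symbol:
  "(\<lambda>z. of_real r * z) holomorphic_on \<bbbD>" "(\<lambda>z. of_real r * z) ` \<bbbD> \<subseteq> \<bbbD>"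
  using dilation_disc(2)[OF r] by (auto intro!: holomorphic_intros)

lemma dilation_ext: "\<forall>f\<in>zygmund v_log. comp_ext (\<lambda>z. of_real r * z) f \<in> zygmund v_log"
proof
  fix f
  assume f: "f \<in> zygmund v_log"
  then have hf: "f holomorphic_on \<bbbD>"
    by (simp add: zygmund_def)
  let ?S = "SUP z\<in>\<bbbD>. v_log z * norm (deriv (deriv f) z)"
  have "extend_zero (\<lambda>z. f (of_real r * z)) \<in> zygmund v_log"
  proof (rule extend_zero_in_zygmund)
    show "(\<lambda>z. f (of_real r * z)) holomorphic_on \<bbbD>"
      using holomorphic_on_compose_gen[OF dilation_symbol(1) hf dilation_symbol(2)] by (simp add: o_def)
    fix z :: complex
    assume z: "z \<in> \<bbbD>"
    let ?f = "norm (deriv (deriv f) (of_real r * z))"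
    have "v_log z * norm (deriv (deriv (\<lambda>z. f (of_real r * z))) z) = r\<^sup>2 * (v_log z * ?f)"
      unfolding deriv_compose_disc(2)[OF hf dilation_symbol z] deriv_linear_map
      using r by (simp add: norm_mult norm_power)
    also have "\<dots> \<le> 1 * (2 * v_log (of_real r * z) * ?f)"
      using r v_log_quasi_mono[OF dilation_disc(1)[OF r z] z] v_log_pos[OF z]
      by (intro mult_mono) (auto simp: power_le_one)
    also have "\<dots> \<le> 2 * ?S"
      using zygmund_bound[OF f dilation_disc(2)[OF r z]] by simp
    finally show "v_log z * norm (deriv (deriv (\<lambda>z. f (of_real r * z))) z) \<le> 2 * ?S" .
  qed
  then show "comp_ext (\<lambda>z. of_real r * z) f \<in> zygmund v_log"
    by (simp add: comp_ext_def extend_zero_def)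
qed

lemma Rep_dilation:
  assumes "z \<in> \<bbbD>"
  shows "Rep_zyg_vlog (dilation r f) z = Rep_zyg_vlog f (of_real r * z)"
    and "deriv (Rep_zyg_vlog (dilation r f)) z = of_real r * deriv (Rep_zyg_vlog f) (of_real r * z)"
    and "deriv (deriv (Rep_zyg_vlog (dilation r f))) z =
      of_real (r\<^sup>2) * deriv (deriv (Rep_zyg_vlog f)) (of_real r * z)"
proof -
  note d = comp_op_derivs[OF dilation_ext dilation_symbol assms, of f]
  show "Rep_zyg_vlog (dilation r f) z = Rep_zyg_vlog f (of_real r * z)"
    unfolding dilation_def Rep_comp_op[OF dilation_ext] comp_ext_def using assms by simp
  show "deriv (Rep_zyg_vlog (dilation r f)) z = of_real r * deriv (Rep_zyg_vlog f) (of_real r * z)"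
    unfolding dilation_def d(1) deriv_linear_map by (rule mult.commute)
  show "deriv (deriv (Rep_zyg_vlog (dilation r f))) z =
      of_real (r\<^sup>2) * deriv (deriv (Rep_zyg_vlog f)) (of_real r * z)"
    unfolding dilation_def d(2) deriv_linear_map by simp
qed

lemma dilation_linear: "Vector_Spaces.linear scaleC scaleC (dilation r)"
  unfolding dilation_def by (rule comp_op_linear[OF dilation_ext])

text \<open>The norm of a dilated function sees only the disc of radius \<open>r\<close>, where Cauchy's estimates bound
the derivatives by the values on a slightly larger disc.\<close>

lemma norm_dilation_le:
  assumes k: "\<And>z. norm z \<le> (1 + r) / 2 \<Longrightarrow> norm (Rep_zyg_vlog k z) \<le> e"
  defines "d \<equiv> (1 - r) / 2"
  shows "norm (dilation r k) \<le> e * (1 + 1 / d + 4 / d\<^sup>2)"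
proof -
  let ?k = "Rep_zyg_vlog k"
  have d: "0 < d" "d < 1"
    using r by (auto simp: d_def)
  have e: "0 \<le> e"
    using order_trans[OF norm_ge_zero k[of 0]] r by simp
  have ch: "norm ((deriv ^^ n) ?k \<xi>) \<le> fact n * e / d ^ n" if "norm \<xi> \<le> r" for n \<xi>
  proof (rule Cauchy_inequality)
    have sub: "cball \<xi> d \<subseteq> \<bbbD>"
    proof
      fix x assume "x \<in> cball \<xi> d"
      then have "norm x \<le> norm \<xi> + d"
        using norm_triangle_ineq2[of x \<xi>] by (simp add: dist_norm norm_minus_commute)
      then show "x \<in> \<bbbD>"
        using that r by (simp add: d_def field_simps)
    qed
    show "?k holomorphic_on ball \<xi> d"
      using zyg_holomorphic by (rule holomorphic_on_subset) (rule order_trans[OF ball_subset_cball sub])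
    show "continuous_on (cball \<xi> d) ?k"
      using holomorphic_on_imp_continuous_on[OF zyg_holomorphic] sub by (rule continuous_on_subset)
    fix x assume "norm (\<xi> - x) = d"
    then have "norm x \<le> norm \<xi> + d"
      using norm_triangle_ineq2[of x \<xi>] by (simp add: norm_minus_commute)
    then show "norm (?k x) \<le> e"
      using that by (intro k) (simp add: d_def field_simps)
  qed (use d in auto)
  have "norm (dilation r k) \<le> norm (Rep_zyg_vlog (dilation r k) 0) +
      norm (deriv (Rep_zyg_vlog (dilation r k)) 0) + 4 * e / d\<^sup>2"
  proof (rule zyg_norm_le)
    fix z :: complex
    assume z: "z \<in> \<bbbD>"
    have "norm (deriv (deriv ?k) (of_real r * z)) \<le> 2 * e / d\<^sup>2"
      using ch[OF dilation_disc(3)[OF r z], of 2] by (simp add: numeral_2_eq_2)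
    then have "r\<^sup>2 * norm (deriv (deriv ?k) (of_real r * z)) \<le> 1 * (2 * e / d\<^sup>2)"
      using r by (intro mult_mono) (auto simp: power_le_one)
    then have "v_log z * (r\<^sup>2 * norm (deriv (deriv ?k) (of_real r * z))) \<le> 2 * (1 * (2 * e / d\<^sup>2))"
      by (intro mult_mono[OF v_log_le_2[OF z]]) auto
    then show "v_log z * norm (deriv (deriv (Rep_zyg_vlog (dilation r k))) z) \<le> 4 * e / d\<^sup>2"
      unfolding Rep_dilation(3)[OF z] by (simp add: norm_mult norm_power)
  qed
  moreover have "norm (Rep_zyg_vlog (dilation r k) 0) \<le> e"
    using Rep_dilation(1)[of 0 k] k[of 0] r by simp
  moreover have "norm (deriv (Rep_zyg_vlog (dilation r k)) 0) \<le> e / d"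
  proof -
    have "norm (deriv ?k 0) \<le> e / d"
      using ch[of 0 1] r by simp
    then have "r * norm (deriv ?k 0) \<le> 1 * (e / d)"
      using r by (intro mult_mono) auto
    then show ?thesis
      using Rep_dilation(2)[of 0 k] r by (simp add: norm_mult)
  qed
  ultimately have "norm (dilation r k) \<le> e + e / d + 4 * e / d\<^sup>2"
    by linarith
  also have "\<dots> = e * (1 + 1 / d + 4 / d\<^sup>2)"
    by (simp add: algebra_simps)
  finally show ?thesis .
qed

end

lemma zyg_growth:
  assumes z: "z \<in> \<bbbD>"
  shows "norm (Rep_zyg_vlog f z) \<le> norm f * (1 + growth_const * loglog z)"
proof -
  let ?B = "growth_const * norm f * loglog z"
  have sub: "cball 0 (norm z) \<subseteq> \<bbbD>"
    using z by auto
  have "norm (Rep_zyg_vlog f z - Rep_zyg_vlog f 0) \<le> ?B * norm (z - 0)"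
  proof (rule field_differentiable_bound[of "cball 0 (norm z)" _ "deriv (Rep_zyg_vlog f)"])
    fix w :: complex
    assume w: "w \<in> cball 0 (norm z)"
    then have w': "w \<in> \<bbbD>"
      using sub by blast
    show "(Rep_zyg_vlog f has_field_derivative deriv (Rep_zyg_vlog f) w) (at w within cball 0 (norm z))"
      using holomorphic_derivI[OF zyg_holomorphic open_ball w'] by (rule has_field_derivative_at_within)
    have "norm (deriv (Rep_zyg_vlog f) w) \<le> growth_const * norm f * loglog w"
      by (rule zyg_deriv_growth[OF w'])
    also have "\<dots> \<le> ?B"
      using w z growth_const_ge_1 by (intro mult_left_mono loglog_mono) auto
    finally show "norm (deriv (Rep_zyg_vlog f) w) \<le> ?B" .
  qed auto
  also have "\<dots> \<le> ?B * 1"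
    using z growth_const_ge_1 loglog_pos[OF z] by (intro mult_left_mono) auto
  finally have "norm (Rep_zyg_vlog f z) \<le> norm (Rep_zyg_vlog f 0) + ?B"
    using norm_triangle_ineq2[of "Rep_zyg_vlog f z" "Rep_zyg_vlog f 0"] by simp
  then show ?thesis
    using zyg_0_le[of f] by (simp add: algebra_simps)
qed

text \<open>Montel's theorem applies because the norm controls the functions locally. The limit stays in the
unit ball: the norm is a supremum of expressions that depend on finitely many values of the function
and its derivatives, and these converge pointwise.\<close>

lemma zyg_unit_ball_normal:
  fixes f :: "nat \<Rightarrow> zyg_vlog"
  assumes f: "\<And>n. norm (f n) \<le> 1"
  obtains h s where "norm h \<le> 1" "strict_mono (s :: nat \<Rightarrow> nat)"
    "\<And>\<rho>. \<rho> < 1 \<Longrightarrow> uniform_limit (cball 0 \<rho>) (\<lambda>n. Rep_zyg_vlog (f (s n))) (Rep_zyg_vlog h) sequentially"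
proof -
  let ?H = "Rep_zyg_vlog ` cball 0 1"
  obtain g s where g: "g holomorphic_on \<bbbD>" and s: "strict_mono (s :: nat \<Rightarrow> nat)"
    and ul: "\<And>K. compact K \<Longrightarrow> K \<subseteq> \<bbbD> \<Longrightarrow>
      uniform_limit K ((\<lambda>n. Rep_zyg_vlog (f n)) \<circ> s) g sequentially"
  proof (rule Montel[of \<bbbD> ?H "\<lambda>n. Rep_zyg_vlog (f n)"])
    fix h assume "h \<in> ?H"
    then show "h holomorphic_on \<bbbD>"
      using zyg_holomorphic by auto
  next
    fix K :: "complex set"
    assume K: "compact K" "K \<subseteq> \<bbbD>"
    show "\<exists>B. \<forall>h\<in>?H. \<forall>z\<in>K. norm (h z) \<le> B"
    proof (cases "K = {}")
      case False
      obtain x where x: "x \<in> K" "\<forall>y\<in>K. norm y \<le> norm x"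
        using continuous_attains_sup[OF K(1) False, of norm] by (auto intro: continuous_intros)
      have xD: "x \<in> \<bbbD>" using x K by blast
      have "norm (Rep_zyg_vlog h z) \<le> 1 * (1 + growth_const * loglog x)"
        if h: "norm h \<le> 1" and z: "z \<in> K" for h z
      proof -
        have zD: "z \<in> \<bbbD>" using z K by blast
        have "norm (Rep_zyg_vlog h z) \<le> norm h * (1 + growth_const * loglog z)"
          by (rule zyg_growth[OF zD])
        also have "\<dots> \<le> 1 * (1 + growth_const * loglog x)"
          using h x z xD growth_const_ge_1 loglog_pos[OF zD]
          by (intro mult_mono add_mono loglog_mono) auto
        finally show ?thesis .
      qed
      then show ?thesis
        by (intro exI[of _ "1 * (1 + growth_const * loglog x)"]) auto
    qed auto
  qed (use f in auto)
  have der: "(\<lambda>n. (deriv ^^ m) (Rep_zyg_vlog (f (s n))) z) \<longlonglongrightarrow> (deriv ^^ m) g z"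
    if z: "z \<in> \<bbbD>" for m z
  proof -
    obtain \<rho> where \<rho>: "norm z < \<rho>" "\<rho> < 1"
      using z dense[of "norm z" 1] by auto
    have "uniform_limit (cball 0 \<rho>) (\<lambda>n. Rep_zyg_vlog (f (s n))) g sequentially"
      using ul[of "cball 0 \<rho>", unfolded o_def] \<rho> by (simp add: subset_iff)
    then have "uniform_limit (ball 0 \<rho>) (\<lambda>n. Rep_zyg_vlog (f (s n))) g sequentially"
      by (rule uniform_limit_on_subset) auto
    then show ?thesis
      by (rule higher_deriv_complex_uniform_limit)
        (use \<rho> in \<open>auto intro!: always_eventually holomorphic_on_subset[OF zyg_holomorphic]\<close>)
  qed
  have bound: "norm (g 0) + norm (deriv g 0) + v_log z * norm (deriv (deriv g) z) \<le> 1"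
    if z: "z \<in> \<bbbD>" for z
  proof (rule LIMSEQ_le_const2)
    show "(\<lambda>n. norm (Rep_zyg_vlog (f (s n)) 0) + norm (deriv (Rep_zyg_vlog (f (s n))) 0) +
        v_log z * norm (deriv (deriv (Rep_zyg_vlog (f (s n)))) z)) \<longlonglongrightarrow>
        norm (g 0) + norm (deriv g 0) + v_log z * norm (deriv (deriv g) z)"
      using der[of 0 0] der[of 0 1] der[OF z, of 2]
      by (intro tendsto_intros) (auto simp: numeral_2_eq_2)
    show "\<exists>N. \<forall>n\<ge>N. norm (Rep_zyg_vlog (f (s n)) 0) + norm (deriv (Rep_zyg_vlog (f (s n))) 0) +
        v_log z * norm (deriv (deriv (Rep_zyg_vlog (f (s n)))) z) \<le> 1"
      using order_trans[OF zyg_norm_sum_le[OF z] f] by auto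
  qed
  have mem: "extend_zero g \<in> zygmund v_log"
    using bound by (intro extend_zero_in_zygmund[OF g, of 1]) (smt (verit) norm_ge_zero)
  define h where "h = Abs_zyg_vlog (extend_zero g)"
  have h: "Rep_zyg_vlog h = extend_zero g"
    unfolding h_def by (rule Abs_zyg_vlog_inverse[OF mem])
  have "norm h \<le> norm (Rep_zyg_vlog h 0) + norm (deriv (Rep_zyg_vlog h) 0) +
      (1 - norm (g 0) - norm (deriv g 0))"
    using bound extend_zero_derivs by (intro zyg_norm_le) (auto simp: h algebra_simps)
  then have "norm h \<le> 1"
    using extend_zero_derivs(1)[of 0 g] by (simp add: h extend_zero_def)
  moreover have "uniform_limit (cball 0 \<rho>) (\<lambda>n. Rep_zyg_vlog (f (s n))) (Rep_zyg_vlog h) sequentially"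
    if "\<rho> < 1" for \<rho>
  proof -
    have "uniform_limit (cball 0 \<rho>) (\<lambda>n. Rep_zyg_vlog (f (s n))) g sequentially"
      using ul[of "cball 0 \<rho>", unfolded o_def] that by (simp add: subset_iff)
    moreover have "Rep_zyg_vlog h z = g z" if "z \<in> cball 0 \<rho>" for z
      using that \<open>\<rho> < 1\<close> by (simp add: h extend_zero_def)
    ultimately show ?thesis
      unfolding uniform_limit_iff by simp
  qed
  ultimately show ?thesis
    using that s by blast
qed

text \<open>Locally uniform convergence of a sequence implies convergence of its dilations in norm, so the image
of the unit ball is sequentially compact.\<close>

lemma compact_dilation_image:
  assumes r: "0 \<le> r" "r < 1"
  shows "compact (dilation r ` cball 0 1)"
  unfolding compact_eq_seq_compact_metric seq_compact_def
proof (intro allI impI)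
  fix y :: "nat \<Rightarrow> zyg_vlog"
  assume "\<forall>n. y n \<in> dilation r ` cball 0 1"
  then have "\<forall>n. \<exists>f. norm f \<le> 1 \<and> y n = dilation r f"
    unfolding image_iff mem_cball_0 Bex_def .
  then obtain f where f: "\<And>n. norm (f n) \<le> 1" "\<And>n. y n = dilation r (f n)"
    by metis
  obtain h and s :: "nat \<Rightarrow> nat" where h: "norm h \<le> 1" and s: "strict_mono s"
    and ul: "\<And>\<rho>. \<rho> < 1 \<Longrightarrow> uniform_limit (cball 0 \<rho>) (\<lambda>n. Rep_zyg_vlog (f (s n))) (Rep_zyg_vlog h) sequentially"
    by (rule zyg_unit_ball_normal[of f, OF f(1)]) (rule that)
  define d where "d = (1 - r) / 2"
  define C where "C = 1 + 1 / d + 4 / d\<^sup>2"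
  have C: "0 < C"
    using r by (auto simp: C_def d_def intro!: add_pos_nonneg)
  have "(\<lambda>n. y (s n)) \<longlonglongrightarrow> dilation r h"
  proof (rule metric_LIMSEQ_I)
    fix e :: real
    assume e: "0 < e"
    have "\<forall>\<^sub>F n in sequentially. \<forall>z\<in>cball 0 ((1 + r) / 2).
        dist (Rep_zyg_vlog (f (s n)) z) (Rep_zyg_vlog h z) < e / (2 * C)"
      by (rule uniform_limitD[OF ul]) (use e C r in auto)
    then obtain N where N: "\<forall>n\<ge>N. \<forall>z\<in>cball 0 ((1 + r) / 2).
        dist (Rep_zyg_vlog (f (s n)) z) (Rep_zyg_vlog h z) < e / (2 * C)"
      unfolding eventually_sequentially ..
    have "dist (y (s n)) (dilation r h) < e" if "n \<ge> N" for n
    proof -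
      have "norm (dilation r (f (s n) - h)) \<le> e / (2 * C) * C"
        unfolding C_def d_def
      proof (rule norm_dilation_le[OF r])
        fix z :: complex
        assume "norm z \<le> (1 + r) / 2"
        then show "norm (Rep_zyg_vlog (f (s n) - h) z) \<le> e / (2 * (1 + 1 / ((1 - r) / 2) + 4 / ((1 - r) / 2)\<^sup>2))"
          using N that by (simp add: Rep_zyg_linear dist_norm C_def d_def less_imp_le)
      qed
      then show ?thesis
        using e C by (simp add: dist_norm f(2) linearC_diff[OF dilation_linear[OF r], symmetric])
    qed
    then show "\<exists>N. \<forall>n\<ge>N. dist (y (s n)) (dilation r h) < e"
      by (intro exI[of _ N] allI impI)
  qed
  then show "\<exists>l\<in>dilation r ` cball 0 1. \<exists>s. strict_mono s \<and> (y \<circ> s) \<longlonglongrightarrow> l"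
    using h s by (intro bexI[of _ "dilation r h"] exI[of _ s]) (auto simp: o_def)
qed

lemma compact_operator_comp_dilation:
  assumes adm: "admissible \<phi>" and r: "0 \<le> r" "r < 1"
  shows "compact_operator (\<lambda>f. comp_op \<phi> (dilation r f))"
  unfolding compact_operator_def
proof
  have ext: "\<forall>f\<in>zygmund v_log. comp_ext \<phi> f \<in> zygmund v_log" and cont: "continuous_on UNIV (comp_op \<phi>)"
    using adm by (auto simp: admissible_def comp_op_continuous_def)
  show "Vector_Spaces.linear scaleC scaleC (\<lambda>f. comp_op \<phi> (dilation r f))"
    using Vector_Spaces.linear_compose[OF dilation_linear[OF r] comp_op_linear[OF ext]] by (simp add: o_def)
  have "compact (comp_op \<phi> ` dilation r ` cball 0 1)"
    by (rule compact_continuous_image[OF continuous_on_subset[OF cont subset_UNIV] compact_dilation_image[OF r]])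
  then have c: "compact ((\<lambda>f. comp_op \<phi> (dilation r f)) ` cball 0 1)"
    unfolding image_image .
  show "compact (closure ((\<lambda>f. comp_op \<phi> (dilation r f)) ` cball 0 1))"
    unfolding closure_closed[OF compact_imp_closed[OF c]] by (rule c)
qed

lemma holomorphic_dilation_diff:
  assumes F: "F holomorphic_on \<bbbD>" and R: "R < 1" and r: "0 \<le> r" "r < 1"
    and B: "\<And>z. norm z \<le> R \<Longrightarrow> norm (deriv F z) \<le> B" and z: "norm z \<le> R"
  shows "norm (F z - F (of_real r * z)) \<le> B * (1 - r)"
proof -
  have B0: "0 \<le> B"
    using B[OF z] order_trans[OF norm_ge_zero] by blast
  have "norm (F z - F (of_real r * z)) \<le> B * norm (z - of_real r * z)"
  proof (rule field_differentiable_bound[of "cball 0 R" _ "deriv F"])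
    fix w :: complex
    assume "w \<in> cball 0 R"
    then show "(F has_field_derivative deriv F w) (at w within cball 0 R)"
      using R by (intro has_field_derivative_at_within[OF holomorphic_derivI[OF F open_ball]]) auto
  next
    show "of_real r * z \<in> cball 0 R"
      using order_trans[OF dilation_disc(1)[OF r, of z] z] z R by simp
  qed (use B z in auto)
  also have "z - of_real r * z = of_real (1 - r) * z"
    by (simp add: algebra_simps)
  also have "B * norm (of_real (1 - r) * z) = B * (1 - r) * norm z"
    using r by (simp add: norm_mult del: of_real_diff)
  also have "\<dots> \<le> B * (1 - r) * 1"
    using B0 r z R by (intro mult_left_mono) auto
  finally show ?thesis by simp
qed

text \<open>On a disc of radius \<open>R < 1\<close> a function and its dilation differ by at most \<open>1 - r\<close> times a bound for
the next derivative, and the chain rule factors \<open>r\<close> and \<open>r\<^sup>2\<close> in the derivatives of the dilation cost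
another multiple of \<open>1 - r\<close>. This is uniform on the unit ball, in contrast to what happens near the
boundary.\<close>

lemma dilation_locally_close:
  assumes R: "0 \<le> R" "R < 1"
  shows "\<exists>C\<ge>0. \<forall>r f z. 0 \<le> r \<longrightarrow> r < 1 \<longrightarrow> norm z \<le> R \<longrightarrow>
    norm (Rep_zyg_vlog (f - dilation r f) z) \<le> C * (1 - r) * norm f \<and>
    norm (deriv (Rep_zyg_vlog (f - dilation r f)) z) \<le> C * (1 - r) * norm f \<and>
    norm (deriv (deriv (Rep_zyg_vlog (f - dilation r f))) z) \<le> C * (1 - r) * norm f"
proof -
  \<comment> \<open>\<open>A i\<close> bounds the derivative of order \<open>i\<close> of a unit vector on the disc of radius \<open>R\<close>;
     the third derivative is reached by Cauchy's estimate from the disc of radius \<open>\<rho>\<close>\<close>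
  define \<rho> where "\<rho> = (1 + R) / 2"
  define A1 A2 A3 where "A1 = growth_const * loglog (of_real R)"
    and "A2 = 2 / v_log (of_real R)" and "A3 = (2 / v_log (of_real \<rho>)) / ((1 - R) / 2)"
  have \<rho>: "0 \<le> \<rho>" "R < \<rho>" "\<rho> < 1"
    using R by (auto simp: \<rho>_def)
  have pos: "0 < v_log (of_real R)" "0 < v_log (of_real \<rho>)" "0 < loglog (of_real R)"
    using R \<rho> by (auto intro!: v_log_pos loglog_pos)
  have A: "0 \<le> A1" "0 \<le> A2" "0 \<le> A3"
    using pos growth_const_ge_1 R by (auto simp: A1_def A2_def A3_def)
  have b1: "norm (deriv (Rep_zyg_vlog f) z) \<le> A1 * norm f" if z: "norm z \<le> R" for f z
  proof -
    have zD: "z \<in> \<bbbD>" using z R by simp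
    have "norm (deriv (Rep_zyg_vlog f) z) \<le> growth_const * norm f * loglog z"
      by (rule zyg_deriv_growth[OF zD])
    also have "\<dots> \<le> growth_const * norm f * loglog (of_real R)"
      using z R growth_const_ge_1 by (intro mult_left_mono loglog_mono) auto
    finally show ?thesis by (simp add: A1_def mult_ac)
  qed
  have v2: "norm (deriv (deriv (Rep_zyg_vlog f)) z) \<le> 2 / v_log (of_real S) * norm f"
    if z: "norm z \<le> S" and S: "0 \<le> S" "S < 1" for f z S
  proof -
    have zD: "z \<in> \<bbbD>" "of_real S \<in> \<bbbD>" using z S by auto
    have "v_log (of_real S) * norm (deriv (deriv (Rep_zyg_vlog f)) z)
        \<le> (2 * v_log z) * norm (deriv (deriv (Rep_zyg_vlog f)) z)"
      using z S zD by (intro mult_right_mono v_log_quasi_mono) auto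
    also have "\<dots> \<le> 2 * norm f"
      using zyg_second_deriv_le[OF zD(1), of f] by simp
    finally show ?thesis
      using v_log_pos[OF zD(2)] by (simp add: field_simps)
  qed
  have b2: "norm (deriv (deriv (Rep_zyg_vlog f)) z) \<le> A2 * norm f" if "norm z \<le> R" for f z
    unfolding A2_def by (rule v2[OF that R])
  have b3: "norm (deriv (deriv (deriv (Rep_zyg_vlog f))) z) \<le> A3 * norm f" if z: "norm z \<le> R" for f z
  proof -
    let ?g = "deriv (deriv (Rep_zyg_vlog f))"
    let ?d = "(1 - R) / 2"
    have near: "norm x \<le> \<rho>" if "norm (z - x) \<le> ?d" for x
      using norm_triangle_ineq2[of x z] that z by (simp add: \<rho>_def norm_minus_commute field_simps)
    have sub: "cball z ?d \<subseteq> \<bbbD>"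
    proof
      fix x assume "x \<in> cball z ?d"
      then have "norm x \<le> \<rho>"
        by (intro near) (simp add: dist_norm)
      then show "x \<in> \<bbbD>"
        using \<rho> by simp
    qed
    have "norm ((deriv ^^ 1) ?g z) \<le> fact 1 * (2 / v_log (of_real \<rho>) * norm f) / ?d ^ 1"
    proof (rule Cauchy_inequality)
      show "?g holomorphic_on ball z ?d"
        by (rule holomorphic_on_subset[OF zyg_deriv_holomorphic(2) order_trans[OF ball_subset_cball sub]])
      show "continuous_on (cball z ?d) ?g"
        by (rule continuous_on_subset[OF holomorphic_on_imp_continuous_on[OF zyg_deriv_holomorphic(2)] sub])
      show "norm (?g x) \<le> 2 / v_log (of_real \<rho>) * norm f" if "norm (z - x) = ?d" for x
        using near[of x] that \<rho> by (intro v2) auto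
    qed (use R in auto)
    then show ?thesis
      by (simp add: A3_def)
  qed
  define C where "C = A1 + A2 + (A3 + 2 * A2) + A1"
  have est: "norm (Rep_zyg_vlog (f - dilation r f) z) \<le> C * (1 - r) * norm f \<and>
      norm (deriv (Rep_zyg_vlog (f - dilation r f)) z) \<le> C * (1 - r) * norm f \<and>
      norm (deriv (deriv (Rep_zyg_vlog (f - dilation r f))) z) \<le> C * (1 - r) * norm f"
    if r: "0 \<le> r" "r < 1" and z: "norm z \<le> R" for r f z
  proof -
    let ?f = "Rep_zyg_vlog f"
    let ?n = "(1 - r) * norm f"
    have zD: "z \<in> \<bbbD>" using z R by simp
    have rz: "norm (of_real r * z) \<le> R"
      using dilation_disc(1)[OF r zD] z by simp
    have n: "0 \<le> ?n" using r by simp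
    have le: "a * ?n \<le> C * ?n" if "a \<le> C" for a
      using that n by (rule mult_right_mono)
    have "norm (?f z - ?f (of_real r * z)) \<le> A1 * norm f * (1 - r)"
      using b1 by (intro holomorphic_dilation_diff[OF zyg_holomorphic R(2) r _ z])
    also have "\<dots> = A1 * ?n" by simp
    also have "\<dots> \<le> C * ?n" using A by (intro le) (simp add: C_def)
    finally have 0: "norm (Rep_zyg_vlog (f - dilation r f) z) \<le> C * ?n"
      by (simp add: Rep_zyg_linear Rep_dilation(1)[OF r zD])
    have "norm (deriv ?f z - of_real r * deriv ?f (of_real r * z)) =
        norm ((deriv ?f z - deriv ?f (of_real r * z)) + of_real (1 - r) * deriv ?f (of_real r * z))"
      by (simp add: algebra_simps)
    also have "\<dots> \<le> norm (deriv ?f z - deriv ?f (of_real r * z)) + (1 - r) * norm (deriv ?f (of_real r * z))"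
      using r by (intro order_trans[OF norm_triangle_ineq]) (simp add: norm_mult del: of_real_diff)
    also have "\<dots> \<le> A2 * norm f * (1 - r) + (1 - r) * (A1 * norm f)"
      using b2 r by (intro add_mono mult_left_mono b1 rz
          holomorphic_dilation_diff[OF zyg_deriv_holomorphic(1) R(2) r _ z]) auto
    also have "\<dots> = (A2 + A1) * ?n" by (simp add: algebra_simps)
    also have "\<dots> \<le> C * ?n" using A by (intro le) (simp add: C_def)
    finally have 1: "norm (deriv (Rep_zyg_vlog (f - dilation r f)) z) \<le> C * ?n"
      by (simp add: deriv_zyg_diff(1)[OF zD] Rep_dilation(2)[OF r zD])
    have "norm (deriv (deriv ?f) z - of_real (r\<^sup>2) * deriv (deriv ?f) (of_real r * z)) =
        norm ((deriv (deriv ?f) z - deriv (deriv ?f) (of_real r * z)) +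
          of_real (1 - r\<^sup>2) * deriv (deriv ?f) (of_real r * z))"
      by (simp add: algebra_simps)
    also have "\<dots> \<le> norm (deriv (deriv ?f) z - deriv (deriv ?f) (of_real r * z)) +
        (1 - r\<^sup>2) * norm (deriv (deriv ?f) (of_real r * z))"
      using r by (intro order_trans[OF norm_triangle_ineq])
        (simp add: norm_mult power_le_one del: of_real_diff of_real_power)
    also have "\<dots> \<le> A3 * norm f * (1 - r) + (2 * (1 - r)) * (A2 * norm f)"
    proof (intro add_mono mult_mono b2 rz)
      show "norm (deriv (deriv ?f) z - deriv (deriv ?f) (of_real r * z)) \<le> A3 * norm f * (1 - r)"
        using b3 by (intro holomorphic_dilation_diff[OF zyg_deriv_holomorphic(2) R(2) r _ z])
      have "1 - r\<^sup>2 = (1 + r) * (1 - r)"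
        by (simp add: power2_eq_square algebra_simps)
      also have "\<dots> \<le> 2 * (1 - r)"
        using r by (intro mult_right_mono) auto
      finally show "1 - r\<^sup>2 \<le> 2 * (1 - r)" .
    qed (use r in auto)
    also have "\<dots> = (A3 + 2 * A2) * ?n" by (simp add: algebra_simps)
    also have "\<dots> \<le> C * ?n" using A by (intro le) (simp add: C_def)
    finally have 2: "norm (deriv (deriv (Rep_zyg_vlog (f - dilation r f))) z) \<le> C * ?n"
      by (simp add: deriv_zyg_diff(2)[OF zD] Rep_dilation(3)[OF r zD] del: of_real_power)
    show ?thesis
      using 0 1 2 by (simp add: mult.assoc)
  qed
  have "0 \<le> C" using A by (simp add: C_def)
  then show ?thesis
    using est by (intro exI[of _ C]) simp
qed

text \<open>Near the boundary \<open>f - dilation r f\<close> is not small. It does, however, satisfy the same growth bounds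
as \<open>f\<close>, with constants that do not depend on \<open>r\<close>.\<close>

lemma dilation_diff_growth:
  assumes r: "0 \<le> r" "r < 1" and z: "z \<in> \<bbbD>"
  shows "norm (deriv (Rep_zyg_vlog (f - dilation r f)) z) \<le> 2 * growth_const * norm f * loglog z"
    and "v_log z * norm (deriv (deriv (Rep_zyg_vlog (f - dilation r f))) z) \<le> 3 * norm f"
proof -
  let ?f = "Rep_zyg_vlog f"
  let ?w = "of_real r * z"
  note w = dilation_disc(1,2)[OF r z]
  have "norm (deriv ?f z - of_real r * deriv ?f ?w) \<le> norm (deriv ?f z) + r * norm (deriv ?f ?w)"
    using r norm_triangle_ineq4[of "deriv ?f z" "of_real r * deriv ?f ?w"] by (simp add: norm_mult)
  also have "\<dots> \<le> growth_const * norm f * loglog z + 1 * (growth_const * norm f * loglog z)"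
  proof (intro add_mono mult_mono zyg_deriv_growth z)
    have "norm (deriv ?f ?w) \<le> growth_const * norm f * loglog ?w"
      by (rule zyg_deriv_growth[OF w(2)])
    also have "\<dots> \<le> growth_const * norm f * loglog z"
      using w z growth_const_ge_1 by (intro mult_left_mono loglog_mono) auto
    finally show "norm (deriv ?f ?w) \<le> growth_const * norm f * loglog z" .
  qed (use r in auto)
  finally show "norm (deriv (Rep_zyg_vlog (f - dilation r f)) z) \<le> 2 * growth_const * norm f * loglog z"
    by (simp add: deriv_zyg_diff(1)[OF z] Rep_dilation(2)[OF r z] mult_ac)
  have "v_log z * norm (deriv (deriv ?f) ?w) \<le> (2 * v_log ?w) * norm (deriv (deriv ?f) ?w)"
    by (intro mult_right_mono v_log_quasi_mono w z) auto
  also have "\<dots> \<le> 2 * norm f"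
    using zyg_second_deriv_le[OF w(2), of f] by simp
  finally have b: "v_log z * norm (deriv (deriv ?f) ?w) \<le> 2 * norm f" .
  have "norm (deriv (deriv ?f) z - of_real (r\<^sup>2) * deriv (deriv ?f) ?w) \<le>
      norm (deriv (deriv ?f) z) + r\<^sup>2 * norm (deriv (deriv ?f) ?w)"
    using norm_triangle_ineq4[of "deriv (deriv ?f) z" "of_real (r\<^sup>2) * deriv (deriv ?f) ?w"]
    by (simp add: norm_mult norm_power)
  also have "\<dots> \<le> norm (deriv (deriv ?f) z) + 1 * norm (deriv (deriv ?f) ?w)"
    using r by (intro add_left_mono mult_right_mono) (auto simp: power_le_one)
  finally have "v_log z * norm (deriv (deriv ?f) z - of_real (r\<^sup>2) * deriv (deriv ?f) ?w) \<le>
      v_log z * (norm (deriv (deriv ?f) z) + 1 * norm (deriv (deriv ?f) ?w))"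
    using v_log_pos[OF z] by (intro mult_left_mono) auto
  also have "\<dots> \<le> 3 * norm f"
    using b zyg_second_deriv_le[OF z, of f] by (simp add: algebra_simps)
  finally show "v_log z * norm (deriv (deriv (Rep_zyg_vlog (f - dilation r f))) z) \<le> 3 * norm f"
    unfolding deriv_zyg_diff(2)[OF z] Rep_dilation(3)[OF r z] .
qed

section \<open>The upper estimate\<close>

lemma bdd_below_onorm_compact:
  assumes "bounded_linear T"
  shows "bdd_below ((\<lambda>K. onorm (\<lambda>x. T x - K x)) ` {K. compact_operator K})"
  using assms
  by (intro bdd_belowI2[where m = 0] onorm_pos_le bounded_linear_sub) (auto intro: compact_operator_bounded_linear)

text \<open>The operators \<open>f \<mapsto> (dilation r f) \<circ> \<phi>\<close> are compact, and their distance to \<open>comp_op \<phi>\<close> is estimated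
through \<open>h = f - dilation r f\<close>. Where \<open>norm (\<phi> z) \<le> R\<close>, the functions \<open>h'\<close> and \<open>h''\<close> are of order
\<open>1 - r\<close> and \<open>v_log * \<phi>'\<^sup>2\<close>, \<open>v_log * \<phi>''\<close> are bounded, so that this part disappears as \<open>r\<close> tends
to 1. Where \<open>norm (\<phi> z) > R\<close>, the growth bounds on \<open>h\<close> meet the hypotheses on \<open>\<phi>\<close>.\<close>

lemma ess_norm_upper:
  assumes adm: "admissible \<phi>" and c: "0 \<le> c" and r0: "r0 < 1"
    and q2: "\<And>z. z \<in> \<bbbD> \<Longrightarrow> r0 < norm (\<phi> z) \<Longrightarrow> v_log z * (norm (deriv \<phi> z))\<^sup>2 \<le> c * v_log (\<phi> z)"
    and q1: "\<And>z. z \<in> \<bbbD> \<Longrightarrow> r0 < norm (\<phi> z) \<Longrightarrow> v_log z * norm (deriv (deriv \<phi>) z) \<le> c * w_log (\<phi> z)"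
  shows "ess_norm (comp_op \<phi>) \<le> (3 + 2 * growth_const) * c"
proof (rule field_le_epsilon)
  fix e :: real
  assume e: "0 < e"
  have ext: "\<forall>f\<in>zygmund v_log. comp_ext \<phi> f \<in> zygmund v_log"
    using adm by (auto simp: admissible_def comp_op_continuous_def)
  have \<phi>z: "\<phi> z \<in> \<bbbD>" if "z \<in> \<bbbD>" for z
    using adm that unfolding admissible_def by blast
  obtain N1 where N1: "\<forall>z\<in>\<bbbD>. 0 \<le> v_log z * norm (deriv (deriv \<phi>) z) \<and> v_log z * norm (deriv (deriv \<phi>) z) \<le> N1"
    using admissible_bounded_weights(1)[OF adm] unfolding bounded_weight_def ..
  obtain N2 where N2: "\<forall>z\<in>\<bbbD>. 0 \<le> v_log z * (norm (deriv \<phi> z))\<^sup>2 \<and> v_log z * (norm (deriv \<phi> z))\<^sup>2 \<le> N2"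
    using admissible_bounded_weights(2)[OF adm] unfolding bounded_weight_def ..
  have N0: "0 \<le> N1" "0 \<le> N2"
    using bspec[OF N1, of 0] bspec[OF N2, of 0] by (auto elim: order_trans)
  define R where "R = max (max r0 0) (norm (\<phi> 0))"
  have R: "0 \<le> R" "R < 1" "r0 \<le> R" "norm (\<phi> 0) \<le> R"
    using r0 \<phi>z[of 0] by (auto simp: R_def)
  obtain C where C: "0 \<le> C" "\<forall>r f z. 0 \<le> r \<longrightarrow> r < 1 \<longrightarrow> norm z \<le> R \<longrightarrow>
      norm (Rep_zyg_vlog (f - dilation r f) z) \<le> C * (1 - r) * norm f \<and>
      norm (deriv (Rep_zyg_vlog (f - dilation r f)) z) \<le> C * (1 - r) * norm f \<and>
      norm (deriv (deriv (Rep_zyg_vlog (f - dilation r f))) z) \<le> C * (1 - r) * norm f"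
    using dilation_locally_close[OF R(1,2)] by (elim exE conjE) (rule that)
  define D where "D = C * (1 + norm (deriv \<phi> 0) + N1 + N2)"
  have D: "0 \<le> D"
    using C N0 by (simp add: D_def)
  define r where "r = max 0 (1 - e / (D + 1))"
  have r: "0 \<le> r" "r < 1"
    using e D by (auto simp: r_def)
  have Dr: "D * (1 - r) \<le> e"
  proof -
    have "D * (1 - r) \<le> (D + 1) * (e / (D + 1))"
      using D e by (intro mult_mono) (auto simp: r_def)
    then show ?thesis using D by simp
  qed
  let ?b = "(3 + 2 * growth_const) * c"
  have main: "norm (comp_op \<phi> f - comp_op \<phi> (dilation r f)) \<le> (?b + e) * norm f" for f
  proof -
    define h where "h = f - dilation r f"
    let ?h = "Rep_zyg_vlog h"
    let ?n = "(1 - r) * norm f"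
    have n: "0 \<le> ?n" using r by simp
    have loc: "norm (?h w) \<le> C * ?n" "norm (deriv ?h w) \<le> C * ?n" "norm (deriv (deriv ?h) w) \<le> C * ?n"
      if "norm w \<le> R" for w
      using C(2) r that unfolding h_def by (simp_all add: mult.assoc)
    have Cn: "0 \<le> C * ?n" using C n by simp
    have "norm (comp_op \<phi> h) \<le> norm (Rep_zyg_vlog (comp_op \<phi> h) 0) +
        norm (deriv (Rep_zyg_vlog (comp_op \<phi> h)) 0) + (?b * norm f + (N1 + N2) * (C * ?n))"
    proof (rule zyg_norm_le)
      fix z :: complex
      assume z: "z \<in> \<bbbD>"
      let ?p = "v_log z * (norm (deriv \<phi> z))\<^sup>2" and ?q = "v_log z * norm (deriv (deriv \<phi>) z)"
      have pq: "0 \<le> ?p" "?p \<le> N2" "0 \<le> ?q" "?q \<le> N1"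
        using N1 N2 z by auto
      have "v_log z * norm (deriv (deriv (Rep_zyg_vlog (comp_op \<phi> h))) z) \<le>
          v_log z * (norm (deriv (deriv ?h) (\<phi> z) * (deriv \<phi> z)\<^sup>2) + norm (deriv ?h (\<phi> z) * deriv (deriv \<phi>) z))"
        unfolding admissible_derivs(2)[OF adm z]
        using v_log_pos[OF z] by (intro mult_left_mono norm_triangle_ineq) auto
      also have "\<dots> = ?p * norm (deriv (deriv ?h) (\<phi> z)) + ?q * norm (deriv ?h (\<phi> z))"
        by (simp add: norm_mult norm_power algebra_simps)
      also have "\<dots> \<le> ?b * norm f + (N1 + N2) * (C * ?n)"
      proof (cases "norm (\<phi> z) \<le> R")
        case True
        have "?p * norm (deriv (deriv ?h) (\<phi> z)) + ?q * norm (deriv ?h (\<phi> z)) \<le> N2 * (C * ?n) + N1 * (C * ?n)"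
          using pq N0 loc[OF True] by (intro add_mono mult_mono) auto
        moreover have "0 \<le> ?b * norm f"
          using c growth_const_ge_1 by simp
        ultimately show ?thesis by (simp add: algebra_simps)
      next
        case False
        then have big: "r0 < norm (\<phi> z)" using R by simp
        have "?p * norm (deriv (deriv ?h) (\<phi> z)) \<le> c * v_log (\<phi> z) * norm (deriv (deriv ?h) (\<phi> z))"
          by (intro mult_right_mono q2 z big) auto
        also have "\<dots> \<le> c * (3 * norm f)"
          using dilation_diff_growth(2)[OF r \<phi>z[OF z], of f] c unfolding h_def mult.assoc
          by (intro mult_left_mono) auto
        finally have 1: "?p * norm (deriv (deriv ?h) (\<phi> z)) \<le> c * (3 * norm f)" .
        have "?q * norm (deriv ?h (\<phi> z)) \<le> c * w_log (\<phi> z) * (2 * growth_const * norm f * loglog (\<phi> z))"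
          using c w_log_pos[OF \<phi>z[OF z]] pq
          by (intro mult_mono q1 z big dilation_diff_growth(1)[OF r \<phi>z[OF z], of f, folded h_def]) auto
        also have "\<dots> = c * (2 * growth_const * norm f)"
          using loglog_pos[OF \<phi>z[OF z]] by (simp add: w_log_eq)
        finally have 2: "?q * norm (deriv ?h (\<phi> z)) \<le> c * (2 * growth_const * norm f)" .
        have "0 \<le> (N1 + N2) * (C * ?n)"
          by (rule mult_nonneg_nonneg[OF add_nonneg_nonneg[OF N0] Cn])
        then show ?thesis
          using 1 2 by (simp add: algebra_simps)
      qed
      finally show "v_log z * norm (deriv (deriv (Rep_zyg_vlog (comp_op \<phi> h))) z) \<le>
          ?b * norm f + (N1 + N2) * (C * ?n)" .
    qed
    moreover have "norm (Rep_zyg_vlog (comp_op \<phi> h) 0) \<le> C * ?n"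
      using loc(1)[OF R(4)] by (simp add: Rep_comp_op[OF ext] comp_ext_def)
    moreover have "norm (deriv (Rep_zyg_vlog (comp_op \<phi> h)) 0) \<le> C * ?n * norm (deriv \<phi> 0)"
      using admissible_derivs(1)[OF adm, of 0 h] loc(2)[OF R(4)] by (simp add: norm_mult mult_right_mono)
    ultimately have "norm (comp_op \<phi> h) \<le> ?b * norm f + D * (1 - r) * norm f"
      by (simp add: D_def algebra_simps)
    also have "\<dots> \<le> ?b * norm f + e * norm f"
      using Dr by (intro add_left_mono mult_right_mono) auto
    finally show ?thesis
      unfolding h_def linearC_diff[OF comp_op_linear[OF ext]] by (simp add: algebra_simps)
  qed
  have "ess_norm (comp_op \<phi>) \<le> onorm (\<lambda>f. comp_op \<phi> f - comp_op \<phi> (dilation r f))"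
    unfolding ess_norm_def
    using compact_operator_comp_dilation[OF adm r] adm
    by (intro cINF_lower bdd_below_onorm_compact comp_op_bounded_linear) (auto simp: admissible_def)
  also have "\<dots> \<le> ?b + e"
    using main c e growth_const_ge_1 by (intro onorm_bound) auto
  finally show "ess_norm (comp_op \<phi>) \<le> ?b + e" .
qed

section \<open>The lower estimate\<close>

lemma bounded_linear_compact_perturbation:
  assumes "admissible \<phi>" "compact_operator K"
  shows "bounded_linear (\<lambda>f. comp_op \<phi> f - K f)"
proof -
  have "comp_op_continuous \<phi>"
    using assms(1) by (simp add: admissible_def)
  then show ?thesis
    by (rule bounded_linear_sub[OF comp_op_bounded_linear compact_operator_bounded_linear[OF assms(2)]])
qed

lemma w_log_tendsto_0:
  assumes "\<And>k. a k \<in> \<bbbD>" "(\<lambda>k. norm (a k)) \<longlonglongrightarrow> 1"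
  shows "(\<lambda>k. w_log (a k)) \<longlonglongrightarrow> 0"
proof -
  have "(\<lambda>k. (1 - (norm (a k))\<^sup>2) / 4) \<longlonglongrightarrow> (1 - 1\<^sup>2) / 4"
    by (intro tendsto_intros assms) auto
  then have "filterlim (\<lambda>k. inverse ((1 - (norm (a k))\<^sup>2) / 4)) at_top sequentially"
    using norm_disc_sq[OF assms(1)] by (intro filterlim_inverse_at_top) auto
  then have "filterlim (\<lambda>k. ln (ln (inverse ((1 - (norm (a k))\<^sup>2) / 4)))) at_top sequentially"
    by (intro filterlim_compose[OF ln_at_top])
  then have "(\<lambda>k. inverse (ln (ln (inverse ((1 - (norm (a k))\<^sup>2) / 4))))) \<longlonglongrightarrow> 0"
    by (rule tendsto_inverse_0_at_top)
  then show ?thesis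
    by (simp add: w_log_def)
qed

text \<open>Suppose points \<open>Z k\<close> violate the bound and \<open>\<phi> (Z k)\<close> approaches the boundary, and let \<open>f k\<close> be
the corresponding test functions. A compact \<open>K\<close> makes the sequence \<open>K (f k)\<close> Cauchy along a
subsequence, hence \<open>K\<close> is almost zero on the differences \<open>f k - f n\<close> with large indices. Evaluated
at the fixed point \<open>Z k\<close>, such a difference looks like \<open>f k\<close> alone as \<open>n\<close> grows, because the test
functions tend to 0 pointwise. Working with differences replaces an argument by weak convergence,
which would need the dual space.\<close>

lemma compact_perturbation_lower:
  fixes F :: "complex \<Rightarrow> zyg_vlog" and \<Theta> :: "complex \<Rightarrow> real"
  assumes adm: "admissible \<phi>" and K: "compact_operator K" and C: "0 < C" and e: "0 < e"
    and F: "\<And>a. a \<in> \<bbbD> \<Longrightarrow> norm (F a) \<le> C"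
    and F1: "\<And>a z. a \<in> \<bbbD> \<Longrightarrow> z \<in> \<bbbD> \<Longrightarrow> norm (deriv (Rep_zyg_vlog (F a)) z) \<le> \<Theta> z * w_log a"
    and F2: "\<And>a z. a \<in> \<bbbD> \<Longrightarrow> z \<in> \<bbbD> \<Longrightarrow> norm (deriv (deriv (Rep_zyg_vlog (F a))) z) \<le> \<Theta> z * w_log a"
  defines "t \<equiv> onorm (\<lambda>f. comp_op \<phi> f - K f)"
  shows "\<exists>r<1. \<forall>z\<in>\<bbbD>. r < norm (\<phi> z) \<longrightarrow>
    v_log z * norm (deriv (deriv (Rep_zyg_vlog (F (\<phi> z)))) (\<phi> z) * (deriv \<phi> z)\<^sup>2 +
      deriv (Rep_zyg_vlog (F (\<phi> z))) (\<phi> z) * deriv (deriv \<phi>) z) \<le> 2 * C * t + e"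
proof (rule ccontr)
  define Q where "Q = (\<lambda>f z. v_log z * norm (deriv (deriv (Rep_zyg_vlog f)) (\<phi> z) * (deriv \<phi> z)\<^sup>2 +
      deriv (Rep_zyg_vlog f) (\<phi> z) * deriv (deriv \<phi>) z))"
  assume "\<not> ?thesis"
  then have "\<not> (\<exists>r<1. \<forall>z\<in>\<bbbD>. r < norm (\<phi> z) \<longrightarrow> Q (F (\<phi> z)) z \<le> 2 * C * t + e)"
    unfolding Q_def .
  then have neg: "\<forall>r<1. \<exists>z\<in>\<bbbD>. r < norm (\<phi> z) \<and> 2 * C * t + e < Q (F (\<phi> z)) z"
    by (simp add: not_le)
  have "\<exists>z. z \<in> \<bbbD> \<and> 1 - inverse (real (Suc k)) < norm (\<phi> z) \<and> 2 * C * t + e < Q (F (\<phi> z)) z" for k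
    using neg[rule_format, of "1 - inverse (real (Suc k))"] by (auto simp: Bex_def)
  then have "\<forall>k. \<exists>z. z \<in> \<bbbD> \<and> 1 - inverse (real (Suc k)) < norm (\<phi> z) \<and> 2 * C * t + e < Q (F (\<phi> z)) z" ..
  from choice[OF this] obtain Z where "\<forall>k. Z k \<in> \<bbbD> \<and> 1 - inverse (real (Suc k)) < norm (\<phi> (Z k)) \<and>
      2 * C * t + e < Q (F (\<phi> (Z k))) (Z k)" ..
  then have Z: "\<And>k. Z k \<in> \<bbbD>" "\<And>k. 1 - inverse (real (Suc k)) < norm (\<phi> (Z k))"
    "\<And>k. 2 * C * t + e < Q (F (\<phi> (Z k))) (Z k)"
    by simp_all
  have \<phi>z: "\<phi> z \<in> \<bbbD>" if "z \<in> \<bbbD>" for z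
    using adm that unfolding admissible_def by blast
  have ext: "\<forall>f\<in>zygmund v_log. comp_ext \<phi> f \<in> zygmund v_log"
    using adm by (auto simp: admissible_def comp_op_continuous_def)
  define a where "a = (\<lambda>k. \<phi> (Z k))"
  define f where "f = (\<lambda>k. F (a k))"
  have a: "a k \<in> \<bbbD>" for k
    using \<phi>z Z(1) by (simp add: a_def)
  have "(\<lambda>k. 1 - inverse (real (Suc k))) \<longlonglongrightarrow> 1 - 0"
    by (intro tendsto_intros LIMSEQ_inverse_real_of_nat)
  then have lo: "(\<lambda>k. 1 - inverse (real (Suc k))) \<longlonglongrightarrow> 1"
    by simp
  have "(\<lambda>k. norm (a k)) \<longlonglongrightarrow> 1"
  proof (rule tendsto_sandwich[OF _ _ lo tendsto_const])
    have "1 - inverse (real (Suc k)) \<le> norm (a k)" for k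
      using Z(2)[of k] by (simp add: a_def)
    then show "\<forall>\<^sub>F k in sequentially. 1 - inverse (real (Suc k)) \<le> norm (a k)"
      by (intro always_eventually allI)
    have "norm (a k) \<le> 1" for k
      using a[of k] by simp
    then show "\<forall>\<^sub>F k in sequentially. norm (a k) \<le> 1"
      by (intro always_eventually allI)
  qed
  then have wa: "(\<lambda>k. w_log (a k)) \<longlonglongrightarrow> 0"
    by (intro w_log_tendsto_0 a)
  interpret K: bounded_linear K
    by (rule compact_operator_bounded_linear[OF K])
  have Tb: "bounded_linear (\<lambda>f. comp_op \<phi> f - K f)"
    by (rule bounded_linear_compact_perturbation[OF adm K])
  \<comment> \<open>along a subsequence the images under the compact operator form a Cauchy sequence\<close>
  have fC: "norm (f k) \<le> C" for k
    unfolding f_def by (rule F[OF a])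
  have mem: "\<forall>k. K ((1 / C) *\<^sub>R f k) \<in> closure (K ` cball 0 1)"
    using fC C by (intro allI subsetD[OF closure_subset] imageI) simp
  have sc: "seq_compact (closure (K ` cball 0 1))"
    using K by (simp add: compact_operator_def compact_imp_seq_compact)
  obtain l s where s: "strict_mono (s :: nat \<Rightarrow> nat)"
    and lim: "((\<lambda>k. K ((1 / C) *\<^sub>R f k)) \<circ> s) \<longlonglongrightarrow> l"
    by (rule seq_compactE[OF sc mem])
  have "0 < e / (2 * C)"
    using e C by simp
  from metric_CauchyD[OF LIMSEQ_imp_Cauchy[OF lim] this]
  obtain N where N: "\<forall>m\<ge>N. \<forall>n\<ge>N. dist (((\<lambda>k. K ((1 / C) *\<^sub>R f k)) \<circ> s) m)
      (((\<lambda>k. K ((1 / C) *\<^sub>R f k)) \<circ> s) n) < e / (2 * C)"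
    ..
  have KN: "norm (K (f (s N) - f (s n))) \<le> e / 2" if "n \<ge> N" for n
  proof -
    have "norm (K (f (s N) - f (s n))) = C * norm (K ((1 / C) *\<^sub>R f (s N)) - K ((1 / C) *\<^sub>R f (s n)))"
      using C by (simp add: K.diff K.scaleR scaleR_diff_right[symmetric])
    also have "\<dots> \<le> C * (e / (2 * C))"
      using N[rule_format, OF order_refl that] C by (intro mult_left_mono) (auto simp: dist_norm)
    finally show ?thesis using C by simp
  qed
  define z where "z = Z (s N)"
  define w where "w = \<phi> z"
  have z: "z \<in> \<bbbD>" "w \<in> \<bbbD>"
    using Z(1) \<phi>z by (auto simp: z_def w_def)
  have small: "(\<lambda>n. \<Theta> w * w_log (a (s n))) \<longlonglongrightarrow> 0"
    using tendsto_mult[OF tendsto_const LIMSEQ_subseq_LIMSEQ[OF wa s], of "\<Theta> w"] by (simp add: o_def)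
  have l1: "(\<lambda>n. deriv (Rep_zyg_vlog (f (s n))) w) \<longlonglongrightarrow> 0"
    by (rule Lim_null_comparison[OF _ small]) (use F1[OF a z(2)] in \<open>simp add: f_def\<close>)
  have l2: "(\<lambda>n. deriv (deriv (Rep_zyg_vlog (f (s n)))) w) \<longlonglongrightarrow> 0"
    by (rule Lim_null_comparison[OF _ small]) (use F2[OF a z(2)] in \<open>simp add: f_def\<close>)
  have "Q (f (s N)) z \<le> 2 * C * t + e / 2"
  proof (rule LIMSEQ_le_const2)
    have "(\<lambda>n. v_log z * norm ((deriv (deriv (Rep_zyg_vlog (f (s N)))) w - deriv (deriv (Rep_zyg_vlog (f (s n)))) w) * (deriv \<phi> z)\<^sup>2 +
        (deriv (Rep_zyg_vlog (f (s N))) w - deriv (Rep_zyg_vlog (f (s n))) w) * deriv (deriv \<phi>) z))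
      \<longlonglongrightarrow> v_log z * norm ((deriv (deriv (Rep_zyg_vlog (f (s N)))) w - 0) * (deriv \<phi> z)\<^sup>2 +
        (deriv (Rep_zyg_vlog (f (s N))) w - 0) * deriv (deriv \<phi>) z)"
      by (intro tendsto_intros l1 l2)
    then show "(\<lambda>n. Q (f (s N) - f (s n)) z) \<longlonglongrightarrow> Q (f (s N)) z"
      by (simp add: Q_def w_def[symmetric] deriv_zyg_diff[OF z(2)])
    have "Q (f (s N) - f (s n)) z \<le> 2 * C * t + e / 2" if n: "n \<ge> N" for n
    proof -
      let ?g = "f (s N) - f (s n)"
      have "Q ?g z = v_log z * norm (deriv (deriv (Rep_zyg_vlog (comp_op \<phi> ?g))) z)"
        unfolding Q_def admissible_derivs(2)[OF adm z(1)] ..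
      also have "\<dots> \<le> norm (comp_op \<phi> ?g)"
        by (rule zyg_second_deriv_le[OF z(1)])
      also have "\<dots> \<le> norm (comp_op \<phi> ?g - K ?g) + norm (K ?g)"
        using norm_triangle_ineq[of "comp_op \<phi> ?g - K ?g" "K ?g"] by simp
      also have "\<dots> \<le> t * (2 * C) + e / 2"
      proof (rule add_mono[OF _ KN[OF n]])
        have "norm (comp_op \<phi> ?g - K ?g) \<le> t * norm ?g"
          unfolding t_def by (rule onorm[OF Tb])
        also have "\<dots> \<le> t * (2 * C)"
          using norm_triangle_ineq4[of "f (s N)" "f (s n)"] fC[of "s N"] fC[of "s n"] onorm_pos_le[OF Tb]
          by (intro mult_left_mono) (auto simp: t_def)
        finally show "norm (comp_op \<phi> ?g - K ?g) \<le> t * (2 * C)" .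
      qed
      finally show ?thesis by (simp add: mult_ac)
    qed
    then show "\<exists>M. \<forall>n\<ge>M. Q (f (s N) - f (s n)) z \<le> 2 * C * t + e / 2"
      by (intro exI[of _ N] allI impI)
  qed
  moreover have "2 * C * t + e < Q (f (s N)) z"
    using Z(3)[of "s N"] by (simp add: f_def a_def z_def)
  ultimately show False
    using e by simp
qed

lemma kernel_bounds:
  fixes a z :: complex
  assumes "a \<in> \<bbbD>" "z \<in> \<bbbD>"
  shows "1 - norm a \<le> norm (1 - cnj a * z)" "1 - norm z \<le> norm (1 - cnj a * z)"
    "norm (1 - cnj a * z) < 2" "0 < Re (1 - cnj a * z)" "1 - cnj a * z \<noteq> 0"
proof -
  have a1: "norm a * norm z \<le> norm a" "norm a * norm z \<le> norm z"
    using assms by (auto intro: mult_left_le mult_left_le_one_le)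
  have *: "1 - norm a * norm z \<le> norm (1 - cnj a * z)"
    using norm_triangle_ineq2[of 1 "cnj a * z"] by (simp add: norm_mult)
  show "1 - norm a \<le> norm (1 - cnj a * z)" "1 - norm z \<le> norm (1 - cnj a * z)"
    using * a1 by linarith+
  have l: "norm (cnj a * z) < 1"
    using a1 assms by (simp add: norm_mult)
  then show "norm (1 - cnj a * z) < 2"
    using norm_triangle_ineq4[of 1 "cnj a * z"] by simp
  show re: "0 < Re (1 - cnj a * z)"
    using l complex_Re_le_cmod[of "cnj a * z"] by simp
  show "1 - cnj a * z \<noteq> 0"
    using re by force
qed

lemma kernel_diag: "1 - cnj a * a = of_real (1 - (norm a)\<^sup>2)"
  unfolding of_real_diff complex_norm_square by (simp add: mult.commute)

lemma kernel_deriv: "((\<lambda>z. 1 - cnj a * z) has_field_derivative - cnj a) (at z)"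
  using DERIV_diff[OF DERIV_const[of 1] DERIV_cmult[OF DERIV_ident, of "cnj a"]] by simp

text \<open>The derivative of \<open>f\<close> is the disc automorphism that vanishes at \<open>a\<close>, divided by
\<open>ln (2 / (1 - norm a))\<close>. Therefore the term with \<open>\<phi>''\<close> disappears from \<open>(f \<circ> \<phi>)''\<close> at points with
\<open>\<phi> z = a\<close>, and the second derivative there has the largest order \<open>1 / v_log a\<close> possible for a bounded
norm.\<close>

lemma second_order_test_function:
  assumes a: "a \<in> \<bbbD>"
  shows "\<exists>f. norm f \<le> 6 \<and> deriv (Rep_zyg_vlog f) a = 0 \<and>
    1 \<le> 2 * v_log a * norm (deriv (deriv (Rep_zyg_vlog f)) a) \<and>
    (\<forall>z\<in>\<bbbD>. norm (deriv (Rep_zyg_vlog f) z) \<le> 4 / (1 - norm z)\<^sup>2 * w_log a \<and>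
      norm (deriv (deriv (Rep_zyg_vlog f)) z) \<le> 4 / (1 - norm z)\<^sup>2 * w_log a)"
proof -
  define \<delta> where "\<delta> = 1 - norm a"
  define c where "c = 1 / ln (2 / \<delta>)"
  define u where "u = (\<lambda>z. 1 - cnj a * z)"
  define g where "g = (\<lambda>z. of_real c * ((z - a) / u z))"
  define b where "b = 1 - (norm a)\<^sup>2"
  have ker: "1 - norm a \<le> norm (u z)" "1 - norm z \<le> norm (u z)" "norm (u z) < 2" "0 < Re (u z)" "u z \<noteq> 0"
    if "z \<in> \<bbbD>" for z
    unfolding u_def by (rule kernel_bounds[OF a that])+
  have \<delta>: "0 < \<delta>" "\<delta> \<le> 1"
    using a by (auto simp: \<delta>_def)
  have ln: "ln 2 \<le> ln (2 / \<delta>)"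
    using \<delta> by (intro ln_mono) (auto simp: field_simps)
  have lnp: "0 < ln (2 / \<delta>)"
    using ln half_le_ln2 by linarith
  have c: "0 < c" "c \<le> 2"
    using ln half_le_ln2 lnp by (auto simp: c_def field_simps)
  have b: "\<delta> \<le> b" "b \<le> 2 * \<delta>" "b \<le> 1"
  proof -
    have "b = \<delta> * (1 + norm a)"
      by (simp add: b_def \<delta>_def power2_eq_square algebra_simps)
    moreover have "\<delta> * 1 \<le> \<delta> * (1 + norm a)" "\<delta> * (1 + norm a) \<le> \<delta> * 2"
      using \<delta> a by (auto intro!: mult_left_mono)
    ultimately show "\<delta> \<le> b" "b \<le> 2 * \<delta>" by auto
  qed (simp add: b_def)
  have c2w: "c \<le> 2 * w_log a"
  proof -
    have "loglog a \<le> ln (4 / b) - 1"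
      unfolding loglog_def b_def using ln_four_over_gt_1[OF a] by (intro ln_le_minus_one) linarith
    also have "\<dots> \<le> ln (4 / \<delta>)"
    proof -
      have "ln \<delta> \<le> ln b"
        using b \<delta> by (intro ln_mono) auto
      then show ?thesis
        using b \<delta> by (simp add: ln_div del: ln_le_cancel_iff)
    qed
    also have "\<dots> = ln 2 + ln (2 / \<delta>)"
      using \<delta> ln_mult[of 2 "2 / \<delta>"] by simp
    also have "\<dots> \<le> 2 * ln (2 / \<delta>)"
      using ln by simp
    finally show ?thesis
      using loglog_pos[OF a] lnp by (simp add: c_def w_log_eq field_simps)
  qed
  have dg: "(g has_field_derivative of_real (c * b) / (u z)\<^sup>2) (at z)" if z: "z \<in> \<bbbD>" for z
  proof -
    have "u z \<noteq> 0" by (rule ker(5)[OF z])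
    have "((\<lambda>z. (z - a) / u z) has_field_derivative ((1 - 0) * u z - (z - a) * - cnj a) / (u z * u z)) (at z)"
      unfolding u_def
      by (rule DERIV_divide[OF DERIV_diff[OF DERIV_ident DERIV_const] kernel_deriv])
        (use \<open>u z \<noteq> 0\<close> in \<open>simp add: u_def\<close>)
    moreover have "(1 - 0) * u z - (z - a) * - cnj a = of_real b"
      unfolding b_def kernel_diag[symmetric] by (simp add: u_def algebra_simps)
    ultimately have "((\<lambda>z. (z - a) / u z) has_field_derivative of_real b / (u z)\<^sup>2) (at z)"
      by (simp add: power2_eq_square)
    from DERIV_cmult[OF this, of "of_real c"] show ?thesis
      by (simp add: g_def)
  qed
  have hol: "g holomorphic_on \<bbbD>"
    unfolding holomorphic_on_open[OF open_ball] using dg by (intro ballI exI)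
  have der: "norm (deriv g z) = c * b / (norm (u z))\<^sup>2" if "z \<in> \<bbbD>" for z
    using DERIV_imp_deriv[OF dg[OF that]] c b \<delta> by (simp add: norm_divide norm_mult norm_power)
  \<comment> \<open>\<open>norm (u z)\<close> dominates both distances to the boundary; the larger one decides which of the two
     logarithms has to be estimated\<close>
  have B: "v_log z * norm (deriv g z) \<le> 4" if z: "z \<in> \<bbbD>" for z
  proof -
    define s where "s = 1 - norm z"
    have s: "0 < s" "s \<le> 1" using z by (auto simp: s_def)
    have us: "s \<le> norm (u z)" "\<delta> \<le> norm (u z)"
      using ker(1,2)[OF z] by (auto simp: s_def \<delta>_def)
    have "s * ln (2 / s) * \<delta> \<le> 2 * ln (2 / \<delta>) * (norm (u z))\<^sup>2"
    proof (cases "s \<le> \<delta>")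
      case True
      have "s * ln (2 / s) * \<delta> \<le> 2 * (\<delta> * ln (2 / \<delta>)) * \<delta>"
        using log_weight_quasi_mono[OF s(1) True \<delta>(2)] \<delta> by (intro mult_right_mono) auto
      also have "\<dots> = 2 * ln (2 / \<delta>) * (\<delta> * \<delta>)" by simp
      also have "\<dots> \<le> 2 * ln (2 / \<delta>) * (norm (u z))\<^sup>2"
        unfolding power2_eq_square using us \<delta> lnp by (intro mult_left_mono mult_mono) auto
      finally show ?thesis .
    next
      case False
      have "ln (2 / s) \<le> ln (2 / \<delta>)"
        using False s \<delta> by (simp add: ln_div)
      then have "ln (2 / s) * (s * \<delta>) \<le> ln (2 / \<delta>) * (norm (u z))\<^sup>2"
        unfolding power2_eq_square using us \<delta> lnp s by (intro mult_mono) auto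
      moreover have "0 \<le> ln (2 / \<delta>) * (norm (u z))\<^sup>2"
        using lnp by simp
      ultimately show ?thesis by (simp add: mult_ac)
    qed
    then have le: "s * ln (2 / s) * \<delta> / (ln (2 / \<delta>) * (norm (u z))\<^sup>2) \<le> 2"
      using lnp ker(5)[OF z] by (subst pos_divide_le_eq) (auto simp: mult_ac)
    have "v_log z * norm (deriv g z) = b * (s * ln (2 / s)) / (ln (2 / \<delta>) * (norm (u z))\<^sup>2)"
      unfolding der[OF z] by (simp add: v_log_def s_def c_def)
    also have "\<dots> \<le> (2 * \<delta>) * (s * ln (2 / s)) / (ln (2 / \<delta>) * (norm (u z))\<^sup>2)"
      using b lnp v_log_pos[OF z] by (intro divide_right_mono mult_right_mono) (auto simp: v_log_def s_def)
    also have "\<dots> = 2 * (s * ln (2 / s) * \<delta> / (ln (2 / \<delta>) * (norm (u z))\<^sup>2))"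
      by simp
    also have "\<dots> \<le> 2 * 2"
      using le by (rule mult_left_mono) simp
    finally show ?thesis by simp
  qed
  have "\<exists>f. norm f \<le> norm (g 0) + 4 \<and> (\<forall>z\<in>\<bbbD>. deriv (Rep_zyg_vlog f) z = g z \<and>
     deriv (deriv (Rep_zyg_vlog f)) z = deriv g z)"
    using hol B by (rule zyg_with_derivative)
  then obtain f where f: "norm f \<le> norm (g 0) + 4" "\<forall>z\<in>\<bbbD>. deriv (Rep_zyg_vlog f) z = g z \<and>
     deriv (deriv (Rep_zyg_vlog f)) z = deriv g z"
    by (elim exE conjE) (rule that)
  have "norm (g 0) = c * norm a"
    using c by (simp add: g_def u_def norm_mult)
  also have "\<dots> \<le> 2 * 1"
    using c a by (intro mult_mono) auto
  finally have n6: "norm f \<le> 6"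
    using f(1) by simp
  have fa: "deriv (Rep_zyg_vlog f) a = 0"
    using f(2) a by (simp add: g_def)
  have faa: "1 \<le> 2 * v_log a * norm (deriv (deriv (Rep_zyg_vlog f)) a)"
  proof -
    have "norm (u a) = b"
      using b \<delta> unfolding u_def kernel_diag b_def[symmetric] by simp
    then have "norm (deriv (deriv (Rep_zyg_vlog f)) a) = c / b"
      using f(2) a der[OF a] b \<delta> by (simp add: power2_eq_square)
    then have "2 * v_log a * norm (deriv (deriv (Rep_zyg_vlog f)) a) = 2 * (v_log a * c) / b"
      by simp
    also have "v_log a * c = \<delta>"
      unfolding v_log_def \<delta>_def[symmetric] c_def using lnp by simp
    finally show ?thesis
      using b \<delta> by (simp add: pos_le_divide_eq)
  qed
  have null: "norm (g z) \<le> 4 / (1 - norm z)\<^sup>2 * w_log a \<and> norm (deriv g z) \<le> 4 / (1 - norm z)\<^sup>2 * w_log a"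
    if z: "z \<in> \<bbbD>" for z
  proof -
    define s where "s = 1 - norm z"
    have s: "0 < s" "s \<le> 1" using z by (auto simp: s_def)
    have us: "s \<le> norm (u z)"
      using ker(2)[OF z] by (simp add: s_def)
    have ss: "s\<^sup>2 \<le> s"
      using s by (simp add: power2_eq_square mult_left_le)
    have "norm (z - a) / norm (u z) \<le> 2 / s\<^sup>2"
      using norm_triangle_ineq4[of z a] z a us ss s by (intro frac_le) auto
    then have "norm (g z) \<le> c * (2 / s\<^sup>2)"
      using c by (simp add: g_def norm_mult norm_divide mult_left_mono del: times_divide_eq_right)
    also have "\<dots> \<le> (2 * w_log a) * (2 / s\<^sup>2)"
      using c2w by (intro mult_right_mono) auto
    finally have 1: "norm (g z) \<le> 4 / s\<^sup>2 * w_log a" by simp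
    have "c * b / (norm (u z))\<^sup>2 \<le> (2 * w_log a) * 1 / s\<^sup>2"
      using c2w c b \<delta> us s w_log_pos[OF a] by (intro frac_le mult_mono power_mono) auto
    also have "\<dots> \<le> 4 / s\<^sup>2 * w_log a"
      using w_log_pos[OF a] s by (simp add: divide_simps)
    finally have 2: "norm (deriv g z) \<le> 4 / s\<^sup>2 * w_log a"
      unfolding der[OF z] .
    show ?thesis using 1 2 by (simp add: s_def)
  qed
  show ?thesis
    using n6 fa faa null f(2) by (intro exI[of _ f]) simp
qed

text \<open>The derivative of \<open>f\<close> is \<open>h\<^sup>2 / h a\<close> where \<open>h z = Ln (1 + ln 2 - Ln (1 - cnj a * z))\<close> is a holomorphic
version of the iterated logarithm. It has the largest order \<open>loglog a\<close> at \<open>a\<close>; squaring and dividing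
by \<open>h a\<close> makes it tend to 0 at every fixed point of the disc as \<open>a\<close> approaches the boundary. The
constant \<open>1 + ln 2\<close> keeps the real part of the inner expression at least 1, because
\<open>norm (1 - cnj a * z) < 2\<close>.\<close>

lemma first_order_test_function:
  assumes a: "a \<in> \<bbbD>"
  shows "\<exists>f. norm f \<le> 65 \<and> loglog a \<le> norm (deriv (Rep_zyg_vlog f) a) \<and>
    (\<forall>z\<in>\<bbbD>. norm (deriv (Rep_zyg_vlog f) z) \<le> ((5 - ln (1 - norm z))\<^sup>2 + 4 * (5 - ln (1 - norm z)) / v_log z) * w_log a \<and>
      norm (deriv (deriv (Rep_zyg_vlog f)) z) \<le> ((5 - ln (1 - norm z))\<^sup>2 + 4 * (5 - ln (1 - norm z)) / v_log z) * w_log a)"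
proof -
  define u where "u = (\<lambda>z. 1 - cnj a * z)"
  define L where "L = (\<lambda>z. of_real (1 + ln 2) - Ln (u z))"
  define h where "h = (\<lambda>z. Ln (L z))"
  define b where "b = 1 - (norm a)\<^sup>2"
  define E where "E = 1 + ln 2 - ln b"
  define H where "H = ln E"
  define g where "g = (\<lambda>z. (h z)\<^sup>2 / of_real H)"
  have ker: "1 - norm a \<le> norm (u z)" "1 - norm z \<le> norm (u z)" "norm (u z) < 2" "0 < Re (u z)" "u z \<noteq> 0"
    if "z \<in> \<bbbD>" for z
    unfolding u_def by (rule kernel_bounds[OF a that])+
  have ln2: "1/2 \<le> ln (2::real)" "ln (2::real) \<le> 1"
    using half_le_ln2 ln_le_minus_one[of "2::real"] by auto
  have b: "0 < b" "b \<le> 1" "b \<le> 2 * (1 - norm a)"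
  proof -
    show "0 < b" using norm_disc_sq[OF a] by (simp add: b_def)
    show "b \<le> 1" by (simp add: b_def)
    have "b = (1 + norm a) * (1 - norm a)"
      by (simp add: b_def power2_eq_square algebra_simps)
    also have "\<dots> \<le> 2 * (1 - norm a)"
      using a by (intro mult_right_mono) auto
    finally show "b \<le> 2 * (1 - norm a)" .
  qed
  have lnb: "ln b \<le> 0" using b by simp
  have E: "3/2 \<le> E" "1 + ln 2 \<le> E"
    using lnb ln2 by (auto simp: E_def)
  have H3: "1/3 \<le> H"
  proof -
    have "ln (1 / E) \<le> 1 / E - 1"
      using E by (intro ln_le_minus_one) auto
    also have "1 / E \<le> 1 / (3/2)"
      using E by (intro divide_left_mono) auto
    finally show ?thesis
      using E by (simp add: H_def ln_div)
  qed
  have loglogH: "loglog a \<le> H"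
  proof -
    have "ln (4::real) = ln 2 + ln 2"
      using ln_mult[of 2 "2::real"] by simp
    then have "ln (4 / b) \<le> E"
      using b ln2 by (simp add: E_def ln_div)
    moreover have "1 < ln (4 / b)"
      using ln_four_over_gt_1[OF a] by (simp add: b_def)
    ultimately show ?thesis
      unfolding loglog_def H_def b_def[symmetric] by (intro iffD2[OF ln_le_cancel_iff]) auto
  qed
  have ReL: "Re (L z) = 1 + ln 2 - ln (norm (u z))" if z: "z \<in> \<bbbD>" for z
    using ker(5)[OF z] by (simp add: L_def)
  have ReL1: "1 \<le> Re (L z)" if z: "z \<in> \<bbbD>" for z
  proof -
    have "ln (norm (u z)) \<le> ln 2"
      using ker(3,5)[OF z] by (subst ln_le_cancel_iff) auto
    then show ?thesis
      using ReL[OF z] by simp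
  qed
  have normL1: "1 \<le> norm (L z)" if z: "z \<in> \<bbbD>" for z
    using ReL1[OF z] complex_Re_le_cmod[of "L z"] by linarith
  have normL: "norm (L z) \<le> 3 - ln (norm (u z)) + ln 2" if z: "z \<in> \<bbbD>" for z
  proof -
    have "\<bar>Im (L z)\<bar> \<le> 2"
      using Re_Ln_pos_lt_imp[OF ker(4)[OF z]] pi_less_4 by (simp add: L_def)
    then show ?thesis
      using cmod_le[of "L z"] ReL[OF z] ReL1[OF z] by simp
  qed
  have normh: "norm (h z) \<le> ln (norm (L z)) + 2" if z: "z \<in> \<bbbD>" for z
  proof -
    have "0 < Re (L z)" using ReL1[OF z] by simp
    from Re_Ln_pos_lt_imp[OF this] have "\<bar>Im (h z)\<bar> \<le> 2"
      using pi_less_4 by (simp add: h_def)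
    moreover have "Re (h z) = ln (norm (L z))"
      using normL1[OF z] by (auto simp: h_def intro!: Re_Ln)
    moreover have "0 \<le> ln (norm (L z))"
      using normL1[OF z] by simp
    ultimately show ?thesis
      using cmod_le[of "h z"] by simp
  qed
  have hH: "norm (h z) \<le> 13 * H" if z: "z \<in> \<bbbD>" for z
  proof -
    have "ln (b / 2) \<le> ln (norm (u z))"
      using ker(1)[OF z] ker(5)[OF z] b by (intro ln_mono) auto
    then have "norm (L z) \<le> 3 * E"
      using normL[OF z] E ln2 b by (simp add: E_def ln_div)
    then have "ln (norm (L z)) \<le> ln (3 * E)"
      using normL1[OF z] by (intro ln_mono) auto
    also have "\<dots> \<le> 2 + H"
      using E ln_le_minus_one[of "3::real"] by (simp add: H_def ln_mult)
    finally show ?thesis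
      using normh[OF z] H3 by simp
  qed
  have dh: "(h has_field_derivative cnj a / (u z * L z)) (at z)" if z: "z \<in> \<bbbD>" for z
  proof -
    have nz: "u z \<notin> \<real>\<^sub>\<le>\<^sub>0" "L z \<notin> \<real>\<^sub>\<le>\<^sub>0"
      using ker(4)[OF z] ReL1[OF z] by (auto simp: complex_nonpos_Reals_iff)
    have "((\<lambda>z. Ln (u z)) has_field_derivative inverse (u z) * - cnj a) (at z)"
      using DERIV_chain2[OF has_field_derivative_Ln[OF nz(1)] kernel_deriv[of a z, folded u_def]] .
    from DERIV_diff[OF DERIV_const this] have "(L has_field_derivative cnj a / u z) (at z)"
      by (simp add: L_def[abs_def] divide_inverse mult.commute)
    from DERIV_chain2[OF has_field_derivative_Ln[OF nz(2)] this] show ?thesis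
      by (simp add: h_def[abs_def] divide_inverse mult_ac)
  qed
  \<comment> \<open>the derivative of \<open>h\<close> has the order of \<open>1 / v_log\<close>, since \<open>norm (u z)\<close> is at least \<open>1 - norm z\<close>
     and \<open>v_log\<close> is quasi-monotone in \<open>1 - norm z\<close>\<close>
  have vh: "v_log z * norm (cnj a / (u z * L z)) \<le> 2" if z: "z \<in> \<bbbD>" for z
  proof -
    have up: "0 < norm (u z)" using ker(5)[OF z] by simp
    have "v_log z \<le> 2 * (norm (u z) * Re (L z))"
    proof (cases "norm (u z) \<le> 1")
      case True
      have "v_log z \<le> 2 * (norm (u z) * ln (2 / norm (u z)))"
        unfolding v_log_def using z ker(2)[OF z] True by (intro log_weight_quasi_mono) auto
      also have "\<dots> \<le> 2 * (norm (u z) * Re (L z))"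
        using up ReL[OF z] by (intro mult_left_mono) (auto simp: ln_div)
      finally show ?thesis .
    next
      case False
      have "2 * (1 * 1) \<le> 2 * (norm (u z) * Re (L z))"
        using False ReL1[OF z] by (intro mult_left_mono mult_mono) auto
      then show ?thesis
        using v_log_le_2[OF z] by simp
    qed
    also have "\<dots> \<le> 2 * (norm (u z) * norm (L z))"
      using complex_Re_le_cmod[of "L z"] by (intro mult_left_mono) auto
    finally have "v_log z / (norm (u z) * norm (L z)) \<le> 2"
      using up normL1[OF z] by (subst pos_divide_le_eq) (auto intro!: mult_pos_pos)
    moreover have "v_log z * norm (cnj a / (u z * L z)) \<le> v_log z * (1 / (norm (u z) * norm (L z)))"
      using a v_log_pos[OF z] by (intro mult_left_mono) (auto simp: norm_divide norm_mult intro!: divide_right_mono)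
    ultimately show ?thesis by simp
  qed
  have dg: "(g has_field_derivative 2 * h z * (cnj a / (u z * L z)) / of_real H) (at z)" if z: "z \<in> \<bbbD>" for z
    using DERIV_cdivide[OF DERIV_power[OF dh[OF z], where n = 2], of "of_real H"]
    by (simp add: g_def[abs_def] mult_ac)
  have hol: "g holomorphic_on \<bbbD>"
    unfolding holomorphic_on_open[OF open_ball] using dg by (intro ballI exI)
  have der: "norm (deriv g z) = 2 * norm (h z) / H * norm (cnj a / (u z * L z))" if z: "z \<in> \<bbbD>" for z
    using H3 unfolding DERIV_imp_deriv[OF dg[OF z]] by (simp add: norm_mult norm_divide)
  have B: "v_log z * norm (deriv g z) \<le> 52" if z: "z \<in> \<bbbD>" for z
  proof -
    have "v_log z * norm (deriv g z) = 2 * norm (h z) / H * (v_log z * norm (cnj a / (u z * L z)))"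
      unfolding der[OF z] by simp
    also have "\<dots> \<le> 26 * 2"
      using hH[OF z] H3 vh[OF z] v_log_pos[OF z] by (intro mult_mono) (auto simp: divide_le_eq)
    finally show ?thesis by simp
  qed
  have "\<exists>f. norm f \<le> norm (g 0) + 52 \<and> (\<forall>z\<in>\<bbbD>. deriv (Rep_zyg_vlog f) z = g z \<and>
     deriv (deriv (Rep_zyg_vlog f)) z = deriv g z)"
    using hol B by (rule zyg_with_derivative)
  then obtain f where f: "norm f \<le> norm (g 0) + 52" "\<forall>z\<in>\<bbbD>. deriv (Rep_zyg_vlog f) z = g z \<and>
     deriv (deriv (Rep_zyg_vlog f)) z = deriv g z"
    by (elim exE conjE) (rule that)
  have "norm (g 0) \<le> 13"
  proof -
    have "L 0 = of_real (1 + ln 2)"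
      by (simp add: L_def u_def)
    then have "h 0 = of_real (ln (1 + ln 2))"
      using ln2 Ln_of_real[of "1 + ln 2"] by (simp only: h_def)
    moreover have "0 \<le> ln (1 + ln (2::real))"
      using ln2 by (intro ln_ge_zero) auto
    moreover have "ln (1 + ln (2::real)) \<le> 1"
    proof -
      have "ln (1 + ln (2::real)) \<le> (1 + ln 2) - 1"
        using ln2 by (intro ln_le_minus_one) linarith
      then show ?thesis using ln2 by linarith
    qed
    ultimately have h0: "norm (h 0) \<le> 1" by simp
    have "norm (g 0) = norm (h 0) * (norm (h 0) / H)"
      using H3 by (simp add: g_def norm_divide norm_mult power2_eq_square)
    also have "\<dots> \<le> 1 * 13"
      using h0 hH[of 0] H3 by (intro mult_mono) (auto simp: divide_le_eq)
    finally show ?thesis by simp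
  qed
  then have n: "norm f \<le> 65" using f(1) by simp
  have fa: "loglog a \<le> norm (deriv (Rep_zyg_vlog f) a)"
  proof -
    have "Ln (u a) = of_real (ln b)"
      unfolding u_def kernel_diag b_def[symmetric] using b(1) by (simp add: Ln_of_real)
    then have "L a = of_real E"
      by (simp add: L_def E_def)
    then have "h a = of_real H"
      using E Ln_of_real[of E] by (simp only: h_def H_def)
    then have "g a = of_real H"
      using H3 by (simp add: g_def power2_eq_square)
    then show ?thesis
      using f(2) a loglogH H3 by simp
  qed
  have Hw: "1 / H \<le> w_log a"
    unfolding w_log_eq using loglogH loglog_pos[OF a] by (intro divide_left_mono) auto
  have null: "norm (g z) \<le> ((5 - ln (1 - norm z))\<^sup>2 + 4 * (5 - ln (1 - norm z)) / v_log z) * w_log a \<and>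
      norm (deriv g z) \<le> ((5 - ln (1 - norm z))\<^sup>2 + 4 * (5 - ln (1 - norm z)) / v_log z) * w_log a"
    if z: "z \<in> \<bbbD>" for z
  proof -
    define P where "P = 5 - ln (1 - norm z)"
    have "ln (1 - norm z) \<le> 0" using z by simp
    then have P: "5 \<le> P" by (simp add: P_def)
    have "ln (1 - norm z) \<le> ln (norm (u z))"
      using ker(2)[OF z] z by (intro ln_mono) auto
    then have "norm (L z) \<le> P - 1"
      using normL[OF z] ln2 by (simp add: P_def)
    moreover have "ln (norm (L z)) \<le> norm (L z) - 1"
      using normL1[OF z] by (intro ln_le_minus_one) auto
    ultimately have hP: "norm (h z) \<le> P"
      using normh[OF z] by simp
    note vz = v_log_pos[OF z]
    have "norm (g z) = (norm (h z))\<^sup>2 * (1 / H)"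
      using H3 by (simp add: g_def norm_divide norm_power)
    also have "\<dots> \<le> P\<^sup>2 * w_log a"
      using hP Hw H3 by (intro mult_mono power_mono) auto
    also have "\<dots> \<le> (P\<^sup>2 + 4 * P / v_log z) * w_log a"
      using P vz w_log_pos[OF a] by (intro mult_right_mono) auto
    finally have 1: "norm (g z) \<le> (P\<^sup>2 + 4 * P / v_log z) * w_log a" .
    have vh': "norm (cnj a / (u z * L z)) \<le> 2 / v_log z"
      using vh[OF z] vz by (simp add: field_simps)
    have "norm (deriv g z) = (2 * norm (h z) * norm (cnj a / (u z * L z))) * (1 / H)"
      unfolding der[OF z] by simp
    also have "\<dots> \<le> (2 * P * (2 / v_log z)) * w_log a"
      using hP Hw H3 vh' P vz by (intro mult_mono mult_left_mono mult_nonneg_nonneg) auto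
    also have "\<dots> \<le> (P\<^sup>2 + 4 * P / v_log z) * w_log a"
      using P vz w_log_pos[OF a] by (intro mult_right_mono) auto
    finally have 2: "norm (deriv g z) \<le> (P\<^sup>2 + 4 * P / v_log z) * w_log a" .
    show ?thesis using 1 2 by (simp add: P_def)
  qed
  show ?thesis
    using n fa null f(2) by (intro exI[of _ f]) simp
qed

text \<open>The functions from \<open>second_order_test_function\<close> isolate \<open>\<phi>'\<^sup>2\<close>. For those from
\<open>first_order_test_function\<close> the contribution of \<open>\<phi>'\<^sup>2\<close> does not vanish, but it is then already under control, and what remains is the one of \<open>\<phi>''\<close>.
The constant is \<open>1690 = 2 * 65 + 65 * 24\<close>.\<close>

lemma weights_le_distance:
  assumes adm: "admissible \<phi>" and K: "compact_operator K" and e: "0 < e"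
  defines "t \<equiv> onorm (\<lambda>f. comp_op \<phi> f - K f)"
  shows "\<exists>r<1. \<forall>z\<in>\<bbbD>. r < norm (\<phi> z) \<longrightarrow>
    v_log z * (norm (deriv \<phi> z))\<^sup>2 \<le> (1690 * t + e) * v_log (\<phi> z) \<and>
    v_log z * norm (deriv (deriv \<phi>) z) \<le> (1690 * t + e) * w_log (\<phi> z)"
proof -
  have \<phi>z: "\<phi> z \<in> \<bbbD>" if "z \<in> \<bbbD>" for z
    using adm that unfolding admissible_def by blast
  have t: "0 \<le> t"
    unfolding t_def by (rule onorm_pos_le[OF bounded_linear_compact_perturbation[OF adm K]])
  \<comment> \<open>the errors \<open>d\<close> and \<open>65 * (2 * d)\<close> of the two steps add up to \<open>e\<close>\<close>
  define d where "d = e / 131"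
  have d: "0 < d" using e by (simp add: d_def)
  have "\<forall>a\<in>\<bbbD>. \<exists>f. norm f \<le> 6 \<and> deriv (Rep_zyg_vlog f) a = 0 \<and>
      1 \<le> 2 * v_log a * norm (deriv (deriv (Rep_zyg_vlog f)) a) \<and>
      (\<forall>z\<in>\<bbbD>. norm (deriv (Rep_zyg_vlog f) z) \<le> 4 / (1 - norm z)\<^sup>2 * w_log a \<and>
        norm (deriv (deriv (Rep_zyg_vlog f)) z) \<le> 4 / (1 - norm z)\<^sup>2 * w_log a)"
    using second_order_test_function by (intro ballI)
  from bchoice[OF this] obtain F where F: "\<forall>a\<in>\<bbbD>. norm (F a) \<le> 6 \<and> deriv (Rep_zyg_vlog (F a)) a = 0 \<and>
      1 \<le> 2 * v_log a * norm (deriv (deriv (Rep_zyg_vlog (F a))) a) \<and>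
      (\<forall>z\<in>\<bbbD>. norm (deriv (Rep_zyg_vlog (F a)) z) \<le> 4 / (1 - norm z)\<^sup>2 * w_log a \<and>
        norm (deriv (deriv (Rep_zyg_vlog (F a))) z) \<le> 4 / (1 - norm z)\<^sup>2 * w_log a)" ..
  have Fa: "norm (F a) \<le> 6"
    "\<forall>z\<in>\<bbbD>. norm (deriv (Rep_zyg_vlog (F a)) z) \<le> 4 / (1 - norm z)\<^sup>2 * w_log a \<and>
        norm (deriv (deriv (Rep_zyg_vlog (F a))) z) \<le> 4 / (1 - norm z)\<^sup>2 * w_log a" if "a \<in> \<bbbD>" for a
    using bspec[OF F that] by - (elim conjE, assumption)+
  have "\<exists>r<1. \<forall>z\<in>\<bbbD>. r < norm (\<phi> z) \<longrightarrow>
    v_log z * norm (deriv (deriv (Rep_zyg_vlog (F (\<phi> z)))) (\<phi> z) * (deriv \<phi> z)\<^sup>2 +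
      deriv (Rep_zyg_vlog (F (\<phi> z))) (\<phi> z) * deriv (deriv \<phi>) z) \<le> 2 * 6 * t + d"
    unfolding t_def
    by (rule compact_perturbation_lower[where \<Theta> = "\<lambda>z. 4 / (1 - norm z)\<^sup>2", OF adm K _ d Fa(1)
          conjunct1[OF bspec[OF Fa(2)]] conjunct2[OF bspec[OF Fa(2)]]]) simp_all
  then obtain r1 where r1: "r1 < 1" "\<forall>z\<in>\<bbbD>. r1 < norm (\<phi> z) \<longrightarrow>
    v_log z * norm (deriv (deriv (Rep_zyg_vlog (F (\<phi> z)))) (\<phi> z) * (deriv \<phi> z)\<^sup>2 +
      deriv (Rep_zyg_vlog (F (\<phi> z))) (\<phi> z) * deriv (deriv \<phi>) z) \<le> 2 * 6 * t + d"
    by (elim exE conjE) (rule that)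
  have q2: "v_log z * (norm (deriv \<phi> z))\<^sup>2 \<le> (24 * t + 2 * d) * v_log (\<phi> z)"
    if z: "z \<in> \<bbbD>" and r: "r1 < norm (\<phi> z)" for z
  proof -
    let ?p = "v_log z * (norm (deriv \<phi> z))\<^sup>2"
    let ?m = "norm (deriv (deriv (Rep_zyg_vlog (F (\<phi> z)))) (\<phi> z))"
    note Fz = bspec[OF F \<phi>z[OF z]]
    have "v_log z * norm (deriv (deriv (Rep_zyg_vlog (F (\<phi> z)))) (\<phi> z) * (deriv \<phi> z)\<^sup>2 +
      deriv (Rep_zyg_vlog (F (\<phi> z))) (\<phi> z) * deriv (deriv \<phi>) z) \<le> 2 * 6 * t + d"
      using bspec[OF r1(2) z] r by (rule mp)
    then have m: "?p * ?m \<le> 12 * t + d"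
      using Fz by (simp add: norm_mult norm_power mult_ac)
    have "?p * 1 \<le> ?p * (2 * v_log (\<phi> z) * ?m)"
      using Fz v_log_pos[OF z] by (intro mult_left_mono) auto
    also have "\<dots> = 2 * v_log (\<phi> z) * (?p * ?m)"
      by simp
    also have "\<dots> \<le> 2 * v_log (\<phi> z) * (12 * t + d)"
      using m v_log_pos[OF \<phi>z[OF z]] by (intro mult_left_mono) auto
    finally show ?thesis
      by (simp add: algebra_simps)
  qed
  let ?\<Theta> = "\<lambda>z. (5 - ln (1 - norm z))\<^sup>2 + 4 * (5 - ln (1 - norm z)) / v_log z"
  have "\<forall>a\<in>\<bbbD>. \<exists>f. norm f \<le> 65 \<and> loglog a \<le> norm (deriv (Rep_zyg_vlog f) a) \<and>
    (\<forall>z\<in>\<bbbD>. norm (deriv (Rep_zyg_vlog f) z) \<le> ?\<Theta> z * w_log a \<and>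
      norm (deriv (deriv (Rep_zyg_vlog f)) z) \<le> ?\<Theta> z * w_log a)"
    using first_order_test_function by (intro ballI)
  from bchoice[OF this] obtain G where G: "\<forall>a\<in>\<bbbD>. norm (G a) \<le> 65 \<and> loglog a \<le> norm (deriv (Rep_zyg_vlog (G a)) a) \<and>
    (\<forall>z\<in>\<bbbD>. norm (deriv (Rep_zyg_vlog (G a)) z) \<le> ?\<Theta> z * w_log a \<and>
      norm (deriv (deriv (Rep_zyg_vlog (G a))) z) \<le> ?\<Theta> z * w_log a)" ..
  have Ga: "norm (G a) \<le> 65"
    "\<forall>z\<in>\<bbbD>. norm (deriv (Rep_zyg_vlog (G a)) z) \<le> ?\<Theta> z * w_log a \<and>
      norm (deriv (deriv (Rep_zyg_vlog (G a))) z) \<le> ?\<Theta> z * w_log a" if "a \<in> \<bbbD>" for a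
    using bspec[OF G that] by - (elim conjE, assumption)+
  have "\<exists>r<1. \<forall>z\<in>\<bbbD>. r < norm (\<phi> z) \<longrightarrow>
    v_log z * norm (deriv (deriv (Rep_zyg_vlog (G (\<phi> z)))) (\<phi> z) * (deriv \<phi> z)\<^sup>2 +
      deriv (Rep_zyg_vlog (G (\<phi> z))) (\<phi> z) * deriv (deriv \<phi>) z) \<le> 2 * 65 * t + d"
    unfolding t_def
    by (rule compact_perturbation_lower[where \<Theta> = ?\<Theta>, OF adm K _ d Ga(1)
          conjunct1[OF bspec[OF Ga(2)]] conjunct2[OF bspec[OF Ga(2)]]]) simp_all
  then obtain r2 where r2: "r2 < 1" "\<forall>z\<in>\<bbbD>. r2 < norm (\<phi> z) \<longrightarrow>
    v_log z * norm (deriv (deriv (Rep_zyg_vlog (G (\<phi> z)))) (\<phi> z) * (deriv \<phi> z)\<^sup>2 +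
      deriv (Rep_zyg_vlog (G (\<phi> z))) (\<phi> z) * deriv (deriv \<phi>) z) \<le> 2 * 65 * t + d"
    by (elim exE conjE) (rule that)
  have q1: "v_log z * norm (deriv (deriv \<phi>) z) \<le> (1690 * t + 131 * d) * w_log (\<phi> z)"
    if z: "z \<in> \<bbbD>" and r: "r1 < norm (\<phi> z)" "r2 < norm (\<phi> z)" for z
  proof -
    let ?g = "Rep_zyg_vlog (G (\<phi> z))"
    let ?A = "deriv (deriv ?g) (\<phi> z) * (deriv \<phi> z)\<^sup>2" and ?B = "deriv ?g (\<phi> z) * deriv (deriv \<phi>) z"
    note Gz = bspec[OF G \<phi>z[OF z]]
    note v = v_log_pos[OF z] v_log_pos[OF \<phi>z[OF z]]
    have AB: "v_log z * norm (?A + ?B) \<le> 2 * 65 * t + d"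
      using bspec[OF r2(2) z] r(2) by (rule mp)
    have "v_log z * norm ?A = (v_log z * (norm (deriv \<phi> z))\<^sup>2) * norm (deriv (deriv ?g) (\<phi> z))"
      by (simp add: norm_mult norm_power)
    also have "\<dots> \<le> ((24 * t + 2 * d) * v_log (\<phi> z)) * norm (deriv (deriv ?g) (\<phi> z))"
      by (intro mult_right_mono q2 z r) auto
    also have "\<dots> = (24 * t + 2 * d) * (v_log (\<phi> z) * norm (deriv (deriv ?g) (\<phi> z)))"
      by simp
    also have "\<dots> \<le> (24 * t + 2 * d) * 65"
      using zyg_second_deriv_le[OF \<phi>z[OF z], of "G (\<phi> z)"] Gz t d by (intro mult_left_mono) auto
    finally have A: "v_log z * norm ?A \<le> (24 * t + 2 * d) * 65" .
    have "norm ?B \<le> norm (?A + ?B) + norm ?A"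
      using norm_triangle_ineq4[of "?A + ?B" ?A] by simp
    then have "v_log z * norm ?B \<le> v_log z * norm (?A + ?B) + v_log z * norm ?A"
      using v mult_left_mono[of "norm ?B" "norm (?A + ?B) + norm ?A" "v_log z"] by (simp add: distrib_left)
    also have "\<dots> \<le> 1690 * t + 131 * d"
      using AB A by simp
    finally have B: "v_log z * norm ?B \<le> 1690 * t + 131 * d" .
    have "v_log z * norm (deriv (deriv \<phi>) z) * loglog (\<phi> z) \<le>
        v_log z * norm (deriv (deriv \<phi>) z) * norm (deriv ?g (\<phi> z))"
      using Gz v by (intro mult_left_mono) auto
    also have "\<dots> = v_log z * norm ?B"
      by (simp add: norm_mult)
    also note B
    finally show ?thesis
      using loglog_pos[OF \<phi>z[OF z]] by (simp add: w_log_eq pos_le_divide_eq)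
  qed
  have "max r1 r2 < 1 \<and> (\<forall>z\<in>\<bbbD>. max r1 r2 < norm (\<phi> z) \<longrightarrow>
    v_log z * (norm (deriv \<phi> z))\<^sup>2 \<le> (1690 * t + e) * v_log (\<phi> z) \<and>
    v_log z * norm (deriv (deriv \<phi>) z) \<le> (1690 * t + e) * w_log (\<phi> z))"
  proof (intro conjI ballI impI)
    show "max r1 r2 < 1" using r1(1) r2(1) by simp
    fix z :: complex
    assume z: "z \<in> \<bbbD>" "max r1 r2 < norm (\<phi> z)"
    have "(24 * t + 2 * d) * v_log (\<phi> z) \<le> (1690 * t + e) * v_log (\<phi> z)"
      using t e v_log_pos[OF \<phi>z[OF z(1)]] by (intro mult_right_mono) (auto simp: d_def)
    then show "v_log z * (norm (deriv \<phi> z))\<^sup>2 \<le> (1690 * t + e) * v_log (\<phi> z)"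
      using q2[OF z(1)] z(2) by simp
    show "v_log z * norm (deriv (deriv \<phi>) z) \<le> (1690 * t + e) * w_log (\<phi> z)"
      using q1[OF z(1)] z(2) by (simp add: d_def)
  qed
  then show ?thesis ..
qed

section \<open>Comparison of \<open>M\<close> with the essential norm\<close>

lemma M_log_le_onorm:
  assumes adm: "admissible \<phi>" and K: "compact_operator K"
  shows "M_log \<phi> \<le> ereal (1690 * onorm (\<lambda>f. comp_op \<phi> f - K f))"
proof (rule ereal_le_epsilon2)
  fix e :: real
  assume e: "0 < e"
  let ?t = "onorm (\<lambda>f. comp_op \<phi> f - K f)"
  have t: "0 \<le> ?t"
    by (rule onorm_pos_le[OF bounded_linear_compact_perturbation[OF adm K]])
  have \<phi>: "\<phi> holomorphic_on \<bbbD>" "\<phi> ` \<bbbD> \<subseteq> \<bbbD>"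
    using adm by (auto simp: admissible_def)
  obtain r where r: "r < 1" "\<forall>z\<in>\<bbbD>. r < norm (\<phi> z) \<longrightarrow>
    v_log z * (norm (deriv \<phi> z))\<^sup>2 \<le> (1690 * ?t + e) * v_log (\<phi> z) \<and>
    v_log z * norm (deriv (deriv \<phi>) z) \<le> (1690 * ?t + e) * w_log (\<phi> z)"
    using weights_le_distance[OF adm K e] by (elim exE conjE) (rule that)
  note bw = admissible_bounded_weights[OF adm]
  have le1: "v_log z * norm (deriv (deriv \<phi>) z) \<le> (1690 * ?t + e) * w_log (\<phi> z)"
    and le2: "v_log z * (norm (deriv \<phi> z))\<^sup>2 \<le> (1690 * ?t + e) * v_log (\<phi> z)"
    if "z \<in> \<bbbD>" "r < norm (\<phi> z)" for z
    using mp[OF bspec[OF r(2) that(1)] that(2)] by - (elim conjE, assumption)+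
  have c: "0 \<le> 1690 * ?t + e"
    using t e by linarith
  have "M_log \<phi> \<le> ereal (1690 * ?t + e)"
    unfolding M_log_eq[OF \<phi> bw]
  proof (rule max.boundedI)
    show "limsup (\<lambda>n. ereal (power_sup (\<lambda>z. v_log z * norm (deriv (deriv \<phi>) z)) \<phi> n / weight_sup w_log n))
        \<le> ereal (1690 * ?t + e)"
      by (rule limsup_power_sup_le[OF bounded_weight_w_log w_log_pos bw(1) \<phi>(2) r(1) le1 c])
    show "limsup (\<lambda>n. ereal (power_sup (\<lambda>z. v_log z * (norm (deriv \<phi> z))\<^sup>2) \<phi> n / weight_sup v_log n))
        \<le> ereal (1690 * ?t + e)"
      by (rule limsup_power_sup_le[OF bounded_weight_v_log v_log_pos bw(2) \<phi>(2) r(1) le2 c])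
  qed
  then show "M_log \<phi> \<le> ereal (1690 * ?t) + ereal e"
    by simp
qed

lemma compact_operator_zero: "compact_operator (\<lambda>x. 0)"
proof -
  interpret U: vector_space "scaleC :: complex \<Rightarrow> 'a \<Rightarrow> 'a"
    by (rule vector_space_scaleC)
  interpret V: vector_space "scaleC :: complex \<Rightarrow> 'b \<Rightarrow> 'b"
    by (rule vector_space_scaleC)
  have "Vector_Spaces.linear scaleC scaleC (\<lambda>x::'a. 0::'b)"
    by unfold_locales auto
  moreover have "(\<lambda>x::'a. 0::'b) ` cball 0 1 = {0}"
    by (rule image_constant[of 0]) simp
  ultimately show ?thesis
    unfolding compact_operator_def by simp
qed

lemma M_log_nonneg:
  assumes "admissible \<phi>"
  shows "0 \<le> M_log \<phi>"
proof -
  have \<phi>: "\<phi> holomorphic_on \<bbbD>" "\<phi> ` \<bbbD> \<subseteq> \<bbbD>"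
    using assms by (auto simp: admissible_def)
  note bw = admissible_bounded_weights[OF assms]
  have "0 \<le> power_sup (\<lambda>z. v_log z * norm (deriv (deriv \<phi>) z)) \<phi> n / weight_sup w_log n" for n
    using power_sup_nonneg[OF bw(1) \<phi>(2)] weight_sup_pos[OF bounded_weight_w_log w_log_pos]
    by (intro divide_nonneg_pos)
  then have "0 \<le> limsup (\<lambda>n. ereal (power_sup (\<lambda>z. v_log z * norm (deriv (deriv \<phi>) z)) \<phi> n / weight_sup w_log n))"
    by (intro le_Limsup always_eventually) auto
  then show ?thesis
    unfolding M_log_eq[OF \<phi> bw] by (simp add: le_max_iff_disj)
qed

text \<open>Finiteness of \<open>M_log \<phi>\<close>, which permits the division, comes from the compact operator 0.\<close>

lemma M_log_le_ess_norm:
  assumes adm: "admissible \<phi>"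
  shows "M_log \<phi> \<le> ereal (1690 * ess_norm (comp_op \<phi>))"
proof -
  obtain m where m: "M_log \<phi> = ereal m"
    using M_log_nonneg[OF adm] M_log_le_onorm[OF adm compact_operator_zero]
    by (cases "M_log \<phi>") auto
  have "m / 1690 \<le> onorm (\<lambda>f. comp_op \<phi> f - K f)" if "compact_operator K" for K
    using M_log_le_onorm[OF adm that] by (simp add: m)
  then have "m / 1690 \<le> ess_norm (comp_op \<phi>)"
    unfolding ess_norm_def using compact_operator_zero by (intro cINF_greatest) auto
  then show ?thesis
    by (simp add: m)
qed

definition peak_const :: real where
  "peak_const = max (2 * exp 2) ((1 + 4 / loglog 0) * exp 2)"

lemma ess_norm_le_M_log:
  assumes adm: "admissible \<phi>"
  shows "ereal (ess_norm (comp_op \<phi>)) \<le> ereal ((3 + 2 * growth_const) * peak_const) * M_log \<phi>"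
proof -
  let ?k = "(3 + 2 * growth_const) * peak_const"
  have pc: "2 * exp 2 \<le> peak_const" "(1 + 4 / loglog 0) * exp 2 \<le> peak_const"
    by (auto simp: peak_const_def)
  have pc0: "0 < peak_const"
    using pc(1) by (rule less_le_trans[rotated]) simp
  have k: "0 < ?k"
    using growth_const_ge_1 pc0 by simp
  have \<phi>: "\<phi> holomorphic_on \<bbbD>" "\<phi> ` \<bbbD> \<subseteq> \<bbbD>"
    using adm by (auto simp: admissible_def)
  note bw = admissible_bounded_weights[OF adm]
  obtain m where m: "M_log \<phi> = ereal m" "0 \<le> m"
    using M_log_nonneg[OF adm] M_log_le_ess_norm[OF adm]
    by (cases "M_log \<phi>") auto
  have "ess_norm (comp_op \<phi>) \<le> ?k * c" if c: "m < c" for c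
  proof -
    have c0: "0 \<le> c" using m c by simp
    have "M_log \<phi> < ereal c"
      using c by (simp add: m(1))
    then have less: "limsup (\<lambda>n. ereal (power_sup (\<lambda>z. v_log z * norm (deriv (deriv \<phi>) z)) \<phi> n / weight_sup w_log n)) < ereal c"
      "limsup (\<lambda>n. ereal (power_sup (\<lambda>z. v_log z * (norm (deriv \<phi> z))\<^sup>2) \<phi> n / weight_sup v_log n)) < ereal c"
      unfolding M_log_eq[OF \<phi> bw] max_less_iff_conj by - (elim conjE, assumption)+
    have "\<exists>r<1. \<forall>z\<in>\<bbbD>. r < norm (\<phi> z) \<longrightarrow>
        v_log z * norm (deriv (deriv \<phi>) z) \<le> (1 + 4 / loglog 0) * exp 2 * c * w_log (\<phi> z)"
      by (rule le_weight_of_limsup_less[OF bounded_weight_w_log w_log_pos peaking_w_log bw(1) \<phi>(2) less(1)])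
    then obtain r1 where r1: "r1 < 1" "\<forall>z\<in>\<bbbD>. r1 < norm (\<phi> z) \<longrightarrow>
        v_log z * norm (deriv (deriv \<phi>) z) \<le> (1 + 4 / loglog 0) * exp 2 * c * w_log (\<phi> z)"
      by (elim exE conjE) (rule that)
    have "\<exists>r<1. \<forall>z\<in>\<bbbD>. r < norm (\<phi> z) \<longrightarrow>
        v_log z * (norm (deriv \<phi> z))\<^sup>2 \<le> 2 * exp 2 * c * v_log (\<phi> z)"
      by (rule le_weight_of_limsup_less[OF bounded_weight_v_log v_log_pos peaking_v_log bw(2) \<phi>(2) less(2)])
    then obtain r2 where r2: "r2 < 1" "\<forall>z\<in>\<bbbD>. r2 < norm (\<phi> z) \<longrightarrow>
        v_log z * (norm (deriv \<phi> z))\<^sup>2 \<le> 2 * exp 2 * c * v_log (\<phi> z)"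
      by (elim exE conjE) (rule that)
    have \<phi>z: "\<phi> z \<in> \<bbbD>" if "z \<in> \<bbbD>" for z
      using \<phi>(2) that by blast
    have "ess_norm (comp_op \<phi>) \<le> (3 + 2 * growth_const) * (peak_const * c)"
    proof (rule ess_norm_upper[OF adm])
      show "0 \<le> peak_const * c" "max r1 r2 < 1"
        using pc0 c0 r1(1) r2(1) by auto
      fix z :: complex
      assume z: "z \<in> \<bbbD>" "max r1 r2 < norm (\<phi> z)"
      have "2 * exp 2 * c * v_log (\<phi> z) \<le> peak_const * c * v_log (\<phi> z)"
        using pc(1) c0 v_log_pos[OF \<phi>z[OF z(1)]] by (intro mult_right_mono) auto
      then show "v_log z * (norm (deriv \<phi> z))\<^sup>2 \<le> peak_const * c * v_log (\<phi> z)"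
        using bspec[OF r2(2) z(1)] z(2) by simp
      have "(1 + 4 / loglog 0) * exp 2 * c * w_log (\<phi> z) \<le> peak_const * c * w_log (\<phi> z)"
        using pc(2) c0 w_log_pos[OF \<phi>z[OF z(1)]] by (intro mult_right_mono) auto
      then show "v_log z * norm (deriv (deriv \<phi>) z) \<le> peak_const * c * w_log (\<phi> z)"
        using bspec[OF r1(2) z(1)] z(2) by simp
    qed
    then show ?thesis by (simp add: mult_ac)
  qed
  then have "ess_norm (comp_op \<phi>) / ?k \<le> c" if "m < c" for c
    using k that by (simp add: pos_divide_le_eq mult.commute)
  then have "ess_norm (comp_op \<phi>) / ?k \<le> m"
    by (rule dense_ge)
  then show ?thesis
    using k by (simp add: m(1) pos_divide_le_eq mult.commute)
qed

theorem theorem5p2: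
  shows "\<exists>K::real. K > 0 \<and>
    (\<forall>\<phi>. \<phi> holomorphic_on \<bbbD> \<longrightarrow> \<phi> ` \<bbbD> \<subseteq> \<bbbD> \<longrightarrow> comp_op_continuous \<phi> \<longrightarrow>
      ereal (1 / K) * M_log \<phi> \<le> ereal (ess_norm (comp_op \<phi>)) \<and>
      ereal (ess_norm (comp_op \<phi>)) \<le> ereal K * M_log \<phi>)"
proof -
  define K where "K = max 1690 ((3 + 2 * growth_const) * peak_const)"
  have K: "0 < K" "1690 \<le> K" "(3 + 2 * growth_const) * peak_const \<le> K"
    by (auto simp: K_def)
  have main: "ereal (1 / K) * M_log \<phi> \<le> ereal (ess_norm (comp_op \<phi>)) \<and>
      ereal (ess_norm (comp_op \<phi>)) \<le> ereal K * M_log \<phi>" if adm: "admissible \<phi>" for \<phi>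
  proof -
    obtain m where m: "M_log \<phi> = ereal m" "0 \<le> m"
      using M_log_nonneg[OF adm] M_log_le_ess_norm[OF adm]
      by (cases "M_log \<phi>") auto
    have "m \<le> 1690 * ess_norm (comp_op \<phi>)"
      using M_log_le_ess_norm[OF adm] by (simp add: m)
    moreover from this have "1690 * ess_norm (comp_op \<phi>) \<le> K * ess_norm (comp_op \<phi>)"
      using m(2) K(2) by (intro mult_right_mono) auto
    moreover have "(3 + 2 * growth_const) * peak_const * m \<le> K * m"
      using K(3) m(2) by (rule mult_right_mono)
    moreover have "ess_norm (comp_op \<phi>) \<le> (3 + 2 * growth_const) * peak_const * m"
      using ess_norm_le_M_log[OF adm] by (simp add: m)
    ultimately show ?thesis
      using K(1) by (simp add: m pos_divide_le_eq mult.commute)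
  qed
  show ?thesis
  proof (intro exI[of _ K] conjI[OF K(1)] allI impI main)
    fix \<phi>
    assume "\<phi> holomorphic_on \<bbbD>" "\<phi> ` \<bbbD> \<subseteq> \<bbbD>" "comp_op_continuous \<phi>"
    then show "admissible \<phi>"
      by (simp add: admissible_def)
  qed
qed

end
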